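(* The pair $(\rho^0_{CR},(\mathcal{M}^t_{CR\to CR})_{t\ge 0})$ forms a ticking clock with a classical tick register, up to clockwork equivalence, if and only if there exist a Hermitian operator $H$ and two finite sequences of operators $(L_j)_{j=1}^{N_L}$ and $(J_j)_{j=1}^{N_L}$ in $\mathcal{B}(\mathcal{H}_C)$, all independent of $t$, such that for all $t\ge 0$ and $N_T\in\mathbb{N}_{>0}$, $$\mathcal{M}^t_{CR\to CR}(\cdot)=e^{t\mathcal{L}_{CR}}(\cdot),$$ $$\mathcal{L}_{CR}(\cdot)=-i[\tilde H,(\cdot)]+\sum_{j=1}^{N_L}\Big(\tilde L_j(\cdot)\tilde L_j^\dagger-\tfrac12\{\tilde L_j^\dagger\tilde L_j,(\cdot)\}\Big)+\sum_{j=1}^{N_L}\Big(\tilde J_j^{(l)}(\cdot)\tilde J_j^{(l)\dagger}-\tfrac12\{\tilde J_j^{(l)\dagger}\tilde J_j^{(l)},(\cdot)\}\Big),$$ where $\tilde H=H\otimes\mathbb{1}_R$, $\tilde L_j=L_j\otimes\mathbb{1}_R$, $\tilde J_j^{(l)}=J_j\otimes O_R^{(l)}$, and $$O_R^{(l)}:=|1\rangle\langle 0|_R+|2\rangle\langle 1|_R+|3\rangle\langle 2|_R+\dots+|N_T\rangle\langle N_T-1|_R+l\,|0\rangle\langle N_T|_R ,$$ with $l=0$ in the cut-off register case and $l=1$ in the periodic register case.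
   Context: Notation. $\mathcal{H}_C$ is a finite-dimensional complex Hilbert space (the clockwork). $\mathcal{H}_R$ is the complex Hilbert space with orthonormal basis $|0\rangle_R,\dots,|N_T\rangle_R$ (the tick register), $N_T\in\mathbb{N}_{>0}$. $\mathcal{B}(\mathcal{H})$ denotes the (bounded) linear operators and $\mathcal{S}(\mathcal{H})$ the density operators on $\mathcal{H}$. A channel is a completely positive trace-preserving linear map. $\{A,B\}=AB+BA$. $\mathrm{tr}_C,\mathrm{tr}_R$ are partial traces; tensor products with identities are omitted when clear. $(\mathcal{M}^t_{CR\to CR})_{t\ge0}$ is a family of channels on $\mathcal{B}(\mathcal{H}_C\otimes\mathcal{H}_R)$, and for $k=0,\dots,N_T$ $$\mathcal{M}^{t,k}_{C\to CR}(\cdot):=\mathcal{M}^t_{CR\to CR}\big((\cdot)\otimes|k\rangle\langle k|_R\big).$$ $o(\cdot)$ is little-o notation. There are two kinds of register, periodic and cut-off. The periodic register satisfies $|n\rangle_R=|n\bmod (N_T+1)\rangle_R$ for $n\in\mathbb{Z}$. Conditions. 1) (Time invariance) $\mathrm{tr}_R[\mathcal{M}^{t,k}_{C\to CR}(\rho_C)\,|k+l\rangle\langle k+l|_R]=\mathrm{tr}_R[\mathcal{M}^{t,k'}_{C\to CR}(\rho_C)\,|k'+l\rangle\langle k'+l|_R]$ for all $t\ge0$, $\rho_C\in\mathcal{S}(\mathcal{H}_C)$, and all $l\in\mathbb{Z}$, $k,k'\in\{0,1,\dots,N_T\}$ such that $k+l,\,k'+l\in\{0,1,\dots,N_T\}$.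 2) (Self-timing) $\mathcal{M}^{t_1+t_2}_{CR\to CR}=\mathcal{M}^{t_2}_{CR\to CR}\circ\mathcal{M}^{t_1}_{CR\to CR}$ for all $t_1,t_2\ge0$. 3) (Zeroth order) $\mathcal{M}^0_{CR\to CR}$ is the identity channel $\mathcal{I}_{CR}$ and $\lim_{t\to0^+}\|\mathcal{M}^t_{CR\to CR}-\mathcal{I}_{CR}\|=0$. 4) (Leading order) With $\tilde p^{(k)}_l(t):=\mathrm{tr}[\mathcal{M}^{t,k}_{C\to CR}(\rho_C)\,|l\rangle\langle l|_R]$ and $f(k)=k+1\bmod (N_T+1)$, $$\lim_{t\to0^+}\frac{\sum_{0\le l\le N_T,\ l\notin\{k,f(k)\}}\tilde p^{(k)}_l(t)}{\tilde p^{(k)}_{f(k)}(t)}=0$$ for all $k\in\{0,\dots,N_T\}$ and $\rho_C\in\mathcal{S}(\mathcal{H}_C)$. 5) (Cut-off register) There exists a ticking clock channel with a periodic register, denoted $\tilde{\mathcal{M}}^t_{CR\to CR}$ and satisfying 1)–4), such that in the limit $t\to0^+$, for all $\rho_C\in\mathcal{S}(\mathcal{H}_C)$: (5a) $\mathcal{M}^{t,k}_{C\to CR}(\rho_C)=\tilde{\mathcal{M}}^{t,k}_{C\to CR}(\rho_C)+o(t)$ for $k=0,\dots,N_T-1$; and (5b) $\mathrm{tr}_C[\mathcal{M}^{t,N_T}_{C\to CR}(\rho_C)]=|N_T\rangle\langle N_T|_R+o(t)$. Ticking clock: a pair $(\rho^0_{CR},(\mathcal{M}^t_{CR\to CR})_{t\ge0})$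 with $\rho^0_{CR}\in\mathcal{S}(\mathcal{H}_C\otimes\mathcal{H}_R)$ (the state of clockwork and register at time $t=0$) such that the channels satisfy 1)–4) in the case of a periodic register, and 2) and 5) in the case of a cut-off register. Classical register: for all $t\ge0$, $k=0,\dots,N_T$ and $\rho_C\in\mathcal{S}(\mathcal{H}_C)$, $\mathcal{M}^{t,k}_{C\to CR}(\rho_C)=\sum_{n=0}^{N_T}\rho_C^{(n;k)}(t)\otimes|n\rangle\langle n|_R$, where the $\rho_C^{(n;k)}(t)$ are arbitrary subnormalised states on $\mathcal{H}_C$. Clockwork equivalence: two ticking clocks with a cut-off register are said to be clockwork equivalent if the two following conditions are both satisfied: (a) their underlying ticking clock channels with a periodic register in (5a), namely $\tilde{\mathcal{M}}^t_{CR\to CR}$, are the same in both cases; (b) the states of their clockwork when inputting the register state $|N_T\rangle\langle N_T|_R$, namely $\mathrm{tr}_R[\mathcal{M}^{t,N_T}_{C\to CR}(\rho_C)]$, differ for some $t\ge0$ and $\rho_C\in\mathcal{S}(\mathcal{H}_C)$.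
   Formalization: In the "only if" direction, M^t = e^{tL} is proved for inputs A⊗|k><k| only (it can fail on register coherences); in condition 1) the labels k+l, k'+l are read modulo N_T+1 for a periodic register; in condition 4) the quotient 0/0 is read as 0. *)

theory Defs
  imports "HOL-Analysis.Analysis" "HOL-Library.Landau_Symbols"
begin

section \<open>Operators on finite-dimensional Hilbert spaces\<close>

text \<open>
  A finite-dimensional complex Hilbert space is \<open>complex ^ 'n\<close> with its standard inner product, and
  its operators are the square matrices. The composite system has the index type \<open>'c \<times> 'r\<close>.
\<close>

type_synonym 'n operator = "complex ^ 'n ^ 'n"

definition cscale :: "complex \<Rightarrow> 'n::finite operator \<Rightarrow> 'n operator"  (infixr "*\<^sub>c" 75) where
  "c *\<^sub>c A = (\<chi> i j. c * A $ i $ j)"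

definition dagger :: "'n::finite operator \<Rightarrow> 'n operator"  ("(_\<^sup>\<dagger>)" [1000] 999) where
  "A\<^sup>\<dagger> = (\<chi> i j. cnj (A $ j $ i))"

definition hermitian :: "'n::finite operator \<Rightarrow> bool" where
  "hermitian A \<longleftrightarrow> A\<^sup>\<dagger> = A"

definition cinner :: "complex ^ 'n::finite \<Rightarrow> complex ^ 'n \<Rightarrow> complex" where
  "cinner u v = (\<Sum>i\<in>UNIV. cnj (u $ i) * v $ i)"

definition psd :: "'n::finite operator \<Rightarrow> bool" where
  "psd A \<longleftrightarrow> (\<forall>v. cinner v (A *v v) \<in> \<real>\<^sub>\<ge>\<^sub>0)"

definition density_op :: "'n::finite operator \<Rightarrow> bool" where
  "density_op \<rho> \<longleftrightarrow> psd \<rho> \<and> trace \<rho> = 1"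

definition subnormalised_state :: "'n::finite operator \<Rightarrow> bool" where
  "subnormalised_state \<rho> \<longleftrightarrow> psd \<rho> \<and> Re (trace \<rho>) \<le> 1"

definition tensor :: "'c::finite operator \<Rightarrow> 'r::finite operator \<Rightarrow> ('c \<times> 'r) operator"
    (infixr "\<otimes>" 72) where
  "A \<otimes> B = (\<chi> i j. A $ fst i $ fst j * B $ snd i $ snd j)"

definition ptrace_R :: "('c::finite \<times> 'r::finite) operator \<Rightarrow> 'c operator" where
  "ptrace_R X = (\<chi> i j. \<Sum>r\<in>UNIV. X $ (i, r) $ (j, r))"

definition ptrace_C :: "('c::finite \<times> 'r::finite) operator \<Rightarrow> 'r operator" where
  "ptrace_C X = (\<chi> r s. \<Sum>i\<in>UNIV. X $ (i, r) $ (i, s))"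

definition commutator :: "'n::finite operator \<Rightarrow> 'n operator \<Rightarrow> 'n operator" where
  "commutator A B = A ** B - B ** A"

definition anticommutator :: "'n::finite operator \<Rightarrow> 'n operator \<Rightarrow> 'n operator" where
  "anticommutator A B = A ** B + B ** A"


section \<open>Channels\<close>

definition clinear_map :: "('n::finite operator \<Rightarrow> 'n operator) \<Rightarrow> bool" where
  "clinear_map \<Phi> \<longleftrightarrow> (\<forall>X Y. \<Phi> (X + Y) = \<Phi> X + \<Phi> Y) \<and> (\<forall>c X. \<Phi> (c *\<^sub>c X) = c *\<^sub>c \<Phi> X)"

text \<open>
  \<open>X i j\<close>, for \<open>i, j < n\<close>, are the blocks of an operator on the tensor product of an
  \<open>n\<close>-dimensional ancilla with the system; the identity on the ancilla tensored with \<open>\<Phi>\<close> applies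
  \<open>\<Phi>\<close> to each block. This way the ancilla dimension can be quantified over in a definition.
\<close>

definition block_psd :: "nat \<Rightarrow> (nat \<Rightarrow> nat \<Rightarrow> 'n::finite operator) \<Rightarrow> bool" where
  "block_psd n X \<longleftrightarrow>
    (\<forall>v :: nat \<Rightarrow> complex ^ 'n. (\<Sum>i<n. \<Sum>j<n. cinner (v i) (X i j *v v j)) \<in> \<real>\<^sub>\<ge>\<^sub>0)"

definition completely_positive :: "('n::finite operator \<Rightarrow> 'n operator) \<Rightarrow> bool" where
  "completely_positive \<Phi> \<longleftrightarrow> (\<forall>n X. block_psd n X \<longrightarrow> block_psd n (\<lambda>i j. \<Phi> (X i j)))"

definition channel :: "('n::finite operator \<Rightarrow> 'n operator) \<Rightarrow> bool" where
  "channel \<Phi> \<longleftrightarrow> clinear_map \<Phi> \<and> completely_positive \<Phi> \<and> (\<forall>X. trace (\<Phi> X) = trace X)"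


section \<open>Tick register\<close>

text \<open>
  The register has one index \<open>tick n\<close> for each label \<open>n = 0, \<dots>, NT\<close>. Throughout, \<open>tick\<close> is a
  bijection from \<open>{0..NT}\<close> onto the index type \<open>'r\<close>, so that \<open>ketbra tick m n\<close> is the operator
  \<open>|m><n|\<close> for an orthonormal basis \<open>|0>, \<dots>, |NT>\<close>. Values of \<open>tick\<close> outside \<open>{0..NT}\<close> are
  never used.
\<close>

datatype register = Periodic | Cutoff

definition tick_labelling :: "(nat \<Rightarrow> 'r::finite) \<Rightarrow> nat \<Rightarrow> bool" where
  "tick_labelling tick NT \<longleftrightarrow> bij_betw tick {0..NT} UNIV"

definition ketbra :: "(nat \<Rightarrow> 'r::finite) \<Rightarrow> nat \<Rightarrow> nat \<Rightarrow> 'r operator" where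
  "ketbra tick m n = (\<chi> i j. if i = tick m \<and> j = tick n then 1 else 0)"

abbreviation tick_proj :: "(nat \<Rightarrow> 'r::finite) \<Rightarrow> nat \<Rightarrow> 'r operator" where
  "tick_proj tick n \<equiv> ketbra tick n n"

text \<open>The label of \<open>|n>\<close> for a periodic register and an integer \<open>n\<close>.\<close>

definition periodic_label :: "nat \<Rightarrow> int \<Rightarrow> nat" where
  "periodic_label NT n = nat (n mod (int NT + 1))"


section \<open>Ticking clocks\<close>

type_synonym ('c, 'r) dynamics = "real \<Rightarrow> ('c \<times> 'r) operator \<Rightarrow> ('c \<times> 'r) operator"

definition from_tick ::
    "(nat \<Rightarrow> 'r::finite) \<Rightarrow> ('c::finite, 'r) dynamics \<Rightarrow> real \<Rightarrow> nat \<Rightarrow> 'c operator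
      \<Rightarrow> ('c \<times> 'r) operator" where
  "from_tick tick M t k \<rho> = M t (\<rho> \<otimes> tick_proj tick k)"

text \<open>
  This condition is only imposed on periodic registers, whose labels are integers modulo
  \<open>NT + 1\<close>; in particular the transition from \<open>NT\<close> to \<open>0\<close> is compared with the one from \<open>0\<close>
  to \<open>1\<close>.
\<close>

definition time_invariance ::
    "(nat \<Rightarrow> 'r::finite) \<Rightarrow> nat \<Rightarrow> ('c::finite, 'r) dynamics \<Rightarrow> bool" where
  "time_invariance tick NT M \<longleftrightarrow>
    (\<forall>t\<ge>0. \<forall>\<rho>. density_op \<rho> \<longrightarrow> (\<forall>l::int. \<forall>k\<le>NT. \<forall>k'\<le>NT.
      ptrace_R (from_tick tick M t k \<rho> **
                 (mat 1 \<otimes> tick_proj tick (periodic_label NT (int k + l)))) =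
      ptrace_R (from_tick tick M t k' \<rho> **
                 (mat 1 \<otimes> tick_proj tick (periodic_label NT (int k' + l))))))"

definition self_timing :: "('c::finite, 'r::finite) dynamics \<Rightarrow> bool" where
  "self_timing M \<longleftrightarrow> (\<forall>t1\<ge>0. \<forall>t2\<ge>0. M (t1 + t2) = M t2 \<circ> M t1)"

definition zeroth_order :: "('c::finite, 'r::finite) dynamics \<Rightarrow> bool" where
  "zeroth_order M \<longleftrightarrow>
    M 0 = id \<and> ((\<lambda>t. onorm (\<lambda>X. M t X - X)) \<longlongrightarrow> 0) (at_right 0)"

definition tick_prob ::
    "(nat \<Rightarrow> 'r::finite) \<Rightarrow> ('c::finite, 'r) dynamics \<Rightarrow> 'c operator \<Rightarrow> nat \<Rightarrow> nat \<Rightarrow> real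
      \<Rightarrow> real" where
  "tick_prob tick M \<rho> k l t = Re (trace (from_tick tick M t k \<rho> ** (mat 1 \<otimes> tick_proj tick l)))"

text \<open>
  The second conjunct excludes the quotients \<open>x / 0 = 0\<close> with \<open>x \<noteq> 0\<close>, so that only \<open>0 / 0\<close> is
  read as \<open>0\<close>. The latter occurs, for instance, when the clock never ticks.
\<close>

definition leading_order ::
    "(nat \<Rightarrow> 'r::finite) \<Rightarrow> nat \<Rightarrow> ('c::finite, 'r) dynamics \<Rightarrow> bool" where
  "leading_order tick NT M \<longleftrightarrow>
    (\<forall>k\<le>NT. \<forall>\<rho>. density_op \<rho> \<longrightarrow>
      (let f = (k + 1) mod (NT + 1);
           others = (\<lambda>t. \<Sum>l\<in>{0..NT} - {k, f}. tick_prob tick M \<rho> k l t);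
           next_tick = tick_prob tick M \<rho> k f
       in ((\<lambda>t. others t / next_tick t) \<longlongrightarrow> 0) (at_right 0) \<and>
          (\<forall>\<^sub>F t in at_right 0. next_tick t = 0 \<longrightarrow> others t = 0)))"

definition periodic_clock_channels ::
    "(nat \<Rightarrow> 'r::finite) \<Rightarrow> nat \<Rightarrow> ('c::finite, 'r) dynamics \<Rightarrow> bool" where
  "periodic_clock_channels tick NT M \<longleftrightarrow>
    (\<forall>t\<ge>0. channel (M t)) \<and> time_invariance tick NT M \<and> self_timing M \<and> zeroth_order M \<and>
    leading_order tick NT M"

text \<open>\<open>M'\<close> is an underlying periodic clock of the cut-off clock \<open>M\<close>.\<close>

definition underlying_periodic ::
    "(nat \<Rightarrow> 'r::finite) \<Rightarrow> nat \<Rightarrow> ('c::finite, 'r) dynamics \<Rightarrow> ('c, 'r) dynamics \<Rightarrow> bool" where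
  "underlying_periodic tick NT M M' \<longleftrightarrow>
    periodic_clock_channels tick NT M' \<and>
    (\<forall>\<rho>. density_op \<rho> \<longrightarrow>
      (\<forall>k<NT. (\<lambda>t. norm (from_tick tick M t k \<rho> - from_tick tick M' t k \<rho>))
                 \<in> o[at_right 0](\<lambda>t. t)) \<and>
      (\<lambda>t. norm (ptrace_C (from_tick tick M t NT \<rho>) - tick_proj tick NT))
         \<in> o[at_right 0](\<lambda>t. t))"

fun ticking_clock ::
    "register \<Rightarrow> (nat \<Rightarrow> 'r::finite) \<Rightarrow> nat \<Rightarrow> ('c::finite \<times> 'r) operator \<Rightarrow> ('c, 'r) dynamics
      \<Rightarrow> bool" where
  "ticking_clock Periodic tick NT \<rho>0 M \<longleftrightarrow>
    density_op \<rho>0 \<and> periodic_clock_channels tick NT M"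
| "ticking_clock Cutoff tick NT \<rho>0 M \<longleftrightarrow>
    density_op \<rho>0 \<and> (\<forall>t\<ge>0. channel (M t)) \<and> self_timing M \<and>
    (\<exists>M'. underlying_periodic tick NT M M')"

definition classical_register ::
    "(nat \<Rightarrow> 'r::finite) \<Rightarrow> nat \<Rightarrow> ('c::finite, 'r) dynamics \<Rightarrow> bool" where
  "classical_register tick NT M \<longleftrightarrow>
    (\<forall>t\<ge>0. \<forall>k\<le>NT. \<forall>\<rho>. density_op \<rho> \<longrightarrow>
      (\<exists>\<sigma>. (\<forall>n\<le>NT. subnormalised_state (\<sigma> n)) \<and>
           from_tick tick M t k \<rho> = (\<Sum>n\<in>{0..NT}. \<sigma> n \<otimes> tick_proj tick n)))"

definition clockwork_equivalent ::
    "(nat \<Rightarrow> 'r::finite) \<Rightarrow> nat \<Rightarrow> ('c::finite \<times> 'r) operator \<Rightarrow> ('c, 'r) dynamics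
      \<Rightarrow> ('c \<times> 'r) operator \<Rightarrow> ('c, 'r) dynamics \<Rightarrow> bool" where
  "clockwork_equivalent tick NT \<rho>1 M1 \<rho>2 M2 \<longleftrightarrow>
    ticking_clock Cutoff tick NT \<rho>1 M1 \<and> ticking_clock Cutoff tick NT \<rho>2 M2 \<and>
    (\<exists>M'. underlying_periodic tick NT M1 M' \<and> underlying_periodic tick NT M2 M') \<and>
    (\<exists>t\<ge>0. \<exists>\<rho>. density_op \<rho> \<and>
      ptrace_R (from_tick tick M1 t NT \<rho>) \<noteq> ptrace_R (from_tick tick M2 t NT \<rho>))"

text \<open>
  The conditions on a clock with a classical register constrain the dynamics only on operators
  \<open>A \<otimes> |k><k|\<close>, not on coherences \<open>A \<otimes> |k><k'|\<close> with \<open>k \<noteq> k'\<close>: composing the dynamics with a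
  dephasing of the register in the basis \<open>|0>, \<dots>, |NT>\<close> preserves all of them.
\<close>

definition agree_on_ticks ::
    "(nat \<Rightarrow> 'r::finite) \<Rightarrow> nat \<Rightarrow> ('c::finite, 'r) dynamics \<Rightarrow> ('c, 'r) dynamics \<Rightarrow> bool" where
  "agree_on_ticks tick NT M1 M2 \<longleftrightarrow>
    (\<forall>t\<ge>0. \<forall>k\<le>NT. \<forall>A. from_tick tick M1 t k A = from_tick tick M2 t k A)"


section \<open>Explicit form of the dynamics\<close>

definition superop_exp ::
    "(('c::finite \<times> 'r::finite) operator \<Rightarrow> ('c \<times> 'r) operator) \<Rightarrow> ('c, 'r) dynamics" where
  "superop_exp \<L> t X = (\<Sum>n. (t ^ n / fact n) *\<^sub>R (\<L> ^^ n) X)"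

definition dissipator :: "'n::finite operator \<Rightarrow> 'n operator \<Rightarrow> 'n operator" where
  "dissipator K X = K ** X ** K\<^sup>\<dagger> - (1/2) *\<^sub>R anticommutator (K\<^sup>\<dagger> ** K) X"

fun wrap_coeff :: "register \<Rightarrow> complex" where
  "wrap_coeff Cutoff = 0"
| "wrap_coeff Periodic = 1"

definition tick_shift :: "register \<Rightarrow> (nat \<Rightarrow> 'r::finite) \<Rightarrow> nat \<Rightarrow> 'r operator" where
  "tick_shift reg tick NT =
    (\<Sum>n<NT. ketbra tick (n + 1) n) + wrap_coeff reg *\<^sub>c ketbra tick 0 NT"

definition clock_generator ::
    "register \<Rightarrow> (nat \<Rightarrow> 'r::finite) \<Rightarrow> nat \<Rightarrow> 'c::finite operator \<Rightarrow> nat \<Rightarrow> (nat \<Rightarrow> 'c operator)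
      \<Rightarrow> (nat \<Rightarrow> 'c operator) \<Rightarrow> ('c \<times> 'r) operator \<Rightarrow> ('c \<times> 'r) operator" where
  "clock_generator reg tick NT H NL L J X =
    (- \<i>) *\<^sub>c commutator (H \<otimes> mat 1) X
    + (\<Sum>j=1..NL. dissipator (L j \<otimes> mat 1) X)
    + (\<Sum>j=1..NL. dissipator (J j \<otimes> tick_shift reg tick NT) X)"

end

theory Submission
  imports Defs
begin

text \<open>
  A norm-continuous semigroup of channels has a generator \<open>G\<close>. For a periodic clock, time invariance
  makes the register blocks of \<open>G (A \<otimes> |k><k|)\<close> depend only on the number of ticks, and the leading
  order condition, together with positivity, kills all blocks except those of no tick and of one tick.
  The one-tick block is a limit of completely positive maps and has a Kraus form with operators \<open>J\<^sub>j\<close>;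
  the no-tick block is conditionally completely positive and yields \<open>H\<close> and \<open>L\<^sub>j\<close>. Trace preservation
  fixes the anticommutator terms. Semigroups with the same derivative at \<open>0\<close> on register-diagonal
  operators agree there.

  For a cut-off clock, (5a) transfers this to all register states but the last one, and (5b) says that
  the last one is left with probability \<open>o(t)\<close>, hence never. So two cut-off clocks with the same
  underlying periodic clock can only differ in the clockwork state reached from \<open>|NT>\<close>.

  Conversely, the explicit dynamics is completely positive by approximating the exponential with
  powers of manifestly completely positive maps, and the leading order condition follows from a
  differential inequality for the tick probabilities.
\<close>

text \<open>The obstacle behind the structure of the proof is that the conditions see only operators
  \<open>A \<otimes> |k><k|\<close> and leave the register coherences free, so the channels
  themselves need not equal the explicit semigroup. They are compared after composition with the
  dephasing \<Delta> of the register. A classical register makes \<open>M t \<circ> \<Delta>\<close>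
  a semigroup again, but one that starts at a projection instead of the identity; the uniqueness
  argument therefore uses positive times only and compares n-th powers at time \<open>t / n\<close>.
  A cut-off clock is assumed neither continuous at 0 nor to start at the identity; its first-order
  behaviour below \<open>|NT>\<close> is inherited from the underlying periodic clock. That periodic
  clock need not have a classical register, so only the register-diagonal part of its generator can
  be identified; the classical register of the given clock removes the rest. All conditions are
  stated for states. They reach arbitrary operators because density operators span.\<close>

section \<open>Bounded endomorphisms as a Banach algebra\<close>

typedef (overloaded) 'a endo = "UNIV :: ('a::real_normed_vector \<Rightarrow>\<^sub>L 'a) set"
  morphisms blinfun_of_endo endo_of_blinfun ..

setup_lifting type_definition_endo

instantiation endo :: (real_normed_vector) real_normed_vector
begin

lift_definition zero_endo :: "'a endo" is 0 .
lift_definition plus_endo :: "'a endo \<Rightarrow> 'a endo \<Rightarrow> 'a endo" is "(+)" .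
lift_definition minus_endo :: "'a endo \<Rightarrow> 'a endo \<Rightarrow> 'a endo" is "(-)" .
lift_definition uminus_endo :: "'a endo \<Rightarrow> 'a endo" is uminus .
lift_definition scaleR_endo :: "real \<Rightarrow> 'a endo \<Rightarrow> 'a endo" is scaleR .
lift_definition norm_endo :: "'a endo \<Rightarrow> real" is norm .
definition sgn_endo :: "'a endo \<Rightarrow> 'a endo" where "sgn_endo x = scaleR (inverse (norm x)) x"
definition dist_endo :: "'a endo \<Rightarrow> 'a endo \<Rightarrow> real" where "dist_endo x y = norm (x - y)"
definition uniformity_endo :: "('a endo \<times> 'a endo) filter"
  where "uniformity_endo = (INF e\<in>{0<..}. principal {(x, y). dist x y < e})"
definition open_endo :: "'a endo set \<Rightarrow> bool"
  where "open_endo U = (\<forall>x\<in>U. eventually (\<lambda>(x', y). x' = x \<longrightarrow> y \<in> U) uniformity)"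

instance
proof
  fix x y z :: "'a endo" and a b :: real
  show "x + y + z = x + (y + z)" "x + y = y + x" "0 + x = x" "- x + x = 0" "x - y = x + - y"
    "a *\<^sub>R (x + y) = a *\<^sub>R x + a *\<^sub>R y" "(a + b) *\<^sub>R x = a *\<^sub>R x + b *\<^sub>R x"
    "a *\<^sub>R b *\<^sub>R x = (a * b) *\<^sub>R x" "1 *\<^sub>R x = x"
    "norm x = 0 \<longleftrightarrow> x = 0" "norm (x + y) \<le> norm x + norm y" "norm (a *\<^sub>R x) = \<bar>a\<bar> * norm x"
    by (transfer; simp add: algebra_simps norm_triangle_ineq)+
qed (simp_all add: sgn_endo_def dist_endo_def uniformity_endo_def open_endo_def)

end

text \<open>On the diagonal type \<open>'a \<Rightarrow>\<^sub>L 'a\<close> composition is a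
  multiplication, which makes powers, geometric series and \<open>exp\<close> available for
  superoperators. \<open>perfect_space\<close> excludes the zero space, where the identity has norm
  0.\<close>

instantiation endo :: ("{real_normed_vector, perfect_space}") real_normed_algebra_1
begin

lift_definition one_endo :: "'a endo" is id_blinfun .
lift_definition times_endo :: "'a endo \<Rightarrow> 'a endo \<Rightarrow> 'a endo" is blinfun_compose .

instance
proof
  fix x y z :: "'a endo" and a :: real
  show "x * y * z = x * (y * z)" by transfer (rule blinfun_eqI, simp)
  show "(x + y) * z = x * z + y * z" "x * (y + z) = x * y + x * z"
    "a *\<^sub>R x * y = a *\<^sub>R (x * y)" "x * a *\<^sub>R y = a *\<^sub>R (x * y)"
    by (transfer; intro blinfun_eqI; simp add: blinfun.bilinear_simps)+
  show "1 * x = x" "x * 1 = x" by (transfer; intro blinfun_eqI; simp)+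
  show "norm (x * y) \<le> norm x * norm y" by transfer (rule norm_blinfun_compose)
  show "norm (1 :: 'a endo) = 1" by transfer (rule norm_blinfun_id)
  have "norm (1 :: 'a endo) \<noteq> norm (0 :: 'a endo)" by transfer simp
  then show "(0 :: 'a endo) \<noteq> 1" by auto
qed

end

instance endo :: ("{banach, perfect_space}") banach
proof
  fix X :: "nat \<Rightarrow> 'a endo"
  assume "Cauchy X"
  then have "Cauchy (\<lambda>n. blinfun_of_endo (X n))"
    unfolding Cauchy_def dist_norm norm_endo.rep_eq minus_endo.rep_eq .
  then obtain L where "(\<lambda>n. blinfun_of_endo (X n)) \<longlonglongrightarrow> L"
    using Cauchy_convergent convergentD by blast
  then have "X \<longlonglongrightarrow> endo_of_blinfun L"
    by (simp add: tendsto_iff dist_norm norm_endo.rep_eq minus_endo.rep_eq endo_of_blinfun_inverse)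
  then show "convergent X" by (rule convergentI)
qed

lift_definition app :: "'a::real_normed_vector endo \<Rightarrow> 'a \<Rightarrow> 'a" is blinfun_apply .

lemma bounded_bilinear_app: "bounded_bilinear app"
proof
  show "\<exists>K. \<forall>(a :: 'a endo) b. norm (app a b) \<le> norm a * norm b * K"
    by (intro exI[of _ 1]; transfer) (simp add: norm_blinfun)
qed (transfer; simp add: blinfun.bilinear_simps)+

interpretation app: bounded_bilinear app
  by (rule bounded_bilinear_app)

lemma app_one [simp]: "app 1 x = x"
  by transfer simp

lemma app_times [simp]: "app (f * g) x = app f (app g x)"
  by transfer simp

lemma app_power: "app (f ^ n) x = ((app f) ^^ n) x"
  by (induction n) auto

lemma linear_app: "linear (app f)"
  by (simp add: app.bounded_linear_right bounded_linear.linear)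

lemma endo_eqI: "(\<And>x. app f x = app g x) \<Longrightarrow> f = g"
  by transfer (rule blinfun_eqI)

definition endo :: "('a::euclidean_space \<Rightarrow> 'a) \<Rightarrow> 'a endo" where
  "endo f = endo_of_blinfun (Blinfun f)"

lemma app_endo: "linear f \<Longrightarrow> app (endo f) = f"
  unfolding endo_def app.rep_eq
  by (simp add: endo_of_blinfun_inverse bounded_linear_Blinfun_apply linear_conv_bounded_linear)

lemma norm_endo_eq_onorm: "norm f = onorm (app f)"
  by transfer (simp add: norm_blinfun.rep_eq)

text \<open>In finite dimension strong convergence is norm convergence, as it can be tested on a
  basis. Limits of superoperators are thus computed on one argument at a time.\<close>

lemma tendsto_endo:
  fixes f :: "'b \<Rightarrow> 'a::euclidean_space endo"
  assumes "\<And>x. ((\<lambda>t. app (f t) x) \<longlongrightarrow> app g x) F"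
  shows "(f \<longlongrightarrow> g) F"
proof -
  have "((\<lambda>t. blinfun_of_endo (f t)) \<longlongrightarrow> blinfun_of_endo g) F"
    using assms by (intro tendsto_componentwise1) (simp add: app.rep_eq)
  then show ?thesis
    by (simp add: tendsto_iff dist_norm norm_endo.rep_eq minus_endo.rep_eq)
qed

lemma tendsto_app: "(f \<longlongrightarrow> g) F \<Longrightarrow> ((\<lambda>t. app (f t) x) \<longlongrightarrow> app g x) F"
  by (intro tendsto_intros app.tendsto)

subsection \<open>One-parameter semigroups in Banach algebras\<close>

text \<open>Telescoping: each of the n summands has a single factor \<open>x - y\<close> between two
  bounded powers. The linear growth in n is harmless when \<open>norm (x - y)\<close> is
  \<open>o(1 / n)\<close>.\<close>

lemma power_diff_bound:
  fixes x y :: "'a::real_normed_algebra_1"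
  assumes x: "\<And>k. k \<le> n \<Longrightarrow> norm (x ^ k) \<le> B" and y: "\<And>k. k \<le> n \<Longrightarrow> norm (y ^ k) \<le> B"
  shows "norm (x ^ n - y ^ n) \<le> real n * B\<^sup>2 * norm (x - y)"
proof -
  have B: "0 \<le> B" using x[of 0] by simp
  have tele: "x ^ m - y ^ m = (\<Sum>k<m. x ^ k * (x - y) * y ^ (m - Suc k))" for m
  proof (induction m)
    case (Suc m)
    have "x ^ Suc m - y ^ Suc m = (x ^ m - y ^ m) * y + x ^ m * (x - y)"
      by (simp add: algebra_simps power_commutes)
    also have "(x ^ m - y ^ m) * y = (\<Sum>k<m. x ^ k * (x - y) * y ^ (Suc m - Suc k))"
      unfolding Suc.IH sum_distrib_right
    proof (rule sum.cong)
      fix k assume "k \<in> {..<m}"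
      then have "Suc m - Suc k = Suc (m - Suc k)" by auto
      then show "x ^ k * (x - y) * y ^ (m - Suc k) * y = x ^ k * (x - y) * y ^ (Suc m - Suc k)"
        by (simp only: power_Suc2 mult.assoc)
    qed simp
    finally show ?case by simp
  qed simp
  have "norm (x ^ n - y ^ n) \<le> (\<Sum>k<n. B * norm (x - y) * B)"
    unfolding tele
  proof (rule sum_norm_le)
    fix k assume "k \<in> {..<n}"
    then have "norm (x ^ k) \<le> B" "norm (y ^ (n - Suc k)) \<le> B" using x y by auto
    then show "norm (x ^ k * (x - y) * y ^ (n - Suc k)) \<le> B * norm (x - y) * B"
      using B by (intro order_trans[OF norm_mult_ineq] mult_mono) (auto intro: order_trans[OF norm_mult_ineq] mult_mono)
  qed
  also have "\<dots> = real n * B\<^sup>2 * norm (x - y)" by (simp add: power2_eq_square)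
  finally show ?thesis .
qed

text \<open>The exponent \<open>Suc n\<close> keeps the value \<open>T 0\<close> out of the
  statement, since it need not be 1 for the dephased semigroups.\<close>

lemma semigroup_power:
  fixes T :: "real \<Rightarrow> 'a::monoid_mult"
  assumes "\<And>s t. 0 < s \<Longrightarrow> 0 < t \<Longrightarrow> T (s + t) = T s * T t" and "0 < h"
  shows "T (real (Suc n) * h) = T h ^ Suc n"
proof (induction n)
  case (Suc n)
  have "T (real (Suc (Suc n)) * h) = T (h + real (Suc n) * h)" by (simp add: algebra_simps)
  also have "\<dots> = T h * T (real (Suc n) * h)" using assms by (intro assms(1)) auto
  finally show ?case using Suc by simp
qed simp

text \<open>Cut \<open>s\<close> into \<open>Suc N\<close> equal pieces shorter than
  \<open>d\<close>; the number of pieces depends on \<open>t\<close> only, so the bound is uniform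
  in \<open>s\<close>.\<close>

lemma semigroup_locally_bounded:
  fixes T :: "real \<Rightarrow> 'a::real_normed_algebra_1"
  assumes T: "\<And>s t. 0 < s \<Longrightarrow> 0 < t \<Longrightarrow> T (s + t) = T s * T t"
    and bd: "\<forall>\<^sub>F t in at_right 0. norm (T t) \<le> B"
  shows "\<exists>B'. \<forall>s. 0 < s \<and> s \<le> t \<longrightarrow> norm (T s) \<le> B'"
proof -
  obtain d where d: "0 < d" "\<And>s. 0 < s \<Longrightarrow> s < d \<Longrightarrow> norm (T s) \<le> B"
    using bd unfolding eventually_at_right_field by auto
  define B1 where "B1 = max 1 B"
  obtain N :: nat where N: "t / d < real N" using reals_Archimedean2 by blast
  have "norm (T s) \<le> B1 ^ Suc N" if "0 < s" "s \<le> t" for s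
  proof -
    define h where "h = s / real (Suc N)"
    have "s < d * real N" using N d that by (simp add: field_simps)
    also have "\<dots> \<le> d * real (Suc N)" using d by simp
    finally have h: "0 < h" "h < d" using that by (auto simp: h_def field_simps)
    have "T s = T h ^ Suc N" using semigroup_power[of T h N] T h by (simp add: h_def)
    also have "norm \<dots> \<le> norm (T h) ^ Suc N" by (rule norm_power_ineq)
    also have "\<dots> \<le> B1 ^ Suc N" using d(2)[OF h] by (intro power_mono) (auto simp: B1_def)
    finally show ?thesis .
  qed
  then show ?thesis by blast
qed

text \<open>Write both sides as \<open>Suc n\<close>-th powers at time \<open>t / Suc n\<close>. The
  factors differ by \<open>o(1 / n)\<close>, and \<open>power_diff_bound\<close> loses only a factor
  of order n. Neither \<open>T 0\<close> nor \<open>S 0\<close> is mentioned, so the semigroups may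
  start at a projection.\<close>

lemma semigroup_eqI:
  fixes S T :: "real \<Rightarrow> 'a::real_normed_algebra_1"
  assumes T: "\<And>s t. 0 < s \<Longrightarrow> 0 < t \<Longrightarrow> T (s + t) = T s * T t"
    and S: "\<And>s t. 0 < s \<Longrightarrow> 0 < t \<Longrightarrow> S (s + t) = S s * S t"
    and diff: "((\<lambda>h. (T h - S h) /\<^sub>R h) \<longlongrightarrow> 0) (at_right 0)"
    and bd: "\<forall>\<^sub>F t in at_right 0. norm (S t) \<le> B"
    and t: "0 < t"
  shows "T t = S t"
proof -
  have "\<forall>\<^sub>F h in at_right 0. norm ((T h - S h) /\<^sub>R h) < 1"
    using tendstoD[OF diff, of 1] by simp
  moreover have "\<forall>\<^sub>F h :: real in at_right 0. 0 < h \<and> h < 1"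
    unfolding eventually_at_right_field by (auto intro: exI[of _ 1])
  ultimately have bdT: "\<forall>\<^sub>F t in at_right 0. norm (T t) \<le> B + 1"
    using bd
  proof eventually_elim
    case (elim h)
    then have "norm (T h - S h) / h < 1" unfolding norm_scaleR by (simp add: field_simps)
    then have "norm (T h - S h) \<le> 1" using elim by (simp add: field_simps)
    then show ?case using norm_triangle_ineq2[of "T h" "S h"] elim by linarith
  qed
  obtain B1 where B1: "\<And>s. 0 < s \<Longrightarrow> s \<le> t \<Longrightarrow> norm (T s) \<le> B1"
    using semigroup_locally_bounded[OF T bdT] by blast
  obtain B2 where B2: "\<And>s. 0 < s \<Longrightarrow> s \<le> t \<Longrightarrow> norm (S s) \<le> B2"
    using semigroup_locally_bounded[OF S bd] by blast
  \<comment> \<open>The 1 takes care of the zeroth powers.\<close>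
  define C where "C = max 1 (max B1 B2)"
  define h where "h n = t / real (Suc n)" for n
  have h_pos: "0 < h n" for n using t by (simp add: h_def)
  have pow: "norm (T (h n) ^ k) \<le> C \<and> norm (S (h n) ^ k) \<le> C" if "k \<le> Suc n" for n k
  proof (cases k)
    case (Suc m)
    have "real (Suc m) * h n \<le> t" using that Suc t by (simp add: h_def field_simps)
    then show ?thesis
      using semigroup_power[of T "h n" m] semigroup_power[of S "h n" m] T S h_pos Suc
        B1[of "real (Suc m) * h n"] B2[of "real (Suc m) * h n"]
      by (auto simp: C_def)
  qed (simp add: C_def)
  have bound: "norm (T t - S t) \<le> t * C\<^sup>2 * norm ((T (h n) - S (h n)) /\<^sub>R h n)" for n
  proof -
    have "T t = T (h n) ^ Suc n" "S t = S (h n) ^ Suc n"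
      using semigroup_power[of T "h n" n] semigroup_power[of S "h n" n] T S h_pos by (auto simp: h_def)
    then have "norm (T t - S t) \<le> real (Suc n) * C\<^sup>2 * norm (T (h n) - S (h n))"
      using power_diff_bound[of "Suc n" "T (h n)" C "S (h n)"] pow by auto
    also have "\<dots> = t * C\<^sup>2 * norm ((T (h n) - S (h n)) /\<^sub>R h n)"
      unfolding norm_scaleR using t by (simp add: h_def)
    finally show ?thesis .
  qed
  have "(h \<longlongrightarrow> 0) sequentially"
    unfolding h_def by (intro LIMSEQ_Suc[of "\<lambda>n. t / real n" 0] lim_const_over_n)
  then have "filterlim h (at_right 0) sequentially"
    using h_pos by (auto simp: filterlim_at intro!: always_eventually dest: less_imp_neq[THEN not_sym])
  from filterlim_compose[OF diff this]
  have "(\<lambda>n. t * C\<^sup>2 * norm ((T (h n) - S (h n)) /\<^sub>R h n)) \<longlonglongrightarrow> t * C\<^sup>2 * norm (0 :: 'a)"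
    by (intro tendsto_intros)
  then have "norm (T t - S t) \<le> t * C\<^sup>2 * norm (0 :: 'a)"
    using bound by (intro tendsto_lowerbound[of _ _ sequentially]) auto
  then show ?thesis by simp
qed

lemma has_vector_derivative_at_right:
  fixes f :: "real \<Rightarrow> 'a::real_normed_vector"
  assumes "(f has_vector_derivative D) (at x within {x..y})" "x < y"
  shows "((\<lambda>h. (f (x + h) - f x) /\<^sub>R h) \<longlongrightarrow> D) (at_right 0)"
proof -
  have "((\<lambda>z. (1 / norm (z - x)) *\<^sub>R (f z - (f x + (z - x) *\<^sub>R D))) \<longlongrightarrow> 0) (at_right x)"
    using assms unfolding has_vector_derivative_def has_derivative_within
    by (simp add: at_within_Icc_at_right)
  then have "((\<lambda>h. (1 / norm h) *\<^sub>R (f (x + h) - (f x + h *\<^sub>R D))) \<longlongrightarrow> 0) (at_right 0)"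
    unfolding at_right_to_0[of x] filterlim_filtermap by (simp add: add.commute)
  then have "((\<lambda>h. (f (x + h) - f x) /\<^sub>R h - D) \<longlongrightarrow> 0) (at_right 0)"
  proof (rule Lim_transform_eventually)
    show "\<forall>\<^sub>F h in at_right 0. (1 / norm h) *\<^sub>R (f (x + h) - (f x + h *\<^sub>R D)) = (f (x + h) - f x) /\<^sub>R h - D"
      unfolding eventually_at_right_field by (intro exI[of _ 1]) (auto simp: algebra_simps divide_inverse)
  qed
  then show ?thesis by (subst (asm) Lim_null[symmetric])
qed

text \<open>Neumann series in \<open>1 - x\<close>. A right inverse suffices to cancel the averaged
  semigroup from the right.\<close>

lemma invertible_near_one:
  fixes x :: "'a::{real_normed_algebra_1, banach}"
  assumes "norm (1 - x) < 1"
  shows "\<exists>y. x * y = 1"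
proof -
  define z where "z = 1 - x"
  have "summable (\<lambda>n. norm z ^ n)" using assms by (simp add: z_def)
  then have z: "summable (\<lambda>n. z ^ n)"
    by (rule summable_comparison_test'[where N = 0]) (simp add: norm_power_ineq)
  have "(\<Sum>n. z ^ n) = 1 + (\<Sum>n. z * z ^ n)"
    using suminf_split_head[OF z] by simp
  also have "(\<Sum>n. z * z ^ n) = z * (\<Sum>n. z ^ n)"
    using z by (rule suminf_mult)
  finally have "x * (\<Sum>n. z ^ n) = 1" by (simp add: z_def algebra_simps)
  then show ?thesis by blast
qed

text \<open>
  The averages \<open>V = \<integral>\<^sub>0\<^sup>s T\<close> satisfy \<open>(T h - 1) V = \<integral>\<^sub>s\<^sup>s\<^sup>+\<^sup>h T - \<integral>\<^sub>0\<^sup>h T\<close>, and \<open>V\<close> is invertible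
  for small \<open>s\<close> by norm continuity; hence \<open>T\<close> is differentiable at \<open>0\<close>.
\<close>

lemma semigroup_has_generator:
  fixes T :: "real \<Rightarrow> 'a::{real_normed_algebra_1, banach}"
  assumes T: "\<And>s t. 0 \<le> s \<Longrightarrow> 0 \<le> t \<Longrightarrow> T (s + t) = T s * T t"
    and T0: "T 0 = 1" and lim: "(T \<longlongrightarrow> 1) (at_right 0)"
  shows "\<exists>G. ((\<lambda>h. (T h - 1) /\<^sub>R h) \<longlongrightarrow> G) (at_right 0)"
proof -
  have "\<forall>\<^sub>F h in at_right 0. dist (T h) 1 < 1" using tendstoD[OF lim, of 1] by simp
  then have bd: "\<forall>\<^sub>F h in at_right 0. norm (T h) \<le> 2"
  proof eventually_elim
    case (elim h)
    then show ?case using norm_triangle_ineq2[of "T h" 1] by (simp add: dist_norm)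
  qed
  have "\<forall>\<^sub>F h in at_right 0. dist (T h) 1 < 1 / 2" using tendstoD[OF lim, of "1/2"] by simp
  then obtain d where d: "0 < d" "\<And>h. 0 < h \<Longrightarrow> h < d \<Longrightarrow> norm (T h - 1) < 1 / 2"
    unfolding eventually_at_right_field dist_norm by auto
  define s where "s = d / 2"
  have s: "0 < s" "s < d" using d by (auto simp: s_def)
  \<comment> \<open>The range is \<open>2 * s\<close> because the shifted integrals reach
    \<open>s + h\<close> with \<open>h\<close> up to \<open>s\<close>.\<close>
  obtain B where B0: "\<And>u. 0 < u \<Longrightarrow> u \<le> 2 * s \<Longrightarrow> norm (T u) \<le> B"
    using semigroup_locally_bounded[OF T bd, of "2 * s"] by (meson less_imp_le)
  define C where "C = max 1 B"
  have C: "norm (T u) \<le> C" if "0 \<le> u" "u \<le> 2 * s" for u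
    using B0[of u] that T0 by (cases "u = 0") (auto simp: C_def)
  \<comment> \<open>Factoring out the earlier value reduces continuity on the whole interval to
    continuity at 0.\<close>
  have shift: "norm (T v - T u) \<le> C * norm (T \<bar>v - u\<bar> - 1)"
    if "u \<in> {0..2 * s}" "v \<in> {0..2 * s}" for u v
  proof -
    have *: "norm (T v - T u) \<le> C * norm (T (v - u) - 1)" if "0 \<le> u" "u \<le> v" "v \<le> 2 * s" for u v
    proof -
      have "T v - T u = T u * (T (v - u) - 1)" using T[of u "v - u"] that by (simp add: algebra_simps)
      also have "norm \<dots> \<le> norm (T u) * norm (T (v - u) - 1)" by (rule norm_mult_ineq)
      also have "\<dots> \<le> C * norm (T (v - u) - 1)" using C[of u] that by (intro mult_right_mono) auto
      finally show ?thesis .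
    qed
    show ?thesis
      using *[of u v] *[of v u] that by (cases "u \<le> v") (auto simp: norm_minus_commute)
  qed
  have cont: "continuous_on {0..2 * s} T"
    unfolding continuous_on_iff
  proof (intro ballI allI impI)
    fix u e :: real assume u: "u \<in> {0..2 * s}" and e: "0 < e"
    have "0 < e / (2 * C)" using e by (simp add: C_def)
    from tendstoD[OF lim this] obtain r
      where r: "0 < r" "\<And>h. 0 < h \<Longrightarrow> h < r \<Longrightarrow> norm (T h - 1) < e / (2 * C)"
      unfolding eventually_at_right_field dist_norm by auto
    show "\<exists>r>0. \<forall>v\<in>{0..2 * s}. dist v u < r \<longrightarrow> dist (T v) (T u) < e"
    proof (intro exI[of _ r] conjI ballI impI r(1))
      fix v assume v: "v \<in> {0..2 * s}" "dist v u < r"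
      have "norm (T \<bar>v - u\<bar> - 1) \<le> e / (2 * C)"
        using r(2)[of "\<bar>v - u\<bar>"] v(2) T0 e by (cases "v = u") (auto simp: dist_real_def C_def)
      then have "C * norm (T \<bar>v - u\<bar> - 1) \<le> C * (e / (2 * C))"
        by (intro mult_left_mono) (auto simp: C_def)
      also have "C * (e / (2 * C)) < e" using e by (simp add: C_def)
      finally show "dist (T v) (T u) < e" using shift[OF u v(1)] by (simp add: dist_norm)
    qed
  qed
  define W where "W x = integral {0..x} T" for x
  have int: "T integrable_on {a..b}" if "0 \<le> a" "b \<le> 2 * s" for a b
    using that by (intro integrable_continuous_real continuous_on_subset[OF cont]) auto
  have Wderiv: "(W has_vector_derivative T x) (at x within {0..2 * s})" if "x \<in> {0..2 * s}" for x
    unfolding W_def using integral_has_vector_derivative[OF cont that] .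
  define V where "V = W s /\<^sub>R s"
  have "norm (1 - V) < 1"
  proof -
    have "norm (integral {0..s} (\<lambda>u. T u - 1)) \<le> 1 / 2 * (s - 0)"
    proof (rule integral_bound)
      show "continuous_on {0..s} (\<lambda>u. T u - 1)"
        using s by (intro continuous_intros continuous_on_subset[OF cont]) auto
      fix u assume "u \<in> {0..s}"
      then show "norm (T u - 1) \<le> 1 / 2" using d(2)[of u] s T0 by (cases "u = 0") auto
    qed (use s in auto)
    also have "integral {0..s} (\<lambda>u. T u - 1) = W s - s *\<^sub>R 1"
      unfolding W_def using int[of 0 s] s by (subst integral_diff) auto
    finally have "norm (W s - s *\<^sub>R 1) \<le> s / 2" by simp
    moreover have eq: "W s - s *\<^sub>R 1 = (- s) *\<^sub>R (1 - V)" using s by (simp add: V_def algebra_simps)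
    have "norm (W s - s *\<^sub>R 1) = s * norm (1 - V)" unfolding eq norm_scaleR using s by simp
    ultimately have "s * norm (1 - V) \<le> s / 2" by simp
    then show ?thesis using s by simp
  qed
  then obtain Y where Y: "V * Y = 1" using invertible_near_one by blast
  define Z where "Z = Y /\<^sub>R s"
  have Z: "W s * Z = 1"
  proof -
    have "W s = s *\<^sub>R V" using s by (simp add: V_def)
    then show ?thesis using s Y by (simp add: Z_def)
  qed
  have key: "T h * W s = W (s + h) - W h" if h: "0 \<le> h" "h \<le> s" for h
  proof -
    have "T h * W s = integral {0..s} (\<lambda>u. T h * T u)"
      unfolding W_def using int[of 0 s] s
      by (simp add: integral_linear[OF _ bounded_linear_mult_right, unfolded o_def])
    also have "\<dots> = integral {0..s} (\<lambda>u. T (h + u))"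
      using h by (intro integral_cong) (simp add: T)
    also have "\<dots> = integral {h..s + h} T"
      using integral_shift_Icc_real[of 0 s T h] by (simp add: o_def)
    also have "\<dots> = W (s + h) - W h"
      unfolding W_def using Henstock_Kurzweil_Integration.integral_combine[of 0 h "s + h" T] int[of 0 "s + h"] h s by (simp add: algebra_simps)
    finally show ?thesis .
  qed
  \<comment> \<open>The two integrals in the difference are differentiated at \<open>s\<close> and
    at 0 by the fundamental theorem of calculus; this is what turns mere continuity of
    \<open>T\<close> into a derivative.\<close>
  have q1: "((\<lambda>h. (W (s + h) - W s) /\<^sub>R h) \<longlongrightarrow> T s) (at_right 0)"
    using s by (intro has_vector_derivative_at_right[where y = "2 * s"]
        has_vector_derivative_within_subset[OF Wderiv[of s]]) auto
  have "((\<lambda>h. (W (0 + h) - W 0) /\<^sub>R h) \<longlongrightarrow> T 0) (at_right 0)"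
    using s by (intro has_vector_derivative_at_right[where y = "2 * s"]
        has_vector_derivative_within_subset[OF Wderiv[of 0]]) auto
  then have q2: "((\<lambda>h. W h /\<^sub>R h) \<longlongrightarrow> 1) (at_right 0)"
    by (simp add: W_def T0)
  have "((\<lambda>h. ((W (s + h) - W s) /\<^sub>R h - W h /\<^sub>R h) * Z) \<longlongrightarrow> (T s - 1) * Z) (at_right 0)"
    by (intro tendsto_intros q1 q2)
  moreover have "\<forall>\<^sub>F h in at_right 0. ((W (s + h) - W s) /\<^sub>R h - W h /\<^sub>R h) * Z = (T h - 1) /\<^sub>R h"
    unfolding eventually_at_right_field
  proof (intro exI[of _ s] conjI allI impI s(1))
    fix h :: real assume "0 < h" "h < s"
    then have TW: "T h * W s = W (s + h) - W h" using key by simp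
    have "((T h - 1) /\<^sub>R h) * W s = (T h * W s - W s) /\<^sub>R h"
      by (simp add: left_diff_distrib)
    also have "\<dots> = (W (s + h) - W s) /\<^sub>R h - W h /\<^sub>R h"
      unfolding TW by (simp add: algebra_simps)
    finally have "(W (s + h) - W s) /\<^sub>R h - W h /\<^sub>R h = ((T h - 1) /\<^sub>R h) * W s" ..
    then show "((W (s + h) - W s) /\<^sub>R h - W h /\<^sub>R h) * Z = (T h - 1) /\<^sub>R h"
      by (simp add: mult.assoc Z)
  qed
  ultimately have "((\<lambda>h. (T h - 1) /\<^sub>R h) \<longlongrightarrow> (T s - 1) * Z) (at_right 0)"
    by (rule Lim_transform_eventually)
  then show ?thesis by blast
qed

lemma exp_scaleR_add:
  fixes G :: "'a::{real_normed_algebra_1, banach}"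
  shows "exp ((s + t) *\<^sub>R G) = exp (s *\<^sub>R G) * exp (t *\<^sub>R G)"
  by (simp add: scaleR_add_left exp_add_commuting)

lemma exp_deriv_at_right_0:
  fixes G :: "'a::{real_normed_algebra_1, banach}"
  shows "((\<lambda>h. (exp (h *\<^sub>R G) - 1) /\<^sub>R h) \<longlongrightarrow> G) (at_right 0)"
proof -
  have "((\<lambda>t. exp (t *\<^sub>R G)) has_vector_derivative G) (at 0 within {0..1})"
    using exp_scaleR_has_vector_derivative_right[of G 0 "{0..1}"] by simp
  from has_vector_derivative_at_right[OF this] show ?thesis by simp
qed

text \<open>A Chernoff product formula: \<open>A\<close> need not be a semigroup, only agree with
  \<open>1 + h G\<close> to first order. It allows \<open>A h\<close> to be chosen for its
  positivity.\<close>

lemma exp_approx: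
  fixes G :: "'a::{real_normed_algebra_1, banach}"
  assumes A: "((\<lambda>h. (A h - 1) /\<^sub>R h) \<longlongrightarrow> G) (at_right 0)"
    and t: "0 < t"
  shows "(\<lambda>n. A (t / real (Suc n)) ^ Suc n) \<longlonglongrightarrow> exp (t *\<^sub>R G)"
proof -
  \<comment> \<open>Strictly above \<open>norm G\<close>, so that eventually
    \<open>norm (A h) \<le> 1 + c h \<le> exp (c h)\<close>. All powers up to \<open>Suc n\<close>
    then stay below \<open>exp (c t)\<close>, uniformly in n.\<close>
  define c where "c = norm G + 1"
  define h where "h n = t / real (Suc n)" for n
  have h_pos: "0 < h n" for n using t by (simp add: h_def)
  have "(h \<longlongrightarrow> 0) sequentially"
    unfolding h_def by (intro LIMSEQ_Suc[of "\<lambda>n. t / real n" 0] lim_const_over_n)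
  then have h_lim: "filterlim h (at_right 0) sequentially"
    using h_pos by (auto simp: filterlim_at intro!: always_eventually dest: less_imp_neq[THEN not_sym])
  have "\<forall>\<^sub>F h in at_right 0. norm ((A h - 1) /\<^sub>R h) < c"
    using tendsto_norm[OF A] by (rule order_tendstoD) (simp add: c_def)
  with h_lim have "\<forall>\<^sub>F n in sequentially. norm ((A (h n) - 1) /\<^sub>R h n) < c"
    by (rule eventually_compose_filterlim[rotated])
  then have bound: "\<forall>\<^sub>F n in sequentially. norm (A (h n) ^ Suc n - exp (t *\<^sub>R G))
      \<le> t * (exp (c * t))\<^sup>2 * norm ((A (h n) - 1) /\<^sub>R h n - (exp (h n *\<^sub>R G) - 1) /\<^sub>R h n)"
  proof eventually_elim
    case (elim n)
    have n: "real (Suc n) * h n = t" by (simp add: h_def)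
    have pow: "x ^ k \<le> exp (c * t)" if "0 \<le> x" "x \<le> exp (c * h n)" "k \<le> Suc n" for x k
    proof -
      have "x ^ k \<le> exp (c * h n) ^ k" using that by (intro power_mono)
      also have "\<dots> = exp (real k * (c * h n))" by (simp add: exp_of_nat_mult)
      also have "\<dots> \<le> exp (real (Suc n) * (c * h n))"
        using that h_pos[of n] by (auto simp: c_def intro!: mult_right_mono)
      also have "real (Suc n) * (c * h n) = c * t" using n by (simp add: algebra_simps)
      finally show ?thesis .
    qed
    have "norm (A (h n) - 1) < c * h n"
      using elim h_pos[of n] unfolding norm_scaleR by (simp add: field_simps)
    then have "norm (A (h n)) \<le> 1 + c * h n"
      using norm_triangle_ineq2[of "A (h n)" 1] by simp
    also have "\<dots> \<le> exp (c * h n)" by (rule exp_ge_add_one_self)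
    finally have 1: "norm (A (h n)) \<le> exp (c * h n)" .
    have "norm (exp (h n *\<^sub>R G)) \<le> exp (norm (h n *\<^sub>R G))" by (rule norm_exp)
    also have "\<dots> \<le> exp (c * h n)" using h_pos[of n] by (simp add: c_def algebra_simps)
    finally have 2: "norm (exp (h n *\<^sub>R G)) \<le> exp (c * h n)" .
    have "exp (h n *\<^sub>R G) ^ Suc n = exp (t *\<^sub>R G)"
      unfolding n[symmetric]
      by (rule semigroup_power[of "\<lambda>t. exp (t *\<^sub>R G)" "h n" n, symmetric]) (auto simp: exp_scaleR_add h_pos)
    then have "norm (A (h n) ^ Suc n - exp (t *\<^sub>R G))
        \<le> real (Suc n) * (exp (c * t))\<^sup>2 * norm (A (h n) - exp (h n *\<^sub>R G))"
      using power_diff_bound[of "Suc n" "A (h n)" "exp (c * t)" "exp (h n *\<^sub>R G)"]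
        order_trans[OF norm_power_ineq pow[OF norm_ge_zero 1]]
        order_trans[OF norm_power_ineq pow[OF norm_ge_zero 2]] by simp
    also have "real (Suc n) = t / h n" using n h_pos[of n] by (simp add: field_simps)
    also have "t / h n * (exp (c * t))\<^sup>2 * norm (A (h n) - exp (h n *\<^sub>R G)) =
       t * (exp (c * t))\<^sup>2 * norm ((A (h n) - exp (h n *\<^sub>R G)) /\<^sub>R h n)"
      unfolding norm_scaleR using h_pos[of n] by (simp add: field_simps)
    also have "(A (h n) - exp (h n *\<^sub>R G)) /\<^sub>R h n = (A (h n) - 1) /\<^sub>R h n - (exp (h n *\<^sub>R G) - 1) /\<^sub>R h n"
      by (simp add: algebra_simps)
    finally show ?case .
  qed
  have "(\<lambda>n. t * (exp (c * t))\<^sup>2 * norm ((A (h n) - 1) /\<^sub>R h n - (exp (h n *\<^sub>R G) - 1) /\<^sub>R h n))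
      \<longlonglongrightarrow> t * (exp (c * t))\<^sup>2 * norm (G - G)"
    by (intro tendsto_intros filterlim_compose[OF A h_lim]
        filterlim_compose[OF exp_deriv_at_right_0 h_lim])
  from Lim_null_comparison[OF bound tendsto_eq_rhs[OF this]]
  have "(\<lambda>n. A (h n) ^ Suc n - exp (t *\<^sub>R G)) \<longlonglongrightarrow> 0" by simp
  then show ?thesis unfolding h_def by (rule LIM_zero_cancel)
qed

subsection \<open>Positive semidefinite operators\<close>

lemma cscale_nth [simp]: "(c *\<^sub>c A) $ i $ j = c * A $ i $ j"
  by (simp add: cscale_def)

lemma dagger_nth [simp]: "A\<^sup>\<dagger> $ i $ j = cnj (A $ j $ i)"
  by (simp add: dagger_def)

lemma operator_eq_iff: "(A :: 'n::finite operator) = B \<longleftrightarrow> (\<forall>i j. A $ i $ j = B $ i $ j)"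
  by (simp add: vec_eq_iff)

lemma matrix_mult_nth: "(A ** B) $ i $ j = (\<Sum>k\<in>UNIV. A $ i $ k * B $ k $ j)"
  by (simp add: matrix_matrix_mult_def)

lemma dagger_add: "(A + B)\<^sup>\<dagger> = A\<^sup>\<dagger> + B\<^sup>\<dagger>"
  and dagger_minus: "(A - B)\<^sup>\<dagger> = A\<^sup>\<dagger> - B\<^sup>\<dagger>"
  and dagger_uminus: "(- A)\<^sup>\<dagger> = - (A\<^sup>\<dagger>)"
  and dagger_dagger [simp]: "(A\<^sup>\<dagger>)\<^sup>\<dagger> = A"
  and dagger_cscale: "(c *\<^sub>c A)\<^sup>\<dagger> = cnj c *\<^sub>c A\<^sup>\<dagger>"
  and dagger_scaleR: "(r *\<^sub>R A)\<^sup>\<dagger> = r *\<^sub>R A\<^sup>\<dagger>"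
  and dagger_zero [simp]: "0\<^sup>\<dagger> = 0"
  and dagger_one [simp]: "(mat 1)\<^sup>\<dagger> = mat 1"
  by (auto simp: operator_eq_iff mat_def)

lemma dagger_mult: "(A ** B)\<^sup>\<dagger> = B\<^sup>\<dagger> ** A\<^sup>\<dagger>"
  by (simp add: operator_eq_iff matrix_mult_nth mult.commute)

lemma scaleR_eq_cscale: "r *\<^sub>R A = of_real r *\<^sub>c A"
  by (simp add: operator_eq_iff) (simp add: scaleR_conv_of_real)

lemma cscale_add: "c *\<^sub>c (A + B) = c *\<^sub>c A + c *\<^sub>c B"
  and cscale_minus: "c *\<^sub>c (A - B) = c *\<^sub>c A - c *\<^sub>c B"
  and cscale_cscale [simp]: "c *\<^sub>c d *\<^sub>c A = (c * d) *\<^sub>c A"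
  and cscale_scaleR: "c *\<^sub>c r *\<^sub>R A = r *\<^sub>R c *\<^sub>c A"
  and cscale_one [simp]: "1 *\<^sub>c A = A"
  and cscale_zero [simp]: "0 *\<^sub>c A = 0" "c *\<^sub>c 0 = 0"
  by (auto simp: operator_eq_iff algebra_simps)

lemma cscale_sum: "c *\<^sub>c (\<Sum>k\<in>I. f k) = (\<Sum>k\<in>I. c *\<^sub>c f k)"
  by (induction I rule: infinite_finite_induct) (auto simp: cscale_add)

lemma mult_cscale [simp]: "(c *\<^sub>c A) ** B = c *\<^sub>c (A ** B)" "A ** (c *\<^sub>c B) = c *\<^sub>c (A ** B)"
  by (simp_all add: operator_eq_iff matrix_mult_nth sum_distrib_left mult_ac)

lemma mult_scaleR [simp]:
  fixes A B :: "'n::finite operator"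
  shows "(r *\<^sub>R A) ** B = r *\<^sub>R (A ** B)" "A ** (r *\<^sub>R B) = r *\<^sub>R (A ** B)"
  by (simp_all add: scaleR_eq_cscale)

lemma matrix_add_rdistrib:
  fixes A B C :: "'n::finite operator"
  shows "(A + B) ** C = A ** C + B ** C"
  by (simp add: operator_eq_iff matrix_mult_nth algebra_simps sum.distrib)

lemma matrix_mult_diff:
  fixes A B C :: "'n::finite operator"
  shows "(A - B) ** C = A ** C - B ** C" "A ** (B - C) = A ** B - A ** C"
  by (simp_all add: operator_eq_iff matrix_mult_nth algebra_simps sum_subtractf)

lemma matrix_mult_sum:
  fixes A :: "'n::finite operator"
  shows "A ** (\<Sum>k\<in>I. f k) = (\<Sum>k\<in>I. A ** f k)" "(\<Sum>k\<in>I. f k) ** A = (\<Sum>k\<in>I. f k ** A)"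
  by (induction I rule: infinite_finite_induct) (auto simp: matrix_add_ldistrib matrix_add_rdistrib)

lemma trace_cscale: "trace (c *\<^sub>c A) = c * trace A"
  by (simp add: trace_def sum_distrib_left)

lemma trace_scaleR: "trace (r *\<^sub>R A) = of_real r * trace (A :: 'n::finite operator)"
  by (simp add: scaleR_eq_cscale trace_cscale)

lemma trace_zero [simp]: "trace (0 :: 'n::finite operator) = 0"
  by (simp add: trace_def)

lemma trace_sum: "trace (\<Sum>k\<in>I. f k) = (\<Sum>k\<in>I. trace (f k :: 'n::finite operator))"
  by (induction I rule: infinite_finite_induct) (auto simp: trace_add)

definition qform :: "complex ^ 'n \<Rightarrow> 'n::finite operator \<Rightarrow> complex ^ 'n \<Rightarrow> complex" where
  "qform u A v = (\<Sum>i\<in>UNIV. \<Sum>j\<in>UNIV. cnj (u $ i) * A $ i $ j * v $ j)"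

lemma cinner_mult_vec: "cinner u (A *v v) = qform u A v"
  by (simp add: cinner_def qform_def matrix_vector_mult_def sum_distrib_left mult.assoc)

lemma psd_qform: "psd A \<longleftrightarrow> (\<forall>v. qform v A v \<in> \<real>\<^sub>\<ge>\<^sub>0)"
  by (simp add: psd_def cinner_mult_vec)

lemma qform_add: "qform u (A + B) v = qform u A v + qform u B v"
  and qform_diff: "qform u (A - B) v = qform u A v - qform u B v"
  and qform_cscale: "qform u (c *\<^sub>c A) v = c * qform u A v"
  by (simp_all add: qform_def algebra_simps sum.distrib sum_distrib_left sum_subtractf)

lemma qform_scaleR: "qform u (r *\<^sub>R A) v = of_real r * qform u A v"
  by (simp add: scaleR_eq_cscale qform_cscale)

lemma qform_zero [simp]: "qform u 0 v = 0"
  by (simp add: qform_def)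

lemma qform_mult: "qform u (A ** B) v = qform (A\<^sup>\<dagger> *v u) B v"
proof -
  have "qform u (A ** B) v = (\<Sum>i\<in>UNIV. \<Sum>j\<in>UNIV. \<Sum>k\<in>UNIV. cnj (u $ i) * A $ i $ k * B $ k $ j * v $ j)"
    by (simp add: qform_def matrix_mult_nth sum_distrib_left sum_distrib_right mult.assoc)
  also have "\<dots> = (\<Sum>k\<in>UNIV. \<Sum>j\<in>UNIV. \<Sum>i\<in>UNIV. cnj (u $ i) * A $ i $ k * B $ k $ j * v $ j)"
    by (subst sum.swap, subst (2) sum.swap, subst sum.swap) (rule refl)
  also have "\<dots> = qform (A\<^sup>\<dagger> *v u) B v"
    by (simp add: qform_def matrix_vector_mult_def sum_distrib_left sum_distrib_right mult_ac)
  finally show ?thesis .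
qed

lemma qform_mult_right: "qform u (A ** B) v = qform u A (B *v v)"
  unfolding cinner_mult_vec[symmetric] by (simp add: matrix_vector_mul_assoc)

lemma tendsto_operator_nth:
  assumes "(f \<longlongrightarrow> (A :: 'n::finite operator)) F"
  shows "((\<lambda>t. f t $ i $ j) \<longlongrightarrow> A $ i $ j) F"
  using assms by (intro tendsto_vec_nth)

lemma tendsto_operatorI:
  assumes "\<And>i j. ((\<lambda>t. f t $ i $ j) \<longlongrightarrow> (A :: 'n::finite operator) $ i $ j) F"
  shows "(f \<longlongrightarrow> A) F"
  using assms by (intro vec_tendstoI)

lemma tendsto_qform: "(f \<longlongrightarrow> A) F \<Longrightarrow> ((\<lambda>t. qform u (f t) v) \<longlongrightarrow> qform u A v) F"
  unfolding qform_def by (intro tendsto_intros tendsto_operator_nth)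

lemma tendsto_trace: "(f \<longlongrightarrow> (A :: 'n::finite operator)) F \<Longrightarrow> ((\<lambda>t. trace (f t)) \<longlongrightarrow> trace A) F"
  unfolding trace_def by (intro tendsto_intros tendsto_operator_nth)

lemma tendsto_cscale: "(f \<longlongrightarrow> (A :: 'n::finite operator)) F \<Longrightarrow> ((\<lambda>t. c *\<^sub>c f t) \<longlongrightarrow> c *\<^sub>c A) F"
  by (intro tendsto_operatorI) (simp add: tendsto_intros tendsto_operator_nth)

lemma nonneg_Reals_lim:
  fixes z :: complex
  assumes "(f \<longlongrightarrow> z) F" "\<forall>\<^sub>F t in F. f t \<in> \<real>\<^sub>\<ge>\<^sub>0" "F \<noteq> bot"
  shows "z \<in> \<real>\<^sub>\<ge>\<^sub>0"
  using Lim_in_closed_set[OF closed_nonneg_Reals_complex assms(2,3,1)] .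

lemma psd_lim:
  assumes "(f \<longlongrightarrow> A) F" "\<forall>\<^sub>F t in F. psd (f t)" "F \<noteq> bot"
  shows "psd A"
  unfolding psd_qform
proof
  fix v show "qform v A v \<in> \<real>\<^sub>\<ge>\<^sub>0"
    using assms by (intro nonneg_Reals_lim[OF tendsto_qform[OF assms(1)]]) (auto simp: psd_qform elim: eventually_mono)
qed

lemma psd_zero [simp]: "psd 0"
  by (simp add: psd_qform)

lemma psd_add: "psd A \<Longrightarrow> psd B \<Longrightarrow> psd (A + B)"
  by (simp add: psd_qform qform_add)

lemma psd_scaleR: "psd A \<Longrightarrow> 0 \<le> r \<Longrightarrow> psd (r *\<^sub>R A)"
  by (auto simp: psd_qform qform_scaleR complex_nonneg_Reals_iff)

text \<open>Vectors supported on two coordinates turn positivity into statements about 2 by 2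
  principal submatrices, the source of the entrywise facts below.\<close>

lemma qform_two_points:
  fixes A :: "'n::finite operator"
  assumes "i \<noteq> j"
  defines "v \<equiv> \<lambda>a b. (\<chi> k. if k = i then a else if k = j then b else 0)"
  shows "qform (v a b) A (v a b) =
    cnj a * a * A $ i $ i + cnj a * b * A $ i $ j + cnj b * a * A $ j $ i + cnj b * b * A $ j $ j"
proof -
  have two: "(\<Sum>k\<in>UNIV. f k) = f i + f j" if "\<And>k. k \<noteq> i \<Longrightarrow> k \<noteq> j \<Longrightarrow> f k = 0" for f :: "'n \<Rightarrow> complex"
  proof -
    have "(\<Sum>k\<in>UNIV. f k) = (\<Sum>k\<in>{i, j}. f k)"
      using that by (intro sum.mono_neutral_right) auto
    then show ?thesis using assms by simp
  qed
  have "qform (v a b) A (v a b) =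
      (\<Sum>k\<in>UNIV. cnj (v a b $ k) * A $ k $ i * a + cnj (v a b $ k) * A $ k $ j * b)"
    unfolding qform_def
  proof (rule sum.cong)
    fix k
    show "(\<Sum>l\<in>UNIV. cnj (v a b $ k) * A $ k $ l * v a b $ l) =
        cnj (v a b $ k) * A $ k $ i * a + cnj (v a b $ k) * A $ k $ j * b"
      using assms by (subst two) (auto simp: v_def)
  qed simp
  also have "\<dots> = cnj a * A $ i $ i * a + cnj a * A $ i $ j * b + (cnj b * A $ j $ i * a + cnj b * A $ j $ j * b)"
    using assms by (subst two) (auto simp: v_def)
  finally show ?thesis by (simp add: mult_ac)
qed

lemma qform_axis: "qform (axis i 1) A (axis j 1) = A $ i $ j"
proof -
  have "qform (axis i 1) A (axis j 1) = (\<Sum>k\<in>UNIV. \<Sum>l\<in>UNIV. if k = i then if l = j then A $ k $ l else 0 else 0)"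
    unfolding qform_def axis_def by (intro sum.cong) auto
  also have "\<dots> = (\<Sum>k\<in>UNIV. if k = i then \<Sum>l\<in>UNIV. if l = j then A $ k $ l else 0 else 0)"
    by (intro sum.cong) auto
  finally show ?thesis by simp
qed

lemma psd_diag: "psd A \<Longrightarrow> A $ i $ i \<in> \<real>\<^sub>\<ge>\<^sub>0"
  unfolding psd_qform using qform_axis[of i A i] by metis

text \<open>Over the complex numbers a real quadratic form forces hermiticity: the coefficient 1
  compares the imaginary parts of the two entries, the coefficient \<i> their real parts.\<close>

lemma psd_nth_cnj:
  assumes "psd A"
  shows "A $ j $ i = cnj (A $ i $ j)"
proof (cases "i = j")
  case True
  then show ?thesis using psd_diag[OF assms, of i] by (simp add: complex_nonneg_Reals_iff complex_eq_iff)
next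
  case False
  have d: "Im (A $ i $ i) = 0" "Im (A $ j $ j) = 0"
    using psd_diag[OF assms] by (auto simp: complex_nonneg_Reals_iff)
  have im: "Im (cnj 1 * 1 * A $ i $ i + cnj 1 * b * A $ i $ j + cnj b * 1 * A $ j $ i + cnj b * b * A $ j $ j) = 0" for b
    using assms unfolding psd_qform complex_nonneg_Reals_iff qform_two_points[OF False, symmetric] by blast
  have "Im (A $ i $ j) + Im (A $ j $ i) = 0" using im[of 1] d by simp
  moreover have "Re (A $ i $ j) = Re (A $ j $ i)" using im[of \<i>] d by simp
  ultimately show ?thesis by (simp add: complex_eq_iff)
qed

lemma psd_hermitian: "psd A \<Longrightarrow> hermitian A"
  unfolding hermitian_def operator_eq_iff dagger_nth using psd_nth_cnj by metis

lemma psd_offdiag_le: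
  assumes "psd A" "i \<noteq> j"
  shows "2 * norm (A $ i $ j) \<le> Re (A $ i $ i) + Re (A $ j $ j)"
proof (cases "A $ i $ j = 0")
  case True
  then show ?thesis using psd_diag[OF assms(1)] by (simp add: complex_nonneg_Reals_iff)
next
  case False
  \<comment> \<open>The phase that makes both cross terms equal to
    \<open>- norm (A $ i $ j)\<close>.\<close>
  define b where "b = - cnj (A $ i $ j) / of_real (norm (A $ i $ j))"
  have n: "cnj (A $ i $ j) * A $ i $ j = (of_real (norm (A $ i $ j)))\<^sup>2"
    by (subst mult.commute) (simp add: complex_norm_square[symmetric])
  have b1: "b * A $ i $ j = - of_real (norm (A $ i $ j))"
    using n False by (simp add: b_def power2_eq_square field_simps)
  have b2: "cnj b * b = 1"
    using n False by (simp add: b_def power2_eq_square field_simps)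
  have b3: "cnj b * A $ j $ i = - of_real (norm (A $ i $ j))"
    using arg_cong[OF b1, of cnj] psd_nth_cnj[OF assms(1), of j i] by simp
  have "0 \<le> Re (A $ i $ i + b * A $ i $ j + cnj b * A $ j $ i + cnj b * b * A $ j $ j)"
    using assms(1) qform_two_points[OF assms(2), of 1 b A, symmetric]
    by (simp add: psd_qform complex_nonneg_Reals_iff)
  then show ?thesis unfolding b1 b2 b3 by simp
qed

lemma psd_diag_le_trace: "psd A \<Longrightarrow> Re (A $ i $ i) \<le> Re (trace A)"
  unfolding trace_def Re_sum
  by (rule member_le_sum) (auto dest: psd_diag simp: complex_nonneg_Reals_iff)

text \<open>Through this bound the trace, a probability, controls every linear functional of a
  positive operator.\<close>

lemma psd_norm_nth_le_trace:
  assumes "psd A"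
  shows "norm (A $ i $ j) \<le> Re (trace A)"
proof (cases "i = j")
  case True
  have "norm (A $ i $ i) = Re (A $ i $ i)"
    using psd_diag[OF assms, of i] by (simp add: complex_nonneg_Reals_iff cmod_eq_Re)
  then show ?thesis using psd_diag_le_trace[OF assms, of i] True by simp
next
  case False
  then show ?thesis
    using psd_offdiag_le[OF assms False] psd_diag_le_trace[OF assms, of i] psd_diag_le_trace[OF assms, of j] by linarith
qed

lemma psd_trace: "psd A \<Longrightarrow> trace A \<in> \<real>\<^sub>\<ge>\<^sub>0"
  unfolding trace_def by (auto dest: psd_diag simp: complex_nonneg_Reals_iff Re_sum Im_sum intro!: sum_nonneg sum.neutral)

lemma psd_trace_zero:
  assumes "psd A" "Re (trace A) = 0"
  shows "A = 0"
  unfolding operator_eq_iff using psd_norm_nth_le_trace[OF assms(1)] assms(2) by auto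

definition outer :: "complex ^ 'n::finite \<Rightarrow> complex ^ 'n \<Rightarrow> 'n operator" where
  "outer u v = (\<chi> i j. u $ i * cnj (v $ j))"

lemma outer_nth [simp]: "outer u v $ i $ j = u $ i * cnj (v $ j)"
  by (simp add: outer_def)

lemma qform_outer: "qform w (outer u v) x = cinner w u * cinner v x"
  by (simp add: qform_def cinner_def sum_product mult_ac)

lemma cinner_cnj: "cnj (cinner u v) = cinner v u"
  by (simp add: cinner_def mult.commute)

lemma psd_outer: "psd (outer v v)"
  unfolding psd_qform
proof
  fix w
  have "qform w (outer v v) w = cinner w v * cnj (cinner w v)"
    by (simp add: qform_outer cinner_cnj)
  then show "qform w (outer v v) w \<in> \<real>\<^sub>\<ge>\<^sub>0"
    by (simp add: complex_mult_cnj complex_nonneg_Reals_iff)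
qed

definition munit :: "'n \<Rightarrow> 'n \<Rightarrow> 'n::finite operator" where
  "munit i j = (\<chi> a b. if a = i \<and> b = j then 1 else 0)"

lemma munit_nth: "munit i j $ a $ b = (if a = i \<and> b = j then 1 else 0)"
  by (simp add: munit_def)

lemma operator_munit: "A = (\<Sum>i\<in>UNIV. \<Sum>j\<in>UNIV. A $ i $ j *\<^sub>c munit i j)"
proof -
  have "(\<Sum>i\<in>UNIV. \<Sum>j\<in>UNIV. A $ i $ j *\<^sub>c munit i j) $ a $ b = A $ a $ b" for a b
  proof -
    have "(\<Sum>i\<in>UNIV. \<Sum>j\<in>UNIV. A $ i $ j *\<^sub>c munit i j) $ a $ b =
      (\<Sum>i\<in>UNIV. \<Sum>j\<in>UNIV. if i = a then if j = b then A $ i $ j else 0 else 0)"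
      unfolding sum_component by (intro sum.cong) (auto simp: munit_nth)
    also have "\<dots> = (\<Sum>i\<in>UNIV. if i = a then \<Sum>j\<in>UNIV. if j = b then A $ i $ j else 0 else 0)"
      by (intro sum.cong) auto
    finally show ?thesis by simp
  qed
  then show ?thesis by (simp add: operator_eq_iff)
qed

text \<open>Polarisation over the fourth roots of unity: the sums of \<open>c\<close> and of
  \<open>c * c\<close> vanish, and only the terms with \<open>c * cnj c\<close> survive.\<close>

lemma munit_polarization:
  "4 *\<^sub>c munit i j = (\<Sum>c\<leftarrow>[1, \<i>, -1, - \<i>]. c *\<^sub>c outer (axis i 1 + c *s axis j 1) (axis i 1 + c *s axis j 1))"
  by (auto simp: operator_eq_iff munit_nth axis_def algebra_simps)

text \<open>Density operators span: matrix units polarise into rank-one positive operators, and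
  these are multiples of states. The rule carries linear properties from states, where the clock
  conditions hold, to all operators.\<close>

lemma density_op_induct [consumes 0, case_names density add scale]:
  fixes A :: "'n::finite operator"
  assumes density: "\<And>\<rho>. density_op \<rho> \<Longrightarrow> P \<rho>"
    and add: "\<And>A B. P A \<Longrightarrow> P B \<Longrightarrow> P (A + B)"
    and scale: "\<And>c A. P A \<Longrightarrow> P (c *\<^sub>c A)"
  shows "P A"
proof -
  have outer: "P (outer v v)" if "v \<noteq> 0" for v :: "complex ^ 'n"
  proof -
    define r where "r = Re (trace (outer v v))"
    have tr: "trace (outer v v) = of_real r" "0 \<le> r"
      using psd_trace[OF psd_outer[of v]] by (auto simp: r_def complex_nonneg_Reals_iff complex_eq_iff)
    have "r \<noteq> 0"
    proof
      assume "r = 0"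
      then have "outer v v = 0" using psd_trace_zero[OF psd_outer[of v]] by (simp add: r_def)
      then have "v $ i * cnj (v $ i) = 0" for i by (metis outer_nth zero_index)
      then show False using that by (simp add: vec_eq_iff)
    qed
    then have "density_op ((1 / r) *\<^sub>R outer v v)"
      using tr psd_scaleR[OF psd_outer, of "1 / r" v] by (simp add: density_op_def trace_scaleR)
    then have "P (of_real r *\<^sub>c ((1 / r) *\<^sub>R outer v v))" by (intro scale density)
    then show ?thesis using \<open>r \<noteq> 0\<close> by (simp add: scaleR_eq_cscale)
  qed
  have zero: "P 0"
    using scale[OF outer[of "axis undefined 1"], of 0] by (simp add: axis_eq_0_iff)
  have outer': "P (outer v v)" for v :: "complex ^ 'n"
    using outer zero by (cases "v = 0") (auto simp: outer_def zero_vec_def)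
  have "P (4 *\<^sub>c munit i j)" for i j :: 'n
    unfolding munit_polarization by (auto intro!: add scale outer' zero)
  then have "P ((1 / 4) *\<^sub>c 4 *\<^sub>c munit i j)" for i j :: 'n by (rule scale)
  then have unit: "P (munit i j)" for i j :: 'n by simp
  have sum: "P (\<Sum>i\<in>I. f i)" if "\<And>i. P (f i)" for I :: "'n set" and f
    by (induction I rule: infinite_finite_induct) (auto intro: zero add that)
  show ?thesis
    by (subst operator_munit[of A]) (intro sum scale unit)
qed

subsection \<open>Completely positive maps\<close>

lemma clinear_mapD:
  assumes "clinear_map \<Phi>"
  shows "\<Phi> (X + Y) = \<Phi> X + \<Phi> Y" "\<Phi> (c *\<^sub>c X) = c *\<^sub>c \<Phi> X" "\<Phi> (r *\<^sub>R X) = r *\<^sub>R \<Phi> X"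
  using assms by (auto simp: clinear_map_def scaleR_eq_cscale)

lemma clinear_map_linear: "clinear_map \<Phi> \<Longrightarrow> linear \<Phi>"
  by (rule linearI) (simp_all add: clinear_mapD)

lemma clinear_map_sum: "clinear_map \<Phi> \<Longrightarrow> \<Phi> (\<Sum>k\<in>I. f k) = (\<Sum>k\<in>I. \<Phi> (f k))"
  using clinear_map_linear linear_sum by blast

lemma block_psd_qform:
  "block_psd n X \<longleftrightarrow> (\<forall>v. (\<Sum>i<n. \<Sum>j<n. qform (v i) (X i j) (v j)) \<in> \<real>\<^sub>\<ge>\<^sub>0)"
  by (simp add: block_psd_def cinner_mult_vec)

lemma completely_positive_id: "completely_positive (\<lambda>X. X)"
  by (simp add: completely_positive_def)

lemma completely_positive_zero: "completely_positive (\<lambda>X. 0)"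
  by (simp add: completely_positive_def block_psd_qform)

lemma completely_positive_funpow: "completely_positive \<Phi> \<Longrightarrow> completely_positive (\<Phi> ^^ n)"
  by (induction n) (simp_all add: completely_positive_def)

lemma completely_positive_add:
  "completely_positive \<Phi> \<Longrightarrow> completely_positive \<Psi> \<Longrightarrow> completely_positive (\<lambda>X. \<Phi> X + \<Psi> X)"
  by (simp add: completely_positive_def block_psd_qform qform_add sum.distrib)

lemma completely_positive_scaleR:
  "completely_positive \<Phi> \<Longrightarrow> 0 \<le> r \<Longrightarrow> completely_positive (\<lambda>X. r *\<^sub>R \<Phi> X)"
  unfolding completely_positive_def block_psd_qform qform_scaleR sum_distrib_left[symmetric]
  by (simp add: complex_nonneg_Reals_iff)

lemma completely_positive_sum:
  "(\<And>k. k \<in> I \<Longrightarrow> completely_positive (\<Phi> k)) \<Longrightarrow> completely_positive (\<lambda>X. \<Sum>k\<in>I. \<Phi> k X)"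
  by (induction I rule: infinite_finite_induct)
    (simp_all add: completely_positive_zero completely_positive_add)

lemma qform_conj: "qform u (K ** X ** K\<^sup>\<dagger>) v = qform (K\<^sup>\<dagger> *v u) X (K\<^sup>\<dagger> *v v)"
  unfolding qform_mult_right[of u "K ** X"] qform_mult[of u K X] ..

lemma completely_positive_conj: "completely_positive (\<lambda>X. K ** X ** K\<^sup>\<dagger>)"
  unfolding completely_positive_def block_psd_qform qform_conj
  by (auto dest: spec[of _ "\<lambda>i. K\<^sup>\<dagger> *v _ i"])

lemma completely_positive_lim:
  fixes \<Phi> :: "'t \<Rightarrow> 'n::finite operator \<Rightarrow> 'n operator"
  assumes "\<And>X. ((\<lambda>t. \<Phi> t X) \<longlongrightarrow> \<Psi> X) F" "\<And>t. completely_positive (\<Phi> t)" "F \<noteq> bot"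
  shows "completely_positive \<Psi>"
  unfolding completely_positive_def block_psd_qform
proof (intro allI impI)
  fix n and X :: "nat \<Rightarrow> nat \<Rightarrow> 'n operator" and v
  assume X: "\<forall>v. (\<Sum>i<n. \<Sum>j<n. qform (v i) (X i j) (v j)) \<in> \<real>\<^sub>\<ge>\<^sub>0"
  show "(\<Sum>i<n. \<Sum>j<n. qform (v i) (\<Psi> (X i j)) (v j)) \<in> \<real>\<^sub>\<ge>\<^sub>0"
  proof (rule nonneg_Reals_lim[OF _ _ assms(3)])
    show "((\<lambda>t. \<Sum>i<n. \<Sum>j<n. qform (v i) (\<Phi> t (X i j)) (v j)) \<longlongrightarrow>
        (\<Sum>i<n. \<Sum>j<n. qform (v i) (\<Psi> (X i j)) (v j))) F"
      by (intro tendsto_sum tendsto_qform assms(1))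
    show "\<forall>\<^sub>F t in F. (\<Sum>i<n. \<Sum>j<n. qform (v i) (\<Phi> t (X i j)) (v j)) \<in> \<real>\<^sub>\<ge>\<^sub>0"
      using assms(2) X by (simp add: completely_positive_def block_psd_qform)
  qed
qed

lemma completely_positive_psd:
  assumes "completely_positive \<Phi>" "psd X"
  shows "psd (\<Phi> X)"
proof -
  have "block_psd 1 (\<lambda>_ _. X)" using assms(2) by (simp add: block_psd_qform psd_qform)
  then have "block_psd 1 (\<lambda>_ _. \<Phi> X)" using assms(1) by (simp add: completely_positive_def)
  then have "qform v (\<Phi> X) v \<in> \<real>\<^sub>\<ge>\<^sub>0" for v
    unfolding block_psd_qform by (auto dest: spec[of _ "\<lambda>_. v"])
  then show ?thesis by (simp add: psd_qform)
qed

text \<open>An enumeration of \<open>'k\<close> moves complete positivity from ancilla indices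
  \<open>i < n\<close> to a finite index type, as required for Choi matrices.\<close>

lemma completely_positive_finite:
  fixes X :: "'k::finite \<Rightarrow> 'k \<Rightarrow> 'n::finite operator"
  assumes \<Phi>: "completely_positive \<Phi>"
    and X: "\<And>v. (\<Sum>i\<in>UNIV. \<Sum>j\<in>UNIV. qform (v i) (X i j) (v j)) \<in> \<real>\<^sub>\<ge>\<^sub>0"
  shows "(\<Sum>i\<in>UNIV. \<Sum>j\<in>UNIV. qform (v i) (\<Phi> (X i j)) (v j)) \<in> \<real>\<^sub>\<ge>\<^sub>0"
proof -
  obtain e where e: "bij_betw e {..<CARD('k)} (UNIV :: 'k set)"
    using bij_betw_from_nat_into_finite ex_bij_betw_nat_finite[of "UNIV :: 'k set"]
    by (auto simp: atLeast0LessThan)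
  define g where "g = inv_into {..<CARD('k)} e"
  have sum: "(\<Sum>i\<in>UNIV. f i) = (\<Sum>i<CARD('k). f (e i))" for f :: "'k \<Rightarrow> complex"
    using sum.reindex_bij_betw[OF e, of f] by simp
  have g: "g (e i) = i" if "i < CARD('k)" for i
    unfolding g_def using e that by (intro inv_into_f_f) (auto simp: bij_betw_def)
  have ge: "e (g k) = k" for k
    unfolding g_def using e by (intro f_inv_into_f) (auto simp: bij_betw_def)
  have "block_psd CARD('k) (\<lambda>i j. X (e i) (e j))"
    unfolding block_psd_qform
  proof
    fix v :: "nat \<Rightarrow> complex ^ 'n"
    show "(\<Sum>i<CARD('k). \<Sum>j<CARD('k). qform (v i) (X (e i) (e j)) (v j)) \<in> \<real>\<^sub>\<ge>\<^sub>0"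
      using X[of "\<lambda>k. v (g k)"] by (simp add: sum g)
  qed
  then have "block_psd CARD('k) (\<lambda>i j. \<Phi> (X (e i) (e j)))"
    using \<Phi> by (simp add: completely_positive_def)
  then have "(\<Sum>i<CARD('k). \<Sum>j<CARD('k). qform (v (e i)) (\<Phi> (X (e i) (e j))) (v (e j))) \<in> \<real>\<^sub>\<ge>\<^sub>0"
    unfolding block_psd_qform by (rule spec)
  then show ?thesis by (simp add: sum)
qed

text \<open>Cholesky elimination: subtracting a rank-one operator built from column \<open>s\<close>
  clears row \<open>s\<close> and leaves the Schur complement, again positive. \<open>S\<close>
  holds the rows not yet eliminated.\<close>

lemma psd_outer_decomposition_aux:
  fixes A :: "'n::finite operator"
  assumes "finite S" "psd A" "\<And>i j. i \<notin> S \<Longrightarrow> A $ i $ j = 0"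
  shows "\<exists>V. A = (\<Sum>k\<in>S. outer (V k) (V k))"
  using assms
proof (induction S arbitrary: A rule: finite_induct)
  case empty
  then show ?case by (simp add: operator_eq_iff)
next
  case (insert s S)
  obtain a where a: "A $ s $ s = of_real a" "0 \<le> a"
    using psd_diag[OF insert.prems(1), of s] by (metis nonneg_Reals_cases)
  \<comment> \<open>If \<open>a = 0\<close>, division by zero makes \<open>w = 0\<close>. This is
    the right choice, because row \<open>s\<close> then vanishes already, as shown in
    \<open>z\<close>.\<close>
  define w where "w = (\<chi> i. A $ i $ s / of_real (sqrt a))"
  define B where "B = A - outer w w"
  have aa: "of_real (sqrt a) * of_real (sqrt a) = (of_real a :: complex)"
    using a by (simp flip: of_real_mult)
  have ww: "outer w w $ i $ j = A $ i $ s * A $ s $ j / of_real a" for i j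
    using aa psd_nth_cnj[OF insert.prems(1), of s j] by (simp add: w_def)
  have z: "A $ s $ j = 0" if "a = 0" for j
  proof (rule ccontr)
    assume nz: "A $ s $ j \<noteq> 0"
    then have sj: "s \<noteq> j" using a that by auto
    define x where "x = Re (A $ j $ j)"
    define y where "y = (norm (A $ s $ j))\<^sup>2"
    \<comment> \<open>Chosen so that \<open>2 * r * y + x = -1\<close>: the vector with entry
      \<alpha> at \<open>s\<close> and 1 at \<open>j\<close> would give the form a negative
      value.\<close>
    define r where "r = - (x + 1) / (2 * y)"
    have y: "0 < y" using nz by (simp add: y_def)
    define \<alpha> where "\<alpha> = of_real r * A $ s $ j"
    have e1: "cnj \<alpha> * A $ s $ j = of_real (r * y)"
      unfolding y_def \<alpha>_def using complex_norm_square[of "A $ s $ j"] by (simp add: mult_ac)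
    have "\<alpha> * A $ j $ s = cnj (cnj \<alpha> * A $ s $ j)"
      using psd_nth_cnj[OF insert.prems(1), of j s] by simp
    then have e2: "\<alpha> * A $ j $ s = of_real (r * y)"
      unfolding e1 by simp
    have "0 \<le> Re (cnj \<alpha> * \<alpha> * A $ s $ s + cnj \<alpha> * 1 * A $ s $ j
        + cnj 1 * \<alpha> * A $ j $ s + cnj 1 * 1 * A $ j $ j)"
      using insert.prems(1) unfolding psd_qform complex_nonneg_Reals_iff
        qform_two_points[OF sj, symmetric] by blast
    also have "\<dots> = 2 * (r * y) + x"
      unfolding complex_cnj_one mult.right_neutral mult_1 e1 e2 a that by (simp add: x_def)
    also have "\<dots> = -1" using y by (simp add: r_def field_simps)
    finally show False by simp
  qed
  have B0: "B $ i $ j = 0" if "i \<notin> S" for i j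
  proof (cases "i = s")
    case True
    show ?thesis
    proof (cases "a = 0")
      case True
      then show ?thesis using z \<open>i = s\<close> unfolding B_def by (simp only: vector_minus_component ww) (simp add: w_def)
    next
      case False
      then show ?thesis using a \<open>i = s\<close> unfolding B_def by (simp only: vector_minus_component ww) simp
    qed
  next
    case False
    then have "i \<notin> insert s S" using that by simp
    then show ?thesis using insert.prems(2) unfolding B_def by (simp only: vector_minus_component ww) simp
  qed
  have "psd B"
  proof (cases "a = 0")
    case True
    then have "B = A" unfolding B_def by (simp add: w_def operator_eq_iff)
    then show ?thesis using insert.prems by simp
  next
    case False
    then have a0: "0 < a" using a by simp
    show ?thesis
      unfolding psd_qform
    proof
      fix v
      have Acnj: "cnj (A $ s $ j) = A $ j $ s" for j
        using psd_nth_cnj[OF insert.prems(1), of j s] by simp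
      define c where "c = (A *v v) $ s / of_real a"
      \<comment> \<open>Completing the square: \<open>c\<close> is chosen so that
        \<open>A *v x\<close> vanishes at \<open>s\<close>, and the form of the Schur complement at
        \<open>v\<close> equals the form of \<open>A\<close> at \<open>x\<close>.\<close>
      define x where "x = v - c *s axis s 1"
      have cw: "cinner v w = cnj ((A *v v) $ s) / of_real (sqrt a)"
        by (simp add: cinner_def w_def matrix_vector_mult_def sum_divide_distrib Acnj mult_ac)
      have "qform x A x = cinner x (A *v x)" by (simp add: cinner_mult_vec)
      also have "A *v x = A *v v - c *s (A *v axis s 1)"
        by (simp add: x_def matrix_vector_mult_diff_distrib vector_scalar_commute)
      also have "cinner x \<dots> = cinner v (A *v v) - c * cinner v (A *v axis s 1)
         - cnj c * cinner (axis s 1) (A *v v) + cnj c * c * cinner (axis s 1) (A *v axis s 1)"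
        by (simp add: cinner_def x_def algebra_simps sum.distrib sum_subtractf sum_distrib_left)
      also have "cinner v (A *v axis s 1) = cnj ((A *v v) $ s)"
        by (simp add: cinner_def matrix_vector_mult_def axis_def Acnj if_distrib[of "(*) _"] mult_ac cong: if_cong)
      also have "cinner (axis s 1) (A *v v) = (A *v v) $ s"
        by (simp add: cinner_def axis_def if_distrib[of cnj] if_distrib[of "\<lambda>z. z * _"] cong: if_cong)
      also have "cinner (axis s 1) (A *v axis s 1) = of_real a"
        by (simp add: cinner_mult_vec qform_axis a)
      also have "cinner v (A *v v) - c * cnj ((A *v v) $ s) - cnj c * (A *v v) $ s + cnj c * c * of_real a
          = qform v A v - cinner v w * cnj (cinner v w)"
        using a0 aa by (simp add: c_def cw cinner_mult_vec)
      also have "\<dots> = qform v B v"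
        by (simp add: B_def qform_diff qform_outer cinner_cnj)
      finally have "qform v B v = qform x A x" ..
      then show "qform v B v \<in> \<real>\<^sub>\<ge>\<^sub>0" using insert.prems(1) by (simp add: psd_qform)
    qed
  qed
  from insert.IH[OF this B0] obtain V where V: "B = (\<Sum>k\<in>S. outer (V k) (V k))" by blast
  have "A = outer w w + B" by (simp add: B_def)
  also have "\<dots> = (\<Sum>k\<in>insert s S. outer ((V(s := w)) k) ((V(s := w)) k))"
    using insert.hyps V by (simp add: sum.insert) (intro sum.cong, auto)
  finally show ?case by blast
qed

lemma psd_outer_decomposition:
  fixes A :: "'n::finite operator"
  assumes "psd A"
  shows "\<exists>V :: 'n \<Rightarrow> _. A = (\<Sum>k\<in>UNIV. outer (V k) (V k))"
  using assms by (intro psd_outer_decomposition_aux) auto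

section \<open>Choi matrices, Kraus operators and the Lindblad form\<close>

text \<open>In each index pair the first component belongs to the output and the second to the
  input; \<open>op_of_vec\<close> relies on this order.\<close>

definition choi :: "('n::finite operator \<Rightarrow> 'n operator) \<Rightarrow> ('n \<times> 'n) operator" where
  "choi \<Lambda> = (\<chi> p q. \<Lambda> (munit (snd p) (snd q)) $ fst p $ fst q)"

lemma choi_nth [simp]: "choi \<Lambda> $ p $ q = \<Lambda> (munit (snd p) (snd q)) $ fst p $ fst q"
  by (simp add: choi_def)

text \<open>Reshapes a vector of a Choi decomposition into the corresponding Kraus operator.\<close>

definition op_of_vec :: "complex ^ ('n \<times> 'n) \<Rightarrow> 'n::finite operator" where
  "op_of_vec v = (\<chi> i j. v $ (i, j))"

lemma op_of_vec_nth [simp]: "op_of_vec v $ i $ j = v $ (i, j)"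
  by (simp add: op_of_vec_def)

lemma clinear_map_munit:
  assumes "clinear_map \<Lambda>"
  shows "\<Lambda> A $ a $ b = (\<Sum>i\<in>UNIV. \<Sum>j\<in>UNIV. A $ i $ j * \<Lambda> (munit i j) $ a $ b)"
  by (subst operator_munit[of A])
    (simp add: clinear_map_sum[OF assms] clinear_mapD[OF assms])

text \<open>The inverse of the Choi correspondence. It is additive in the matrix, so a decomposition
  of the Choi matrix can be read term by term as a decomposition of the map.\<close>

definition choi_apply :: "('n::finite \<times> 'n) operator \<Rightarrow> 'n operator \<Rightarrow> 'n operator" where
  "choi_apply C A = (\<chi> a b. \<Sum>i\<in>UNIV. \<Sum>j\<in>UNIV. A $ i $ j * C $ (a, i) $ (b, j))"

lemma choi_apply_choi: "clinear_map \<Lambda> \<Longrightarrow> choi_apply (choi \<Lambda>) A = \<Lambda> A"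
  by (simp add: choi_apply_def operator_eq_iff clinear_map_munit[of \<Lambda> A])

lemma choi_apply_add: "choi_apply (C + D) A = choi_apply C A + choi_apply D A"
  by (simp add: choi_apply_def operator_eq_iff algebra_simps sum.distrib)

lemma choi_apply_zero [simp]: "choi_apply 0 A = 0"
  by (simp add: choi_apply_def operator_eq_iff)

lemma choi_apply_sum: "choi_apply (\<Sum>k\<in>I. f k) A = (\<Sum>k\<in>I. choi_apply (f k) A)"
  by (induction I rule: infinite_finite_induct) (simp_all add: choi_apply_add)

lemma choi_apply_outer: "choi_apply (outer u v) A = op_of_vec u ** A ** (op_of_vec v)\<^sup>\<dagger>"
proof -
  have "(op_of_vec u ** A ** (op_of_vec v)\<^sup>\<dagger>) $ a $ b =
    (\<Sum>j\<in>UNIV. \<Sum>i\<in>UNIV. A $ i $ j * (u $ (a, i) * cnj (v $ (b, j))))" for a b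
    by (simp add: matrix_mult_nth sum_distrib_right sum_distrib_left mult_ac)
  also have "\<dots> a b = (\<Sum>i\<in>UNIV. \<Sum>j\<in>UNIV. A $ i $ j * (u $ (a, i) * cnj (v $ (b, j))))" for a b
    by (rule sum.swap)
  finally show ?thesis by (simp add: operator_eq_iff choi_apply_def)
qed

lemma cscale_mult_vec: "(c *\<^sub>c A) *v v = c *s (A *v v)"
  by (simp add: vec_eq_iff matrix_vector_mult_def sum_distrib_left mult.assoc)

text \<open>Choi's theorem: a rank-one term \<open>outer v v\<close> of the Choi matrix is the map
  \<open>A \<mapsto> K A K\<^sup>\<dagger>\<close> with \<open>K = op_of_vec v\<close>.\<close>

lemma kraus_decomposition:
  fixes \<Lambda> :: "'n::finite operator \<Rightarrow> 'n operator"
  assumes "clinear_map \<Lambda>" "psd (choi \<Lambda>)"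
  shows "\<exists>K :: 'n \<times> 'n \<Rightarrow> 'n operator. \<forall>A. \<Lambda> A = (\<Sum>k\<in>UNIV. K k ** A ** (K k)\<^sup>\<dagger>)"
proof -
  obtain V :: "'n \<times> 'n \<Rightarrow> complex ^ ('n \<times> 'n)" where V: "choi \<Lambda> = (\<Sum>k\<in>UNIV. outer (V k) (V k))"
    using psd_outer_decomposition[OF assms(2)] by blast
  have *: "\<Lambda> A = (\<Sum>k\<in>UNIV. op_of_vec (V k) ** A ** (op_of_vec (V k))\<^sup>\<dagger>)" for A
    using choi_apply_choi[OF assms(1), of A] unfolding V choi_apply_sum choi_apply_outer by simp
  show ?thesis by (intro exI[of _ "\<lambda>k. op_of_vec (V k)"] allI *)
qed

text \<open>
  The Gorini--Kossakowski--Lindblad--Sudarshan form: compressing the Choi matrix to the complement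
  of the maximally entangled vector \<open>w\<close> leaves a positive matrix, and the remainder
  \<open>g w\<^sup>\<dagger> + w g\<^sup>\<dagger>\<close> is the Choi matrix of \<open>A \<mapsto> G A + A G\<^sup>\<dagger>\<close>.
\<close>

lemma gkls_decomposition:
  fixes \<Lambda> :: "'n::finite operator \<Rightarrow> 'n operator"
  assumes \<Lambda>: "clinear_map \<Lambda>" and herm: "hermitian (choi \<Lambda>)"
    and cond: "\<And>v. (\<Sum>i\<in>UNIV. v $ (i, i)) = 0 \<Longrightarrow> qform v (choi \<Lambda>) v \<in> \<real>\<^sub>\<ge>\<^sub>0"
  shows "\<exists>(K :: 'n \<times> 'n \<Rightarrow> 'n operator) G.
    \<forall>A. \<Lambda> A = (\<Sum>k\<in>UNIV. K k ** A ** (K k)\<^sup>\<dagger>) + (G ** A + A ** G\<^sup>\<dagger>)"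
proof -
  define C where "C = choi \<Lambda>"
  define d where "d = real CARD('n)"
  have d: "d > 0" by (simp add: d_def)
  define w :: "complex ^ ('n \<times> 'n)" where "w = (\<chi> p. if fst p = snd p then 1 else 0)"
  \<comment> \<open>The hypothesis \<open>cond\<close> therefore says that the Choi matrix is
    positive on the orthogonal complement of \<open>w\<close>.\<close>
  have cw: "cinner w v = (\<Sum>i\<in>UNIV. v $ (i, i))" for v
  proof -
    have "(\<Sum>i\<in>UNIV. \<Sum>j\<in>UNIV. if j = i then v $ (i, j) else 0) = cinner w v"
      unfolding cinner_def sum.cartesian_product UNIV_Times_UNIV w_def by (intro sum.cong) auto
    then show ?thesis by simp
  qed
  have ww: "cinner w w = of_real d" unfolding cw by (simp add: w_def d_def)
  define P where "P = mat 1 - (1 / d) *\<^sub>R outer w w"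
  define u where "u = C *v w"
  define c where "c = cinner w u"
  \<comment> \<open>Expanding \<open>P ** C ** P\<close> leaves a multiple of
    \<open>outer w w\<close>; half of it goes to each of \<open>outer g w\<close> and
    \<open>outer w g\<close>, hence the 2. This works since \<open>c\<close> is real, see
    \<open>cc\<close>.\<close>
  define g where "g = (1 / of_real d) *s u - (c / (2 * of_real (d\<^sup>2))) *s w"
  have P_herm: "P\<^sup>\<dagger> = P"
    by (simp add: P_def dagger_minus dagger_scaleR operator_eq_iff mult.commute)
  have "psd (P ** C ** P)"
    unfolding psd_qform
  proof
    fix v
    have "outer w w *v v = cinner w v *s w"
      by (simp add: vec_eq_iff matrix_vector_mult_def cinner_def sum_distrib_right sum_distrib_left mult_ac)
    then have Pv: "P *v v = v - (cinner w v / of_real d) *s w"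
      by (simp add: P_def matrix_vector_mult_diff_rdistrib scaleR_eq_cscale cscale_mult_vec)
    have "cinner w (v - c *s w) = cinner w v - c * cinner w w" for c
      by (simp add: cinner_def algebra_simps sum_subtractf sum_distrib_left)
    then have "cinner w (P *v v) = 0"
      using d ww unfolding Pv by simp
    then have "qform (P *v v) C (P *v v) \<in> \<real>\<^sub>\<ge>\<^sub>0"
      unfolding C_def cw by (rule cond)
    then show "qform v (P ** C ** P) v \<in> \<real>\<^sub>\<ge>\<^sub>0"
      using qform_conj[of v P C v] by (simp add: P_herm)
  qed
  then obtain V :: "'n \<times> 'n \<Rightarrow> complex ^ ('n \<times> 'n)" where V: "P ** C ** P = (\<Sum>k\<in>UNIV. outer (V k) (V k))"
    using psd_outer_decomposition by blast
  have CC: "C\<^sup>\<dagger> = C" using herm by (simp add: C_def hermitian_def)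
  have o1: "outer w w ** C = outer w u"
  proof -
    have "(outer w w ** C) $ p $ q = outer w u $ p $ q" for p q
    proof -
      have "cnj (C $ q $ r) = C $ r $ q" for r using CC unfolding operator_eq_iff dagger_nth by metis
      then show ?thesis by (simp add: matrix_mult_nth u_def matrix_vector_mult_def sum_distrib_left mult_ac)
    qed
    then show ?thesis by (simp add: operator_eq_iff)
  qed
  have o2: "C ** outer w w = outer u w"
    by (simp add: operator_eq_iff matrix_mult_nth u_def matrix_vector_mult_def sum_distrib_left sum_distrib_right mult_ac)
  have o3: "outer w u ** outer w w = cnj c *\<^sub>c outer w w"
    unfolding c_def cinner_cnj
    by (simp add: operator_eq_iff matrix_mult_nth cinner_def sum_distrib_left sum_distrib_right mult_ac)
  have cc: "cnj c = c"
  proof -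
    have "c = qform w C w" by (simp add: c_def u_def cinner_mult_vec)
    moreover have "cnj (qform w C w) = qform w (C\<^sup>\<dagger>) w"
      unfolding qform_def by (simp add: mult_ac) (rule sum.swap)
    ultimately show ?thesis using CC by simp
  qed
  have "C = P ** C ** P + (outer g w + outer w g)"
  proof -
    have "P ** C ** P = C - (1 / d) *\<^sub>R outer w u - (1 / d) *\<^sub>R outer u w + (1 / d\<^sup>2) *\<^sub>R (c *\<^sub>c outer w w)"
      by (simp add: P_def matrix_mult_diff o1 o2 o3 cc algebra_simps power2_eq_square)
    then show ?thesis
      using cc d by (simp add: operator_eq_iff g_def scaleR_eq_cscale)
        (simp add: field_simps power2_eq_square)
  qed
  then have C: "C = (\<Sum>k\<in>UNIV. outer (V k) (V k)) + (outer g w + outer w g)"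
    unfolding V .
  have "\<Lambda> A = choi_apply C A" for A
    using choi_apply_choi[OF \<Lambda>, of A] by (simp add: C_def)
  then have "\<Lambda> A = (\<Sum>k\<in>UNIV. op_of_vec (V k) ** A ** (op_of_vec (V k))\<^sup>\<dagger>)
     + (op_of_vec g ** A ** (op_of_vec w)\<^sup>\<dagger> + op_of_vec w ** A ** (op_of_vec g)\<^sup>\<dagger>)" for A
    unfolding C choi_apply_add choi_apply_sum choi_apply_outer .
  moreover have "op_of_vec w = mat 1"
    by (simp add: operator_eq_iff w_def mat_def)
  ultimately have *: "\<Lambda> A = (\<Sum>k\<in>UNIV. op_of_vec (V k) ** A ** (op_of_vec (V k))\<^sup>\<dagger>)
     + (op_of_vec g ** A + A ** (op_of_vec g)\<^sup>\<dagger>)" for A by simp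
  show ?thesis by (intro exI[of _ "\<lambda>k. op_of_vec (V k)"] exI[of _ "op_of_vec g"] allI *)
qed

subsection \<open>Exponentials of generators\<close>

text \<open>The first part makes the semigroup theory of the Banach algebra available; the second
  keeps the power series at hand for arguments applied to each power of \<open>L\<close>.\<close>

lemma superop_exp_app:
  assumes "linear L"
  shows "superop_exp L t X = app (exp (t *\<^sub>R endo L)) X"
    and "(\<lambda>n. (t ^ n / fact n) *\<^sub>R (L ^^ n) X) sums superop_exp L t X"
proof -
  have eq: "app ((t *\<^sub>R endo L) ^ n /\<^sub>R fact n) X = (t ^ n / fact n) *\<^sub>R (L ^^ n) X" for n
    by (simp add: app.scaleR_left app_power app_endo[OF assms] divide_inverse_commute scaleR_power)
  have "(\<lambda>n. (t *\<^sub>R endo L) ^ n /\<^sub>R fact n) sums exp (t *\<^sub>R endo L)"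
    unfolding exp_def by (intro summable_sums summable_exp_generic)
  from bounded_linear.sums[OF app.bounded_linear_left[of X] this]
  have sums: "(\<lambda>n. (t ^ n / fact n) *\<^sub>R (L ^^ n) X) sums app (exp (t *\<^sub>R endo L)) X"
    unfolding eq .
  show 1: "superop_exp L t X = app (exp (t *\<^sub>R endo L)) X"
    unfolding superop_exp_def using sums by (rule sums_unique[symmetric])
  show "(\<lambda>n. (t ^ n / fact n) *\<^sub>R (L ^^ n) X) sums superop_exp L t X"
    unfolding 1 by (rule sums)
qed

lemma superop_exp_zero: "linear L \<Longrightarrow> superop_exp L 0 X = X"
  by (simp add: superop_exp_app)

lemma superop_exp_add: "linear L \<Longrightarrow> superop_exp L (s + t) X = superop_exp L t (superop_exp L s X)"
  using exp_scaleR_add[of t s "endo L"] by (simp add: superop_exp_app add.commute)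

lemma superop_exp_deriv:
  assumes "linear L"
  shows "((\<lambda>t. superop_exp L t X) has_vector_derivative L (superop_exp L t X)) (at t within S)"
proof -
  have "((\<lambda>t. exp (t *\<^sub>R endo L)) has_vector_derivative endo L * exp (t *\<^sub>R endo L)) (at t within S)"
    using exp_scaleR_has_vector_derivative_left[of "endo L" t] has_vector_derivative_at_within by blast
  from bounded_linear.has_vector_derivative[OF app.bounded_linear_left this, of X]
  show ?thesis by (simp add: superop_exp_app[OF assms] app_endo[OF assms])
qed

lemma superop_exp_deriv_0:
  assumes "linear L"
  shows "((\<lambda>h. (superop_exp L h X - X) /\<^sub>R h) \<longlongrightarrow> L X) (at_right 0)"
  using tendsto_app[OF exp_deriv_at_right_0[of "endo L"], of X]
  by (simp add: superop_exp_app[OF assms] app_endo[OF assms] app.scaleR_left app.diff_left)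

text \<open>Covers symmetries of \<open>L\<close> as well as invariant subspaces \<open>V\<close>, with \<open>S\<close> a projection onto \<open>V\<close>.\<close>

lemma superop_exp_commute:
  assumes L: "linear L" and S: "linear S"
    and V: "\<And>X. X \<in> V \<Longrightarrow> L X \<in> V" and comm: "\<And>X. X \<in> V \<Longrightarrow> S (L X) = L (S X)"
    and X: "X \<in> V"
  shows "S (superop_exp L t X) = superop_exp L t (S X)"
proof -
  have "S ((L ^^ n) X) = (L ^^ n) (S X) \<and> (L ^^ n) X \<in> V" for n
    by (induction n) (auto simp: X V comm)
  then have eq: "S ((t ^ n / fact n) *\<^sub>R (L ^^ n) X) = (t ^ n / fact n) *\<^sub>R (L ^^ n) (S X)" for n
    using S by (simp add: linear_scale)
  have "bounded_linear S" using S by (simp add: linear_conv_bounded_linear)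
  from bounded_linear.sums[OF this superop_exp_app(2)[OF L, of t X]]
  have "(\<lambda>n. (t ^ n / fact n) *\<^sub>R (L ^^ n) (S X)) sums S (superop_exp L t X)"
    unfolding eq .
  then show ?thesis using superop_exp_app(2)[OF L, of t "S X"] by (rule sums_unique2)
qed

lemma linear_cscale: "linear (\<lambda>X. c *\<^sub>c X)"
  by (rule linearI) (simp_all add: cscale_add cscale_scaleR)

lemma superop_exp_clinear:
  assumes L: "clinear_map L"
  shows "clinear_map (superop_exp L t)"
proof -
  note lin = clinear_map_linear[OF L]
  have "superop_exp L t (c *\<^sub>c X) = c *\<^sub>c superop_exp L t X" for c X
    using superop_exp_commute[OF lin linear_cscale, of UNIV c X] clinear_mapD[OF L] by auto
  then show ?thesis
    unfolding clinear_map_def using linear_app by (auto simp: superop_exp_app[OF lin] app.add_right)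
qed

lemma superop_exp_trace:
  assumes L: "linear L" and tr: "\<And>X. trace (L X) = 0"
  shows "trace (superop_exp L t X) = trace X"
proof -
  have "linear (trace :: ('a \<times> 'b) operator \<Rightarrow> complex)"
    by (rule linearI) (simp_all add: trace_add trace_scaleR scaleR_conv_of_real[where 'a = complex])
  then have bl: "bounded_linear (trace :: ('a \<times> 'b) operator \<Rightarrow> complex)"
    by (simp add: linear_conv_bounded_linear)
  have "trace ((t ^ n / fact n) *\<^sub>R (L ^^ n) X) = (if n = 0 then trace X else 0)" for n
    by (cases n) (simp_all add: trace_scaleR tr)
  with bounded_linear.sums[OF bl superop_exp_app(2)[OF L, of t X]]
  have "(\<lambda>n. if n = 0 then trace X else 0) sums trace (superop_exp L t X)" by simp
  then show ?thesis using sums_single[of 0 "\<lambda>_. trace X"] sums_unique2 by blast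
qed

section \<open>Generators whose exponentials are channels\<close>

lemma matrix_mult_uminus:
  fixes A B :: "'n::finite operator"
  shows "(- A) ** B = - (A ** B)" "A ** (- B) = - (A ** B)"
  by (simp_all add: operator_eq_iff matrix_mult_nth sum_negf)

text \<open>This form is closed under sums, so the Hamiltonian and dissipative terms of a generator
  can be treated one at a time. Preservation of the trace is handled separately.\<close>

definition gkls_form :: "('n::finite operator \<Rightarrow> 'n operator) \<Rightarrow> bool" where
  "gkls_form L \<longleftrightarrow> (\<exists>\<Phi> G. completely_positive \<Phi> \<and> clinear_map \<Phi> \<and>
    L = (\<lambda>X. \<Phi> X + (G ** X + X ** G\<^sup>\<dagger>)))"

lemma clinear_map_left_right: "clinear_map (\<lambda>X. G ** X ** F)"
  by (simp add: clinear_map_def matrix_add_ldistrib matrix_add_rdistrib)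

lemma clinear_map_add: "clinear_map f \<Longrightarrow> clinear_map g \<Longrightarrow> clinear_map (\<lambda>X. f X + g X)"
  by (simp add: clinear_map_def cscale_add)

lemma clinear_map_zero: "clinear_map (\<lambda>X. 0)"
  by (simp add: clinear_map_def)

lemma gkls_form_clinear: "gkls_form L \<Longrightarrow> clinear_map L"
  unfolding gkls_form_def
  by (auto simp: clinear_map_def matrix_add_ldistrib matrix_add_rdistrib cscale_add)

lemma gkls_form_add:
  assumes "gkls_form L" "gkls_form L'"
  shows "gkls_form (\<lambda>X. L X + L' X)"
proof -
  obtain \<Phi> G \<Phi>' G' where *: "completely_positive \<Phi>" "clinear_map \<Phi>" "L = (\<lambda>X. \<Phi> X + (G ** X + X ** G\<^sup>\<dagger>))"
    "completely_positive \<Phi>'" "clinear_map \<Phi>'" "L' = (\<lambda>X. \<Phi>' X + (G' ** X + X ** G'\<^sup>\<dagger>))"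
    using assms unfolding gkls_form_def by auto
  show ?thesis
    unfolding gkls_form_def
    by (rule exI[of _ "\<lambda>X. \<Phi> X + \<Phi>' X"], rule exI[of _ "G + G'"])
      (simp add: * completely_positive_add clinear_map_add dagger_add matrix_add_ldistrib matrix_add_rdistrib fun_eq_iff)
qed

lemma gkls_form_left_right: "gkls_form (\<lambda>X. G ** X + X ** G\<^sup>\<dagger>)"
  unfolding gkls_form_def
  by (rule exI[of _ "\<lambda>X. 0"], rule exI[of _ G]) (simp add: completely_positive_zero clinear_map_zero)

lemma gkls_form_sum: "(\<And>k. k \<in> I \<Longrightarrow> gkls_form (L k)) \<Longrightarrow> gkls_form (\<lambda>X. \<Sum>k\<in>I. L k X)"
  using gkls_form_left_right[of 0]
  by (induction I rule: infinite_finite_induct) (auto intro: gkls_form_add)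

lemma gkls_form_dissipator: "gkls_form (dissipator K)"
  unfolding gkls_form_def
  by (rule exI[of _ "\<lambda>X. K ** X ** K\<^sup>\<dagger>"], rule exI[of _ "(- (1/2)) *\<^sub>R (K\<^sup>\<dagger> ** K)"])
    (simp add: completely_positive_conj clinear_map_left_right dissipator_def anticommutator_def
      dagger_uminus dagger_scaleR dagger_mult matrix_mult_uminus fun_eq_iff algebra_simps)

lemma gkls_form_hamiltonian:
  assumes "hermitian H"
  shows "gkls_form (\<lambda>X. (- \<i>) *\<^sub>c commutator H X)"
proof -
  have "((- \<i>) *\<^sub>c H)\<^sup>\<dagger> = \<i> *\<^sub>c H"
    using assms unfolding hermitian_def dagger_cscale by simp
  then have "(- \<i>) *\<^sub>c commutator H X = ((- \<i>) *\<^sub>c H) ** X + X ** ((- \<i>) *\<^sub>c H)\<^sup>\<dagger>" for X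
    unfolding commutator_def by (simp only:) (simp add: operator_eq_iff algebra_simps)
  then show ?thesis using gkls_form_left_right[of "(- \<i>) *\<^sub>c H"] by presburger
qed

lemma trace_dissipator: "trace (dissipator K X) = 0"
proof -
  have "trace (K ** X ** K\<^sup>\<dagger>) = trace (K\<^sup>\<dagger> ** K ** X)"
    by (simp add: trace_mul_sym[of "K ** X"] matrix_mul_assoc)
  moreover have "trace (X ** (K\<^sup>\<dagger> ** K)) = trace (K\<^sup>\<dagger> ** K ** X)"
    by (rule trace_mul_sym)
  ultimately show ?thesis
    by (simp add: dissipator_def anticommutator_def trace_sub trace_add trace_scaleR)
qed

lemma trace_commutator: "trace (commutator H X) = 0"
  by (simp add: commutator_def trace_sub trace_mul_sym[of H X])

text \<open>
  \<open>e\<^sup>t\<^sup>L\<close> is the limit of powers of \<open>X \<mapsto> (1 + h G) X (1 + h G)\<^sup>\<dagger> + h \<Phi> X\<close> with \<open>h = t / n\<close>, which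
  are completely positive and agree with \<open>1 + h L\<close> to first order.
\<close>

lemma superop_exp_completely_positive:
  fixes L :: "('c::finite \<times> 'r::finite) operator \<Rightarrow> ('c \<times> 'r) operator"
  assumes "gkls_form L" "0 \<le> t"
  shows "completely_positive (superop_exp L t)"
proof (cases "t = 0")
  case True
  then have "superop_exp L t = (\<lambda>X. X)"
    using superop_exp_zero clinear_map_linear[OF gkls_form_clinear[OF assms(1)]] by blast
  then show ?thesis by (simp add: completely_positive_id)
next
  case False
  then have t: "0 < t" using assms by simp
  obtain \<Phi> G where \<Phi>: "completely_positive \<Phi>" "clinear_map \<Phi>"
    and L: "L = (\<lambda>X. \<Phi> X + (G ** X + X ** G\<^sup>\<dagger>))"
    using assms unfolding gkls_form_def by blast
  note lin = clinear_map_linear[OF gkls_form_clinear[OF assms(1)]]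
  define A where "A h X = (mat 1 + h *\<^sub>R G) ** X ** (mat 1 + h *\<^sub>R G)\<^sup>\<dagger> + h *\<^sub>R \<Phi> X" for h :: real and X
  have Alin: "linear (A h)" for h
    unfolding A_def using clinear_map_linear[OF \<Phi>(2)]
    by (intro linear_compose_add clinear_map_linear[OF clinear_map_left_right] linear_compose_scale_right)
  have A_cp: "completely_positive (A h)" if "0 \<le> h" for h
    unfolding A_def by (intro completely_positive_add completely_positive_conj completely_positive_scaleR \<Phi> that)
  have "((\<lambda>h. (endo (A h) - 1) /\<^sub>R h) \<longlongrightarrow> endo L) (at_right 0)"
  proof (rule tendsto_endo)
    fix X
    have "((\<lambda>h. L X + h *\<^sub>R (G ** X ** G\<^sup>\<dagger>)) \<longlongrightarrow> L X + 0 *\<^sub>R (G ** X ** G\<^sup>\<dagger>)) (at_right 0)"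
      by (intro tendsto_intros)
    moreover have "\<forall>\<^sub>F h :: real in at_right 0. h \<noteq> 0"
      by (simp add: eventually_at_filter)
    then have "\<forall>\<^sub>F h in at_right 0. L X + h *\<^sub>R (G ** X ** G\<^sup>\<dagger>) = app ((endo (A h) - 1) /\<^sub>R h) X"
    proof eventually_elim
      case (elim h)
      have "A h X - X = h *\<^sub>R (L X + h *\<^sub>R (G ** X ** G\<^sup>\<dagger>))"
        by (simp add: A_def L dagger_add dagger_scaleR matrix_add_ldistrib matrix_add_rdistrib algebra_simps)
      then show ?case using elim by (simp add: app.scaleR_left app.diff_left app_endo[OF Alin])
    qed
    ultimately show "((\<lambda>h. app ((endo (A h) - 1) /\<^sub>R h) X) \<longlongrightarrow> app (endo L) X) (at_right 0)"
      by (simp add: app_endo[OF lin] tendsto_cong)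
  qed
  from exp_approx[OF this t]
  have "(\<lambda>n. (A (t / real (Suc n)) ^^ Suc n) X) \<longlonglongrightarrow> superop_exp L t X" for X
    unfolding superop_exp_app[OF lin] using tendsto_app by (fastforce simp: app_power app_endo[OF Alin])
  moreover have "completely_positive (A (t / real (Suc n)) ^^ Suc n)" for n
    using t by (intro completely_positive_funpow A_cp) simp
  ultimately show ?thesis
    by (rule completely_positive_lim) simp
qed

lemma superop_exp_channel:
  assumes "gkls_form L" "\<And>X. trace (L X) = 0" "0 \<le> t"
  shows "channel (superop_exp L t)"
  unfolding channel_def
  using superop_exp_clinear[OF gkls_form_clinear[OF assms(1)]] superop_exp_completely_positive[OF assms(1,3)]
    superop_exp_trace[OF clinear_map_linear[OF gkls_form_clinear[OF assms(1)]] assms(2)] by blast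

lemma superop_exp_zeroth_order:
  assumes "linear L" and M: "\<And>t. 0 \<le> t \<Longrightarrow> M t = superop_exp L t"
  shows "zeroth_order M"
proof -
  have "((\<lambda>t. exp (t *\<^sub>R endo L)) \<longlongrightarrow> exp (0 *\<^sub>R endo L)) (at_right 0)"
    using has_vector_derivative_continuous[OF exp_scaleR_has_vector_derivative_right[of "endo L" 0 "{0<..}"]]
    by (simp add: continuous_within)
  then have "((\<lambda>t. norm (exp (t *\<^sub>R endo L) - 1)) \<longlongrightarrow> norm (exp (0 *\<^sub>R endo L) - 1)) (at_right 0)"
    by (intro tendsto_intros)
  then have "((\<lambda>t. norm (exp (t *\<^sub>R endo L) - 1)) \<longlongrightarrow> 0) (at_right 0)" by simp
  moreover have "\<forall>\<^sub>F t in at_right 0. norm (exp (t *\<^sub>R endo L) - 1) = onorm (\<lambda>X. M t X - X)"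
    unfolding eventually_at_right_field
    by (intro exI[of _ 1]) (simp add: norm_endo_eq_onorm app.diff_left[abs_def] M superop_exp_app[OF assms(1)])
  ultimately have "((\<lambda>t. onorm (\<lambda>X. M t X - X)) \<longlongrightarrow> 0) (at_right 0)"
    by (rule Lim_transform_eventually)
  then show ?thesis
    unfolding zeroth_order_def using M[of 0] superop_exp_zero[OF assms(1)] by (auto simp: fun_eq_iff)
qed

subsection \<open>Register blocks\<close>

lemma tensor_nth [simp]: "(A \<otimes> B) $ p $ q = A $ fst p $ fst q * B $ snd p $ snd q"
  by (simp add: tensor_def)

lemma sum_UNIV_prod: "(\<Sum>p\<in>UNIV. f p) = (\<Sum>i\<in>UNIV. \<Sum>r\<in>UNIV. f (i, r))"
  by (simp add: sum.cartesian_product flip: UNIV_Times_UNIV)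

lemma tensor_mult: "(A \<otimes> B) ** (C \<otimes> D) = (A ** C) \<otimes> (B ** D)"
  by (simp add: operator_eq_iff matrix_mult_nth sum_UNIV_prod sum_product mult_ac)

lemma dagger_tensor: "(A \<otimes> B)\<^sup>\<dagger> = A\<^sup>\<dagger> \<otimes> B\<^sup>\<dagger>"
  by (simp add: operator_eq_iff)

lemma tensor_add: "(A + A') \<otimes> B = A \<otimes> B + A' \<otimes> B"
  and tensor_diff: "(A - A') \<otimes> B = A \<otimes> B - A' \<otimes> B"
  and tensor_zero [simp]: "0 \<otimes> B = 0" "A \<otimes> 0 = 0"
  and tensor_cscale: "(c *\<^sub>c A) \<otimes> B = c *\<^sub>c (A \<otimes> B)" "A \<otimes> (c *\<^sub>c B) = c *\<^sub>c (A \<otimes> B)"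
  by (simp_all add: operator_eq_iff algebra_simps)

lemma tensor_scaleR: "(r *\<^sub>R A) \<otimes> B = r *\<^sub>R (A \<otimes> B)"
  by (simp add: scaleR_eq_cscale tensor_cscale)

lemma tensor_sum: "(\<Sum>k\<in>I. f k) \<otimes> B = (\<Sum>k\<in>I. f k \<otimes> B)"
  by (induction I rule: infinite_finite_induct) (simp_all add: tensor_add)

lemma mult_munit_mult: "(A ** munit i j ** B) $ a $ b = A $ a $ i * B $ j $ b"
proof -
  have "(A ** munit i j) $ a $ k = (if k = j then A $ a $ i else 0)" for k
  proof -
    have "(A ** munit i j) $ a $ k = (\<Sum>l\<in>UNIV. if l = i then if k = j then A $ a $ i else 0 else 0)"
      unfolding matrix_mult_nth by (intro sum.cong) (auto simp: munit_nth)
    then show ?thesis by simp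
  qed
  then have "(A ** munit i j ** B) $ a $ b = (\<Sum>k\<in>UNIV. if k = j then A $ a $ i * B $ k $ b else 0)"
    unfolding matrix_mult_nth[of "A ** munit i j"] by (intro sum.cong) auto
  then show ?thesis by simp
qed

lemma mat_nth: "mat 1 $ i $ j = (if i = j then 1 else 0)"
  by (simp add: mat_def)

lemma mult_munit: "(A ** munit i j) $ a $ b = (if b = j then A $ a $ i else 0)"
  and munit_mult: "(munit i j ** B) $ a $ b = (if a = i then B $ j $ b else 0)"
  using mult_munit_mult[of A i j "mat 1" a b] mult_munit_mult[of "mat 1" i j B a b]
  by (auto simp: mat_nth)

lemma ketbra_munit: "ketbra tick m n = munit (tick m) (tick n)"
  by (simp add: ketbra_def munit_def)

definition block :: "'r \<Rightarrow> ('c::finite \<times> 'r::finite) operator \<Rightarrow> 'c operator" where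
  "block r X = (\<chi> i j. X $ (i, r) $ (j, r))"

lemma block_nth [simp]: "block r X $ i $ j = X $ (i, r) $ (j, r)"
  by (simp add: block_def)

lemma block_add: "block r (X + Y) = block r X + block r Y"
  and block_diff: "block r (X - Y) = block r X - block r Y"
  and block_zero [simp]: "block r 0 = 0"
  and block_cscale: "block r (c *\<^sub>c X) = c *\<^sub>c block r X"
  and block_scaleR: "block r (x *\<^sub>R X) = x *\<^sub>R block r X"
  by (simp_all add: operator_eq_iff)

lemma block_sum: "block r (\<Sum>k\<in>I. f k) = (\<Sum>k\<in>I. block r (f k))"
  by (induction I rule: infinite_finite_induct) (simp_all add: block_add)

lemma block_tensor: "block r (A \<otimes> munit s s) = (if r = s then A else 0)"
  by (auto simp: operator_eq_iff munit_nth)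

lemma bounded_linear_block: "bounded_linear (block r)"
  unfolding linear_conv_bounded_linear[symmetric] by (rule linearI) (simp_all add: block_add block_scaleR)

lemma tendsto_block: "(f \<longlongrightarrow> A) F \<Longrightarrow> ((\<lambda>t. block r (f t)) \<longlongrightarrow> block r A) F"
  by (rule bounded_linear.tendsto[OF bounded_linear_block])

lemma trace_block: "trace X = (\<Sum>r\<in>UNIV. trace (block r X))"
  unfolding trace_def sum_UNIV_prod by (simp, rule sum.swap)

lemma mult_proj_nth: "(X ** (mat 1 \<otimes> munit r r)) $ p $ q = (if snd q = r then X $ p $ q else 0)"
proof -
  have "(X ** (mat 1 \<otimes> munit r r)) $ p $ q = (\<Sum>k\<in>UNIV. if k = q then if snd q = r then X $ p $ q else 0 else 0)"
    unfolding matrix_mult_nth by (intro sum.cong) (auto simp: mat_def munit_nth prod_eq_iff)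
  then show ?thesis by simp
qed

lemma ptrace_R_mult_proj: "ptrace_R (X ** (mat 1 \<otimes> munit r r)) = block r X"
  by (simp add: ptrace_R_def operator_eq_iff mult_proj_nth)

lemma trace_mult_proj: "trace (X ** (mat 1 \<otimes> munit r r)) = trace (block r X)"
  by (simp add: trace_def sum_UNIV_prod mult_proj_nth)

lemma ptrace_R_tensor: "ptrace_R (A \<otimes> munit s s) = A"
proof -
  have "(\<Sum>r\<in>UNIV. A $ i $ j * munit s s $ r $ r) = A $ i $ j" for i j
    by (simp add: munit_nth if_distrib cong: if_cong)
  then show ?thesis by (simp add: ptrace_R_def operator_eq_iff)
qed

definition lift_vec :: "'r \<Rightarrow> complex ^ 'c \<Rightarrow> complex ^ ('c::finite \<times> 'r::finite)" where
  "lift_vec r v = (\<chi> p. if snd p = r then v $ fst p else 0)"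

lemma sum_block:
  fixes r :: "'r::finite"
  shows "(\<Sum>p\<in>UNIV. if snd p = r then f p else 0) = (\<Sum>i\<in>UNIV. f (i, r))"
  by (simp add: sum_UNIV_prod)

lemma qform_block: "qform u (block r X) v = qform (lift_vec r u) X (lift_vec r v)"
proof -
  have "qform (lift_vec r u) X (lift_vec r v) = (\<Sum>p\<in>UNIV. if snd p = r then
      \<Sum>q\<in>UNIV. if snd q = r then cnj (u $ fst p) * X $ p $ q * v $ fst q else 0 else 0)"
    unfolding qform_def lift_vec_def by (intro sum.cong) (auto intro!: sum.cong)
  then show ?thesis unfolding sum_block by (simp add: qform_def)
qed

lemma psd_block: "psd X \<Longrightarrow> psd (block r X)"
  by (simp add: psd_qform qform_block)

lemma qform_tensor: "qform u (A \<otimes> munit s s) v = qform (\<chi> i. u $ (i, s)) A (\<chi> i. v $ (i, s))"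
proof -
  have "qform u (A \<otimes> munit s s) v = (\<Sum>p\<in>UNIV. if snd p = s then
      \<Sum>q\<in>UNIV. if snd q = s then cnj (u $ p) * A $ fst p $ fst q * v $ q else 0 else 0)"
    unfolding qform_def by (intro sum.cong) (auto simp: munit_nth intro!: sum.cong)
  then show ?thesis unfolding sum_block by (simp add: qform_def)
qed

lemma psd_tensor: "psd A \<Longrightarrow> psd (A \<otimes> munit s s)"
  by (simp add: psd_qform qform_tensor)

lemma trace_tensor: "trace (A \<otimes> munit s s) = trace A"
  unfolding trace_block by (simp add: block_tensor if_distrib cong: if_cong)

lemma density_op_tensor: "density_op \<rho> \<Longrightarrow> density_op (\<rho> \<otimes> munit s s)"
  by (simp add: density_op_def psd_tensor trace_tensor)

section \<open>Operators diagonal in the register\<close>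

text \<open>The equation \<open>dephase X = X\<close> is how being diagonal in the register is
  expressed from here on.\<close>

definition dephase :: "('c::finite \<times> 'r::finite) operator \<Rightarrow> ('c \<times> 'r) operator" where
  "dephase X = (\<Sum>s\<in>UNIV. block s X \<otimes> munit s s)"

lemma dephase_nth: "dephase X $ p $ q = (if snd p = snd q then X $ p $ q else 0)"
proof -
  have "dephase X $ p $ q = (\<Sum>s\<in>UNIV. if s = snd p then if snd p = snd q then X $ p $ q else 0 else 0)"
    unfolding dephase_def sum_component by (intro sum.cong) (auto simp: munit_nth)
  then show ?thesis by simp
qed

lemma dephase_idem [simp]: "dephase (dephase X) = dephase X"
  by (simp add: operator_eq_iff dephase_nth)

lemma dephase_clinear: "clinear_map dephase"
  by (simp add: clinear_map_def operator_eq_iff dephase_nth)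

lemma dephase_tensor [simp]: "dephase (A \<otimes> munit s s) = A \<otimes> munit s s"
  by (auto simp: operator_eq_iff dephase_nth munit_nth)

lemma block_dephase [simp]: "block r (dephase X) = block r X"
  by (simp add: operator_eq_iff dephase_nth)

lemma dephase_eqI:
  assumes "dephase X = X" "dephase Y = Y" "\<And>r. block r X = block r Y"
  shows "X = Y"
proof -
  have "dephase X = dephase Y" unfolding dephase_def assms(3) ..
  then show ?thesis using assms by simp
qed

lemma clinear_map_dephase_induct:
  assumes "clinear_map f" "clinear_map g" "\<And>A s. f (A \<otimes> munit s s) = g (A \<otimes> munit s s)"
    and "dephase X = X"
  shows "f X = g X"
proof -
  have "f (dephase X) = g (dephase X)"
    unfolding dephase_def clinear_map_sum[OF assms(1)] clinear_map_sum[OF assms(2)] assms(3) ..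
  then show ?thesis using assms(4) by simp
qed

lemma clinear_trace_munit: "clinear_map \<Phi> \<Longrightarrow> trace (\<Phi> A) = (\<Sum>i\<in>UNIV. \<Sum>j\<in>UNIV. A $ i $ j * trace (\<Phi> (munit i j)))"
  by (subst operator_munit[of A]) (simp add: clinear_map_sum clinear_mapD trace_sum trace_cscale)

text \<open>Entries of a positive operator are at most its trace, so the values on matrix units give
  a constant independent of the state. It supplies the bounds on the tick rate and on the leak out
  of the last register state.\<close>

lemma clinear_trace_bound:
  assumes "clinear_map \<Phi>" "psd A"
  shows "norm (trace (\<Phi> A)) \<le> (\<Sum>i\<in>UNIV. \<Sum>j\<in>UNIV. norm (trace (\<Phi> (munit i j)))) * Re (trace A)"
proof -
  have "norm (trace (\<Phi> A)) \<le> (\<Sum>i\<in>UNIV. \<Sum>j\<in>UNIV. norm (trace (\<Phi> (munit i j))) * Re (trace A))"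
    unfolding clinear_trace_munit[OF assms(1), of A]
    by (intro sum_norm_le, subst norm_mult, subst mult.commute)
      (intro mult_left_mono psd_norm_nth_le_trace assms norm_ge_zero)
  then show ?thesis by (simp add: sum_distrib_right)
qed

section \<open>The generator as a jump chain on the register\<close>

definition jump_part :: "nat \<Rightarrow> (nat \<Rightarrow> 'n::finite operator) \<Rightarrow> 'n operator \<Rightarrow> 'n operator" where
  "jump_part NL J A = (\<Sum>j=1..NL. J j ** A ** (J j)\<^sup>\<dagger>)"

text \<open>The weight \<open>c\<close> is \<open>1\<close> at register states that can tick and \<open>0\<close> at the end of a cut-off register.\<close>

definition stay_part ::
    "complex \<Rightarrow> 'n operator \<Rightarrow> nat \<Rightarrow> (nat \<Rightarrow> 'n operator) \<Rightarrow> (nat \<Rightarrow> 'n::finite operator) \<Rightarrow> 'n operator \<Rightarrow> 'n operator"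
  where "stay_part c H NL L J A = (- \<i>) *\<^sub>c commutator H A + (\<Sum>j=1..NL. dissipator (L j) A)
    - c *\<^sub>c (\<Sum>j=1..NL. (1/2) *\<^sub>R anticommutator ((J j)\<^sup>\<dagger> ** J j) A)"

lemma jump_part_clinear: "clinear_map (jump_part NL J)"
  by (simp add: clinear_map_def jump_part_def matrix_add_ldistrib matrix_add_rdistrib sum.distrib cscale_sum)

lemma psd_jump_part: "psd A \<Longrightarrow> psd (jump_part NL J A)"
  unfolding jump_part_def
  by (rule completely_positive_psd[OF completely_positive_sum[OF completely_positive_conj]])

text \<open>The Hamiltonian and the \<open>L\<close> terms are traceless; what remains is the
  probability current that a tick carries to the next register state.\<close>

lemma trace_stay_part: "trace (stay_part c H NL L J A) = - c * trace (jump_part NL J A)"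
proof -
  have "trace ((1/2) *\<^sub>R anticommutator ((J j)\<^sup>\<dagger> ** J j) A) = trace (J j ** A ** (J j)\<^sup>\<dagger>)" for j
    using trace_dissipator[of "J j" A] by (simp add: dissipator_def trace_sub)
  then show ?thesis
    by (simp add: stay_part_def jump_part_def trace_sub trace_add trace_cscale trace_sum trace_commutator trace_dissipator)
qed

text \<open>Cyclic for both kinds of register, hence a bijection. The cut-off enters only through
  the weight \<open>hop\<close>, which is 0 at the last state.\<close>

definition next_tick :: "(nat \<Rightarrow> 'r::finite) \<Rightarrow> nat \<Rightarrow> 'r \<Rightarrow> 'r" where
  "next_tick tick NT r = tick ((inv_into {0..NT} tick r + 1) mod (NT + 1))"

definition hop :: "register \<Rightarrow> (nat \<Rightarrow> 'r::finite) \<Rightarrow> nat \<Rightarrow> 'r \<Rightarrow> complex" where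
  "hop reg tick NT r = (if r = tick NT then wrap_coeff reg else 1)"

lemma hop_Periodic [simp]: "hop Periodic tick NT r = 1"
  by (simp add: hop_def)

lemma hop_idem: "hop reg tick NT r * cnj (hop reg tick NT r) = hop reg tick NT r"
  by (cases reg) (simp_all add: hop_def)

locale tick_register =
  fixes tick :: "nat \<Rightarrow> 'r::finite" and NT :: nat
  assumes NT_pos: "NT > 0" and labelling: "tick_labelling tick NT"
begin

abbreviation "nxt \<equiv> next_tick tick NT"

lemma tick_eq_iff: "m \<le> NT \<Longrightarrow> n \<le> NT \<Longrightarrow> tick m = tick n \<longleftrightarrow> m = n"
  using labelling unfolding tick_labelling_def bij_betw_def inj_on_def by auto

lemma tick_cases: obtains n where "n \<le> NT" "r = tick n"
proof -
  have "r \<in> tick ` {0..NT}" using labelling unfolding tick_labelling_def bij_betw_def by simp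
  then show ?thesis using that by auto
qed

lemma sum_tick: "(\<Sum>r\<in>UNIV. f r) = (\<Sum>n\<in>{0..NT}. f (tick n))"
  using labelling sum.reindex_bij_betw unfolding tick_labelling_def by metis

lemma nxt_tick: "n \<le> NT \<Longrightarrow> nxt (tick n) = tick ((n + 1) mod (NT + 1))"
  unfolding next_tick_def using labelling
  by (subst inv_into_f_f) (auto simp: tick_labelling_def bij_betw_def)

lemma nxt_tick_Suc: "n < NT \<Longrightarrow> nxt (tick n) = tick (Suc n)"
  by (simp add: nxt_tick)

lemma nxt_tick_NT: "nxt (tick NT) = tick 0"
  by (simp add: nxt_tick)

lemma surj_nxt: "surj nxt"
proof -
  have "r \<in> range nxt" for r
  proof (rule tick_cases[of r])
    fix n assume n: "n \<le> NT" "r = tick n"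
    then show ?thesis
    proof (cases n)
      case 0
      then show ?thesis using n nxt_tick_NT by (metis rangeI)
    next
      case (Suc m)
      then show ?thesis using n nxt_tick_Suc[of m] by (metis Suc_le_lessD rangeI)
    qed
  qed
  then show ?thesis by blast
qed

lemma inj_nxt: "inj nxt"
  using surj_nxt by (simp add: finite_UNIV_surj_inj)

lemma nxt_eq_iff [simp]: "nxt r = nxt s \<longleftrightarrow> r = s"
  using inj_nxt by (simp add: inj_eq)

text \<open>Uses \<open>NT > 0\<close>: with a single label the cyclic successor would be the
  identity.\<close>

lemma nxt_neq: "nxt r \<noteq> r"
proof (rule tick_cases[of r])
  fix n assume n: "n \<le> NT" "r = tick n"
  then show ?thesis
    using NT_pos by (cases "n = NT") (simp_all add: nxt_tick_NT nxt_tick_Suc tick_eq_iff)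
qed

lemma tick_shift_nth: "tick_shift reg tick NT $ r $ s = (if r = nxt s then hop reg tick NT s else 0)"
proof (rule tick_cases[of s])
  fix m assume m: "m \<le> NT" "s = tick m"
  have "tick_shift reg tick NT $ r $ s = (\<Sum>n<NT. if n = m then (if r = tick (Suc m) then 1 else 0) else 0)
      + (if m = NT \<and> r = tick 0 then wrap_coeff reg else 0)"
    unfolding tick_shift_def vector_add_component sum_component cscale_nth ketbra_munit munit_nth
    using m by (intro arg_cong2[where f = "(+)"] sum.cong) (auto simp: tick_eq_iff)
  then show ?thesis
    using m NT_pos by (cases "m = NT") (auto simp: nxt_tick_NT nxt_tick_Suc hop_def tick_eq_iff)
qed

lemma tick_shift_conj:
  "tick_shift reg tick NT ** munit s s ** (tick_shift reg tick NT)\<^sup>\<dagger> = hop reg tick NT s *\<^sub>c munit (nxt s) (nxt s)"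
  using hop_idem[of reg tick NT s] by (auto simp: operator_eq_iff mult_munit_mult tick_shift_nth munit_nth)

lemma tick_shift_square: "((tick_shift reg tick NT)\<^sup>\<dagger> ** tick_shift reg tick NT) $ r $ s = (if r = s then hop reg tick NT s else 0)"
proof -
  have "((tick_shift reg tick NT)\<^sup>\<dagger> ** tick_shift reg tick NT) $ r $ s =
      (\<Sum>k\<in>UNIV. if k = nxt s then if r = s then hop reg tick NT s else 0 else 0)"
    unfolding matrix_mult_nth using hop_idem[of reg tick NT s]
    by (intro sum.cong) (auto simp: tick_shift_nth mult.commute)
  then show ?thesis by simp
qed

lemma tick_shift_square_munit:
  "((tick_shift reg tick NT)\<^sup>\<dagger> ** tick_shift reg tick NT) ** munit s s = hop reg tick NT s *\<^sub>c munit s s"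
  "munit s s ** ((tick_shift reg tick NT)\<^sup>\<dagger> ** tick_shift reg tick NT) = hop reg tick NT s *\<^sub>c munit s s"
  by (auto simp: operator_eq_iff mult_munit munit_mult tick_shift_square munit_nth)

text \<open>\<open>O O\<^sup>\<dagger>\<close>-type products of the shift stay diagonal on
  \<open>|s><s|\<close>: conjugation moves it to the successor, and the anticommutator keeps it in
  place, each with weight \<open>hop\<close>. The generator thus acts on register states as a jump
  chain with operator-valued rates.\<close>

lemma clock_generator_tensor:
  "clock_generator reg tick NT H NL L J (A \<otimes> munit s s) =
     stay_part (hop reg tick NT s) H NL L J A \<otimes> munit s s
     + (hop reg tick NT s *\<^sub>c jump_part NL J A) \<otimes> munit (nxt s) (nxt s)"
proof -
  have 1: "commutator (H \<otimes> mat 1) (A \<otimes> munit s s) = commutator H A \<otimes> munit s s"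
    by (simp add: commutator_def tensor_mult tensor_diff)
  have 2: "dissipator (L j \<otimes> mat 1) (A \<otimes> munit s s) = dissipator (L j) A \<otimes> munit s s" for j
    by (simp add: dissipator_def anticommutator_def tensor_mult dagger_tensor tensor_diff tensor_scaleR tensor_add)
  have 3: "dissipator (J j \<otimes> tick_shift reg tick NT) (A \<otimes> munit s s) =
      hop reg tick NT s *\<^sub>c ((J j ** A ** (J j)\<^sup>\<dagger>) \<otimes> munit (nxt s) (nxt s))
      - hop reg tick NT s *\<^sub>c (((1/2) *\<^sub>R anticommutator ((J j)\<^sup>\<dagger> ** J j) A) \<otimes> munit s s)" for j
    by (simp add: dissipator_def anticommutator_def tensor_mult dagger_tensor tick_shift_conj
        tick_shift_square_munit tensor_cscale tensor_scaleR tensor_add cscale_add cscale_scaleR)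
  show ?thesis
    unfolding clock_generator_def 1 2 3 stay_part_def jump_part_def
    by (simp add: tensor_add tensor_diff tensor_sum tensor_cscale sum_subtractf cscale_sum)
qed

end

lemma gkls_form_clock_generator:
  fixes tick :: "nat \<Rightarrow> 'r::finite" and H :: "'c::finite operator"
  assumes "hermitian H"
  shows "gkls_form (clock_generator reg tick NT H NL L J)"
proof -
  have "hermitian (H \<otimes> mat 1 :: ('c \<times> 'r) operator)"
    using assms by (simp add: hermitian_def dagger_tensor)
  then show ?thesis
    unfolding clock_generator_def[abs_def]
    by (intro gkls_form_add gkls_form_sum gkls_form_hamiltonian gkls_form_dissipator)
qed

lemma trace_clock_generator: "trace (clock_generator reg tick NT H NL L J X) = 0"
  by (simp add: clock_generator_def trace_add trace_cscale trace_sum trace_commutator trace_dissipator)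

subsection \<open>The explicit dynamics form a ticking clock\<close>

lemma psd_trace_nonneg: "psd A \<Longrightarrow> 0 \<le> Re (trace A)"
  using psd_trace[of A] by (simp add: complex_nonneg_Reals_iff)

locale clock_dynamics = tick_register tick NT
  for tick :: "nat \<Rightarrow> 'r::finite" and NT +
  fixes reg :: register and H :: "'c::finite operator" and NL :: nat and L J :: "nat \<Rightarrow> 'c operator"
  assumes hermitian_H: "hermitian H"
begin

abbreviation "gen \<equiv> clock_generator reg tick NT H NL L J"
abbreviation "E \<equiv> superop_exp gen"
abbreviation "w \<equiv> hop reg tick NT"
abbreviation "jump \<equiv> jump_part NL J"
abbreviation "stay c \<equiv> stay_part c H NL L J"

lemma gen_clinear: "clinear_map gen"
  by (intro gkls_form_clinear gkls_form_clock_generator hermitian_H)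

lemma gen_linear: "linear gen"
  by (rule clinear_map_linear[OF gen_clinear])

lemma E_channel: "0 \<le> t \<Longrightarrow> channel (E t)"
  by (intro superop_exp_channel gkls_form_clock_generator hermitian_H trace_clock_generator)

lemma E_psd: "psd X \<Longrightarrow> 0 \<le> t \<Longrightarrow> psd (E t X)"
  using E_channel[of t] completely_positive_psd by (auto simp: channel_def)

lemma dephase_gen: "dephase X = X \<Longrightarrow> dephase (gen X) = gen X"
proof (rule clinear_map_dephase_induct[of "\<lambda>X. dephase (gen X)" gen X])
  show "clinear_map (\<lambda>X. dephase (gen X))"
    by (simp add: clinear_map_def clinear_mapD[OF dephase_clinear] clinear_mapD[OF gen_clinear])
  show "dephase (gen (A \<otimes> munit s s)) = gen (A \<otimes> munit s s)" for A s
    unfolding clock_generator_tensor by (simp add: clinear_mapD[OF dephase_clinear])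
qed (simp_all add: gen_clinear)

lemma dephase_E: "dephase X = X \<Longrightarrow> dephase (E t X) = E t X"
  using superop_exp_commute[of gen dephase "{X. dephase X = X}" X t]
  by (simp add: gen_linear clinear_map_linear[OF dephase_clinear] dephase_gen)

text \<open>Indexed by \<open>nxt r\<close>, so that the incoming jump comes from \<open>r\<close>
  itself and not from a predecessor.\<close>

lemma block_gen:
  assumes "dephase X = X"
  shows "block (nxt r) (gen X) = stay (w (nxt r)) (block (nxt r) X) + w r *\<^sub>c jump (block r X)"
proof -
  have "block (nxt r) (gen (dephase X)) = (\<Sum>s\<in>UNIV. block (nxt r) (gen (block s X \<otimes> munit s s)))"
    unfolding dephase_def clinear_map_sum[OF gen_clinear] block_sum ..
  also have "\<dots> = (\<Sum>s\<in>UNIV. (if s = nxt r then stay (w (nxt r)) (block (nxt r) X) else 0)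
      + (if s = r then w r *\<^sub>c jump (block r X) else 0))"
    unfolding clock_generator_tensor by (intro sum.cong) (auto simp: block_add block_tensor)
  also have "\<dots> = stay (w (nxt r)) (block (nxt r) X) + w r *\<^sub>c jump (block r X)"
    by (simp add: sum.distrib)
  finally show ?thesis using assms by simp
qed

lemma E_classical: "dephase X = X \<Longrightarrow> E t X = (\<Sum>n\<in>{0..NT}. block (tick n) (E t X) \<otimes> tick_proj tick n)"
  using dephase_E[of X t] unfolding dephase_def[of "E t X"] ketbra_munit by (simp add: sum_tick)

lemma subnormalised_block:
  assumes "density_op X"
  shows "subnormalised_state (block r X)"
proof -
  have "Re (trace (block r X)) \<le> (\<Sum>r\<in>UNIV. Re (trace (block r X)))"
    using assms by (intro member_le_sum) (auto simp: density_op_def psd_trace_nonneg psd_block)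
  also have "\<dots> = 1" using assms trace_block[of X] by (simp add: density_op_def flip: Re_sum)
  finally show ?thesis using assms by (simp add: subnormalised_state_def density_op_def psd_block)
qed

lemma E_density: "density_op X \<Longrightarrow> 0 \<le> t \<Longrightarrow> density_op (E t X)"
  using E_psd E_channel[of t] by (auto simp: density_op_def channel_def)

lemma E_deriv:
  assumes "bounded_linear f"
  shows "((\<lambda>t. f (E t X)) has_vector_derivative f (gen (E t X))) (at t)"
  using bounded_linear.has_vector_derivative[OF assms superop_exp_deriv[OF gen_linear]] .

context
  fixes M :: "('c, 'r) dynamics"
  assumes M: "\<And>t. 0 \<le> t \<Longrightarrow> M t = E t"
begin

lemma M_classical: "classical_register tick NT M"
  unfolding classical_register_def
proof (intro allI impI)
  fix t :: real and k \<rho> assume t: "0 \<le> t" and "k \<le> NT" and \<rho>: "density_op (\<rho> :: 'c operator)"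
  let ?X = "E t (\<rho> \<otimes> munit (tick k) (tick k))"
  have "\<forall>n\<le>NT. subnormalised_state (block (tick n) ?X)"
    using t \<rho> by (intro allI impI subnormalised_block E_density density_op_tensor)
  moreover have "from_tick tick M t k \<rho> = (\<Sum>n\<in>{0..NT}. block (tick n) ?X \<otimes> tick_proj tick n)"
    unfolding from_tick_def M[OF t] ketbra_munit using E_classical[OF dephase_tensor, of t] by (simp add: ketbra_munit)
  ultimately show "\<exists>\<sigma>. (\<forall>n\<le>NT. subnormalised_state (\<sigma> n)) \<and>
      from_tick tick M t k \<rho> = (\<Sum>n\<in>{0..NT}. \<sigma> n \<otimes> tick_proj tick n)"
    by (intro exI[of _ "\<lambda>n. block (tick n) ?X"]) simp
qed

lemma M_self_timing: "self_timing M"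
  unfolding self_timing_def using M superop_exp_add[OF gen_linear] by (auto simp: fun_eq_iff)

lemma M_channel: "0 \<le> t \<Longrightarrow> channel (M t)"
  using M E_channel by simp

lemma M_zeroth_order: "zeroth_order M"
  by (rule superop_exp_zeroth_order[OF gen_linear M])

context
  assumes periodic: "reg = Periodic"
begin

text \<open>Relabelling all register states by one tick is a symmetry of the periodic generator.\<close>

lemma E_shift: "block (nxt r) (E t (A \<otimes> munit (nxt s) (nxt s))) = block r (E t (A \<otimes> munit s s))"
proof -
  define S :: "('c \<times> 'r) operator \<Rightarrow> ('c \<times> 'r) operator"
    where "S X = (\<chi> p q. X $ (fst p, nxt (snd p)) $ (fst q, nxt (snd q)))" for X
  have Scl: "clinear_map S" by (simp add: S_def clinear_map_def operator_eq_iff)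
  have St: "S (A \<otimes> munit (nxt s) (nxt s)) = A \<otimes> munit s s" for A s
    by (simp add: S_def operator_eq_iff munit_nth)
  have Sb: "block r (S X) = block (nxt r) X" for r X
    by (simp add: S_def operator_eq_iff)
  have comm: "S (gen X) = gen (S X)" if "dephase X = X" for X
  proof (rule clinear_map_dephase_induct[of "\<lambda>X. S (gen X)" "\<lambda>X. gen (S X)"])
    fix A s
    obtain s' where s: "s = nxt s'" using surj_nxt by (metis surjD)
    show "S (gen (A \<otimes> munit s s)) = gen (S (A \<otimes> munit s s))"
      unfolding s St clock_generator_tensor using periodic by (simp add: clinear_mapD[OF Scl] St)
  qed (use Scl gen_clinear that in \<open>auto simp: clinear_map_def\<close>)
  have "S (E t (A \<otimes> munit (nxt s) (nxt s))) = E t (S (A \<otimes> munit (nxt s) (nxt s)))"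
    using superop_exp_commute[of gen S "{X. dephase X = X}" _ t]
    by (simp add: gen_linear clinear_map_linear[OF Scl] dephase_gen comm)
  then show ?thesis using Sb unfolding St by metis
qed

lemma nxt_label: "nxt (tick (periodic_label NT n)) = tick (periodic_label NT (n + 1))"
proof -
  have le: "periodic_label NT n \<le> NT"
  proof -
    have "n mod (int NT + 1) < int NT + 1" by (rule pos_mod_bound) simp
    then show ?thesis unfolding periodic_label_def by linarith
  qed
  have "int ((periodic_label NT n + 1) mod (NT + 1)) = int (periodic_label NT (n + 1))"
    by (simp add: periodic_label_def zmod_int mod_simps add.commute)
  then show ?thesis using nxt_tick[OF le] by simp
qed

text \<open>Shifting \<open>k\<close> down to 0 one tick at a time gives a right-hand side free of
  \<open>k\<close>, so any two starting labels can be compared.\<close>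

lemma E_label: "k \<le> NT \<Longrightarrow> block (tick (periodic_label NT (int k + l))) (E t (A \<otimes> munit (tick k) (tick k)))
    = block (tick (periodic_label NT l)) (E t (A \<otimes> munit (tick 0) (tick 0)))"
proof (induction k)
  case (Suc k)
  have "tick (periodic_label NT (int (Suc k) + l)) = nxt (tick (periodic_label NT (int k + l)))"
    unfolding nxt_label by (simp add: ac_simps)
  moreover have "tick (Suc k) = nxt (tick k)" using Suc.prems by (simp add: nxt_tick_Suc)
  ultimately show ?case using Suc E_shift by simp
qed simp

lemma M_time_invariance: "time_invariance tick NT M"
  unfolding time_invariance_def from_tick_def ketbra_munit ptrace_R_mult_proj
  using M E_label by simp

text \<open>
  Let \<open>p\<close> be the probability of one tick and \<open>q\<close> that of the remaining register states. Their rates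
  satisfy \<open>q' \<le> C p\<close> and \<open>p' \<ge> - C p\<close>, where \<open>C\<close> bounds the tick rate; so \<open>e\<^sup>C\<^sup>t p\<close> increases and
  \<open>q \<le> C t e\<^sup>C\<^sup>t p\<close>.
\<close>

lemma others_le:
  assumes \<rho>: "density_op \<rho>"
  shows "\<exists>C\<ge>0. \<forall>t\<ge>0. (\<Sum>r\<in>UNIV - {s, nxt s}. Re (trace (block r (E t (\<rho> \<otimes> munit s s)))))
    \<le> C * t * exp (C * t) * Re (trace (block (nxt s) (E t (\<rho> \<otimes> munit s s))))"
proof -
  define f where "f r t = Re (trace (block r (E t (\<rho> \<otimes> munit s s))))" for r t
  define \<kappa> where "\<kappa> r t = Re (trace (jump (block r (E t (\<rho> \<otimes> munit s s)))))" for r t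
  define C where "C = (\<Sum>i\<in>UNIV. \<Sum>j\<in>UNIV. norm (trace (jump (munit i j))))"
  have C: "0 \<le> C" unfolding C_def by (intro sum_nonneg) auto
  have psd: "psd (block r (E t (\<rho> \<otimes> munit s s)))" if "0 \<le> t" for r t
    using \<rho> that by (intro psd_block E_psd psd_tensor) (auto simp: density_op_def)
  have f: "0 \<le> f r t" if "0 \<le> t" for r t
    unfolding f_def by (intro psd_trace_nonneg psd that)
  have \<kappa>: "0 \<le> \<kappa> r t" "\<kappa> r t \<le> C * f r t" if "0 \<le> t" for r t
    using psd_trace_nonneg[OF psd_jump_part[OF psd[OF that]]]
      clinear_trace_bound[OF jump_part_clinear psd[OF that], of NL J r]
      complex_Re_le_cmod[of "trace (jump (block r (E t (\<rho> \<otimes> munit s s))))"]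
    unfolding \<kappa>_def f_def C_def by (blast, linarith)
  have f_deriv: "(f (nxt r) has_real_derivative (\<kappa> r t - \<kappa> (nxt r) t)) (at t)" for r t
  proof -
    have "bounded_linear (\<lambda>X :: ('c \<times> 'r) operator. Re (trace (block (nxt r) X)))"
      unfolding linear_conv_bounded_linear[symmetric]
      by (rule linearI) (simp_all add: block_add block_scaleR trace_add trace_scaleR)
    from E_deriv[OF this, of "\<rho> \<otimes> munit s s" t]
    have "(f (nxt r) has_real_derivative Re (trace (block (nxt r) (gen (E t (\<rho> \<otimes> munit s s)))))) (at t)"
      unfolding has_real_derivative_iff_has_vector_derivative f_def .
    then show ?thesis
      unfolding block_gen[OF dephase_E[OF dephase_tensor]] using periodic
      by (simp add: trace_add trace_stay_part \<kappa>_def)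
  qed
  define R where "R = UNIV - {s, nxt s}"
  define prv where "prv = inv nxt"
  have prv: "nxt (prv r) = r" for r unfolding prv_def using surj_nxt by (simp add: surj_f_inv_f)
  define q where "q t = (\<Sum>r\<in>R. f r t)" for t
  have q_deriv: "(q has_real_derivative (\<Sum>r\<in>R. \<kappa> (prv r) t - \<kappa> r t)) (at t)" for t
    unfolding q_def using f_deriv[of "prv _"] by (auto intro!: DERIV_sum simp: prv)
  have q_le: "(\<Sum>r\<in>R. \<kappa> (prv r) t - \<kappa> r t) \<le> C * f (nxt s) t" if t: "0 \<le> t" for t
  proof -
    have inj: "inj prv" using prv by (metis injI)
    have "(\<Sum>r\<in>R. \<kappa> (prv r) t) = (\<Sum>r\<in>prv ` R. \<kappa> r t)"
      using inj by (subst sum.reindex) (auto intro: inj_on_subset)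
    \<comment> \<open>Probability enters \<open>R\<close> only from \<open>nxt s\<close> or from
      within: the successor of \<open>s\<close> is not in \<open>R\<close>. The flows inside
      \<open>R\<close> cancel against its outflow.\<close>
    also have "\<dots> \<le> (\<Sum>r\<in>insert (nxt s) R. \<kappa> r t)"
    proof (intro sum_mono2)
      show "prv ` R \<subseteq> insert (nxt s) R"
      proof
        fix r assume "r \<in> prv ` R"
        then have "nxt r \<in> R" using prv by auto
        then have "nxt r \<noteq> nxt s" by (simp add: R_def)
        then show "r \<in> insert (nxt s) R" by (auto simp: R_def)
      qed
    qed (auto simp: \<kappa> t)
    also have "\<dots> = \<kappa> (nxt s) t + (\<Sum>r\<in>R. \<kappa> r t)"
      by (subst sum.insert) (auto simp: R_def)
    finally show ?thesis using \<kappa>(2)[OF t, of "nxt s"] by (simp add: sum_subtractf)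
  qed
  \<comment> \<open>The two rate inequalities are combined into one function that starts at 0 and
    has nonnegative derivative: differentiating the factor \<open>t\<close> yields a term that
    dominates the rate of \<open>q\<close>.\<close>
  define g where "g t = C * t * exp (C * t) * f (nxt s) t - q t" for t
  have "0 \<le> g t" if "0 \<le> t" for t
  proof -
    have "g 0 \<le> g t"
    proof (rule DERIV_nonneg_imp_nondecreasing[OF that])
      fix u assume u: "0 \<le> u" "u \<le> t"
      define g' where "g' = C * exp (C * u) * f (nxt s) u + C * u * (C * exp (C * u)) * f (nxt s) u
        + C * u * exp (C * u) * (\<kappa> s u - \<kappa> (nxt s) u) - (\<Sum>r\<in>R. \<kappa> (prv r) u - \<kappa> r u)"
      have "(g has_real_derivative g') (at u)"
        unfolding g_def by (rule derivative_eq_intros f_deriv q_deriv refl)+ (simp add: g'_def algebra_simps)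
      moreover have "0 \<le> g'"
      proof -
        have "C * f (nxt s) u \<le> exp (C * u) * (C * f (nxt s) u)"
          using mult_right_mono[of 1 "exp (C * u)" "C * f (nxt s) u"] C u f[of u] by simp
        moreover have "0 \<le> C * u * exp (C * u) * (C * f (nxt s) u + \<kappa> s u - \<kappa> (nxt s) u)"
          using C u \<kappa>[of u] by (intro mult_nonneg_nonneg) (auto intro: add_increasing2)
        ultimately show ?thesis using q_le[OF u(1)] by (simp add: g'_def algebra_simps)
      qed
      ultimately show "\<exists>y. (g has_real_derivative y) (at u) \<and> 0 \<le> y" by blast
    qed
    moreover have "q 0 = 0"
      unfolding q_def f_def by (intro sum.neutral) (auto simp: superop_exp_zero[OF gen_linear] block_tensor R_def)
    ultimately show ?thesis by (simp add: g_def)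
  qed
  then show ?thesis using C unfolding g_def q_def f_def R_def by auto
qed

text \<open>Both conjuncts come from \<open>others_le\<close>: dividing by the probability of one
  tick leaves \<open>C t exp (C t)\<close>, which tends to 0, and where that probability is 0 the
  other ones are 0 as well.\<close>

lemma M_leading_order: "leading_order tick NT M"
  unfolding leading_order_def Let_def
proof (intro allI impI)
  fix k and \<rho> :: "'c operator" assume k: "k \<le> NT" and \<rho>: "density_op \<rho>"
  define s where "s = tick k"
  define f where "f r t = Re (trace (block r (E t (\<rho> \<otimes> munit s s))))" for r t
  have tp: "tick_prob tick M \<rho> k l t = f (tick l) t" if "0 \<le> t" for l t
    by (simp add: tick_prob_def from_tick_def ketbra_munit trace_mult_proj M that f_def s_def)
  let ?f = "(k + 1) mod (NT + 1)"
  have nt: "tick ?f = nxt s" using k by (simp add: s_def nxt_tick)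
  have "bij_betw tick ({0..NT} - {k, ?f}) (UNIV - {tick k, tick ?f})"
    using labelling k unfolding tick_labelling_def
    by (intro bij_betw_DiffI) (auto simp: bij_betw_def inj_on_def)
  then have "bij_betw tick ({0..NT} - {k, ?f}) (UNIV - {s, nxt s})"
    by (simp only: nt s_def[symmetric])
  from sum.reindex_bij_betw[OF this]
  have others: "(\<Sum>l\<in>{0..NT} - {k, ?f}. tick_prob tick M \<rho> k l t) = (\<Sum>r\<in>UNIV - {s, nxt s}. f r t)" if "0 \<le> t" for t
    by (simp add: tp that)
  have fpos: "0 \<le> f r t" if "0 \<le> t" for r t
    unfolding f_def using \<rho> that by (intro psd_trace_nonneg psd_block E_psd psd_tensor) (auto simp: density_op_def)
  obtain C where C: "0 \<le> C" "\<And>t. 0 \<le> t \<Longrightarrow> (\<Sum>r\<in>UNIV - {s, nxt s}. f r t) \<le> C * t * exp (C * t) * f (nxt s) t"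
    using others_le[OF \<rho>, of s] unfolding f_def by blast
  let ?q = "\<lambda>t. (\<Sum>r\<in>UNIV - {s, nxt s}. f r t)"
  have ev: "\<forall>\<^sub>F t :: real in at_right 0. 0 < t" by (simp add: eventually_at_filter)
  have "((\<lambda>t. C * t * exp (C * t)) \<longlongrightarrow> C * 0 * exp (C * 0)) (at_right 0)"
    by (intro tendsto_intros)
  then have lim: "((\<lambda>t. C * t * exp (C * t)) \<longlongrightarrow> 0) (at_right 0)" by simp
  have "((\<lambda>t. ?q t / f (nxt s) t) \<longlongrightarrow> 0) (at_right 0)"
  proof (rule tendsto_sandwich[OF _ _ tendsto_const lim])
    show "\<forall>\<^sub>F t in at_right 0. 0 \<le> ?q t / f (nxt s) t"
      using ev by eventually_elim (intro divide_nonneg_nonneg sum_nonneg fpos; simp)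
    show "\<forall>\<^sub>F t in at_right 0. ?q t / f (nxt s) t \<le> C * t * exp (C * t)"
      using ev
    proof eventually_elim
      case (elim t)
      then show ?case using C(2)[of t] fpos[of t "nxt s"] C(1)
        by (cases "f (nxt s) t = 0") (auto simp: divide_le_eq)
    qed
  qed
  moreover have "\<forall>\<^sub>F t in at_right 0. ?q t / f (nxt s) t =
      (\<Sum>l\<in>{0..NT} - {k, ?f}. tick_prob tick M \<rho> k l t) / tick_prob tick M \<rho> k ?f t"
    using ev by eventually_elim (subst others, simp, simp only: tp[OF less_imp_le] nt)
  ultimately have 1: "((\<lambda>t. (\<Sum>l\<in>{0..NT} - {k, ?f}. tick_prob tick M \<rho> k l t) / tick_prob tick M \<rho> k ?f t) \<longlongrightarrow> 0) (at_right 0)"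
    by (rule Lim_transform_eventually)
  have 2: "\<forall>\<^sub>F t in at_right 0. tick_prob tick M \<rho> k ?f t = 0 \<longrightarrow>
      (\<Sum>l\<in>{0..NT} - {k, ?f}. tick_prob tick M \<rho> k l t) = 0"
    using ev
  proof eventually_elim
    case (elim t)
    have "0 \<le> ?q t" using elim by (intro sum_nonneg fpos) simp
    then have "f (nxt s) t = 0 \<longrightarrow> ?q t = 0" using C(2)[of t] elim by auto
    then show ?case using elim by (subst others, simp, simp only: tp[OF less_imp_le] nt)
  qed
  show "((\<lambda>t. (\<Sum>l\<in>{0..NT} - {k, ?f}. tick_prob tick M \<rho> k l t) / tick_prob tick M \<rho> k ?f t) \<longlongrightarrow> 0) (at_right 0)
    \<and> (\<forall>\<^sub>F t in at_right 0. tick_prob tick M \<rho> k ?f t = 0 \<longrightarrow>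
      (\<Sum>l\<in>{0..NT} - {k, ?f}. tick_prob tick M \<rho> k l t) = 0)"
    using 1 2 by blast
qed

lemma M_periodic_clock_channels: "periodic_clock_channels tick NT M"
  unfolding periodic_clock_channels_def
  using M_channel M_time_invariance M_self_timing M_zeroth_order M_leading_order by blast

end

end

end

subsection \<open>The cut-off register\<close>

lemma smallo_norm_iff:
  fixes f :: "real \<Rightarrow> 'a::real_normed_vector"
  shows "(\<lambda>t. norm (f t)) \<in> o[at_right 0](\<lambda>t. t) \<longleftrightarrow> ((\<lambda>t. f t /\<^sub>R t) \<longlongrightarrow> 0) (at_right 0)"
proof -
  have nz: "\<forall>\<^sub>F t :: real in at_right 0. t \<noteq> 0" by (simp add: eventually_at_filter)
  have "(\<lambda>t. norm (f t)) \<in> o[at_right 0](\<lambda>t. t) \<longleftrightarrow> ((\<lambda>t. norm (f t) / t) \<longlongrightarrow> 0) (at_right 0)"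
    by (auto intro: smalloI_tendsto[OF _ nz] dest: smalloD_tendsto)
  also have "\<dots> \<longleftrightarrow> ((\<lambda>t. norm (f t /\<^sub>R t)) \<longlongrightarrow> 0) (at_right 0)"
    by (intro tendsto_cong) (auto simp: eventually_at_filter divide_inverse mult.commute)
  also have "\<dots> \<longleftrightarrow> ((\<lambda>t. f t /\<^sub>R t) \<longlongrightarrow> 0) (at_right 0)"
    by (rule tendsto_norm_zero_iff)
  finally show ?thesis .
qed

lemma tendsto_quotient_diff:
  fixes f g :: "real \<Rightarrow> 'a::real_normed_vector"
  assumes "((\<lambda>h. (f h - X) /\<^sub>R h) \<longlongrightarrow> D) F" "((\<lambda>h. (g h - X) /\<^sub>R h) \<longlongrightarrow> D) F"
  shows "((\<lambda>h. (f h - g h) /\<^sub>R h) \<longlongrightarrow> 0) F"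
  using tendsto_diff[OF assms] by (simp add: algebra_simps)

lemma ptrace_C_add: "ptrace_C (X + Y) = ptrace_C X + ptrace_C Y"
  and ptrace_C_diff: "ptrace_C (X - Y) = ptrace_C X - ptrace_C Y"
  and ptrace_C_scaleR: "ptrace_C (r *\<^sub>R X) = r *\<^sub>R ptrace_C X"
  by (simp_all add: ptrace_C_def operator_eq_iff sum.distrib sum_subtractf scaleR_sum_right)

lemma bounded_linear_ptrace_C: "bounded_linear ptrace_C"
  unfolding linear_conv_bounded_linear[symmetric] by (rule linearI) (simp_all add: ptrace_C_add ptrace_C_scaleR)

lemma ptrace_C_tensor: "ptrace_C (A \<otimes> B) = trace A *\<^sub>c B"
  by (simp add: ptrace_C_def trace_def operator_eq_iff sum_distrib_right)

lemma ptrace_C_nth: "ptrace_C X $ r $ r = trace (block r X)"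
  by (simp add: ptrace_C_def trace_def)

context tick_register
begin

lemma hop_lt: "k < NT \<Longrightarrow> hop reg tick NT (tick k) = 1"
  using tick_eq_iff[of k NT] by (simp add: hop_def)

lemma cutoff_generator_lt:
  "k < NT \<Longrightarrow> clock_generator Cutoff tick NT H NL L J (A \<otimes> munit (tick k) (tick k)) =
    clock_generator Periodic tick NT H NL L J (A \<otimes> munit (tick k) (tick k))"
  by (simp add: clock_generator_tensor hop_lt)

lemma cutoff_generator_end:
  "clock_generator Cutoff tick NT H NL L J (A \<otimes> munit (tick NT) (tick NT)) =
    stay_part 0 H NL L J A \<otimes> munit (tick NT) (tick NT)"
  by (simp add: clock_generator_tensor hop_def)

text \<open>The operators \<open>A \<otimes> |NT><NT|\<close> form an invariant subspace of the
  cut-off generator. \<open>Q\<close> projects onto it and commutes with the generator there, so the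
  exponential never leaves it.\<close>

lemma cutoff_exp_end:
  fixes H :: "'c::finite operator"
  assumes "hermitian H" "r \<noteq> tick NT"
  shows "block r (superop_exp (clock_generator Cutoff tick NT H NL L J) t (A \<otimes> munit (tick NT) (tick NT))) = 0"
proof -
  interpret clock_dynamics tick NT Cutoff H NL L J by unfold_locales (rule assms)
  let ?e = "munit (tick NT) (tick NT)"
  define Q :: "('c \<times> 'r) operator \<Rightarrow> ('c \<times> 'r) operator" where "Q X = block (tick NT) X \<otimes> ?e" for X
  have lin: "linear Q"
    by (rule linearI) (simp_all add: Q_def block_add block_scaleR tensor_add tensor_scaleR)
  have "Q (E t (A \<otimes> ?e)) = E t (Q (A \<otimes> ?e))"
  proof (rule superop_exp_commute[OF gen_linear lin])
    show "A \<otimes> ?e \<in> range (\<lambda>A. A \<otimes> ?e)" by blast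
    fix X assume "X \<in> range (\<lambda>A :: 'c operator. A \<otimes> ?e)"
    then obtain A :: "'c operator" where "X = A \<otimes> ?e" by blast
    then show "gen X \<in> range (\<lambda>A. A \<otimes> ?e)" "Q (gen X) = gen (Q X)"
      unfolding Q_def by (auto simp: cutoff_generator_end block_tensor)
  qed
  then have "E t (A \<otimes> ?e) = Q (E t (A \<otimes> ?e))" by (simp add: Q_def block_tensor)
  then show ?thesis using assms(2) by (metis Q_def block_tensor)
qed

text \<open>The witness is the periodic dynamics with the same \<open>H\<close>, \<open>L\<close>,
  \<open>J\<close>. Below the last state the two generators coincide, so the dynamics agree to first
  order. At the last state the cut-off generator acts on the clockwork alone and is traceless, so
  the reduced register state has derivative 0.\<close>

lemma cutoff_underlying_periodic:
  fixes H :: "'c::finite operator"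
  assumes H: "hermitian H" and M: "\<And>t. 0 \<le> t \<Longrightarrow> M t = superop_exp (clock_generator Cutoff tick NT H NL L J) t"
  shows "underlying_periodic tick NT M (superop_exp (clock_generator Periodic tick NT H NL L J))"
proof -
  interpret P: clock_dynamics tick NT Periodic H NL L J by unfold_locales (rule H)
  interpret C: clock_dynamics tick NT Cutoff H NL L J by unfold_locales (rule H)
  have ev: "\<forall>\<^sub>F t :: real in at_right 0. M t = C.E t"
    by (auto simp: eventually_at_filter M)
  show ?thesis
    unfolding underlying_periodic_def
  proof (intro conjI allI impI)
    show "periodic_clock_channels tick NT P.E"
      by (rule P.M_periodic_clock_channels) simp_all
  next
    fix \<rho> :: "'c operator" and k assume k: "k < NT"
    let ?X = "\<rho> \<otimes> munit (tick k) (tick k)"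
    have "((\<lambda>h. (C.E h ?X - P.E h ?X) /\<^sub>R h) \<longlongrightarrow> 0) (at_right 0)"
      using superop_exp_deriv_0[OF C.gen_linear, of ?X] superop_exp_deriv_0[OF P.gen_linear, of ?X]
      unfolding cutoff_generator_lt[OF k] by (rule tendsto_quotient_diff)
    then have "((\<lambda>h. (M h ?X - P.E h ?X) /\<^sub>R h) \<longlongrightarrow> 0) (at_right 0)"
      by (rule Lim_transform_eventually) (use ev in eventually_elim, simp)
    then show "(\<lambda>t. norm (from_tick tick M t k \<rho> - from_tick tick P.E t k \<rho>)) \<in> o[at_right 0](\<lambda>t. t)"
      unfolding smallo_norm_iff from_tick_def ketbra_munit .
  next
    fix \<rho> :: "'c operator" assume \<rho>: "density_op \<rho>"
    let ?e = "munit (tick NT) (tick NT)"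
    have "((\<lambda>h. ptrace_C ((C.E h (\<rho> \<otimes> ?e) - \<rho> \<otimes> ?e) /\<^sub>R h)) \<longlongrightarrow> ptrace_C (C.gen (\<rho> \<otimes> ?e))) (at_right 0)"
      by (rule bounded_linear.tendsto[OF bounded_linear_ptrace_C superop_exp_deriv_0[OF C.gen_linear]])
    also have "ptrace_C (C.gen (\<rho> \<otimes> ?e)) = 0"
      by (simp add: cutoff_generator_end ptrace_C_tensor trace_stay_part)
    finally have "((\<lambda>h. (ptrace_C (C.E h (\<rho> \<otimes> ?e)) - ?e) /\<^sub>R h) \<longlongrightarrow> 0) (at_right 0)"
      using \<rho> by (simp add: ptrace_C_scaleR ptrace_C_diff ptrace_C_tensor density_op_def del: scaleR_right_diff_distrib)
    then have "((\<lambda>h. (ptrace_C (M h (\<rho> \<otimes> ?e)) - ?e) /\<^sub>R h) \<longlongrightarrow> 0) (at_right 0)"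
      by (rule Lim_transform_eventually) (use ev in eventually_elim, simp)
    then show "(\<lambda>t. norm (ptrace_C (from_tick tick M t NT \<rho>) - tick_proj tick NT)) \<in> o[at_right 0](\<lambda>t. t)"
      unfolding smallo_norm_iff from_tick_def ketbra_munit .
  qed
qed

lemma explicit_dynamics_clock:
  assumes H: "hermitian H" and \<rho>0: "density_op \<rho>0"
    and M: "\<And>t. 0 \<le> t \<Longrightarrow> M t = superop_exp (clock_generator reg tick NT H NL L J) t"
  shows "ticking_clock reg tick NT \<rho>0 M" "classical_register tick NT M"
proof -
  interpret clock_dynamics tick NT reg H NL L J by unfold_locales (rule H)
  show "classical_register tick NT M" by (rule M_classical[OF M])
  show "ticking_clock reg tick NT \<rho>0 M"
  proof (cases reg)
    case Periodic
    then show ?thesis using M_periodic_clock_channels[OF M Periodic] \<rho>0 by simp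
  next
    case Cutoff
    then show ?thesis
      using M_channel[OF M] M_self_timing[OF M] cutoff_underlying_periodic[OF H M[unfolded Cutoff]] \<rho>0 by auto
  qed
qed

end

subsection \<open>Generators of ticking clocks\<close>

lemma channelD:
  assumes "channel \<Phi>"
  shows "clinear_map \<Phi>" "linear \<Phi>" "completely_positive \<Phi>" "trace (\<Phi> X) = trace X"
  using assms clinear_map_linear by (auto simp: channel_def)

text \<open>The derivative exists in the real Banach algebra \<open>endo\<close>; complex linearity
  and tracelessness then pass to it as limits of the difference quotients.\<close>

lemma channel_semigroup_generator:
  fixes M :: "('c::finite, 'r::finite) dynamics"
  assumes ch: "\<And>t. 0 \<le> t \<Longrightarrow> channel (M t)" and self: "self_timing M" and zero: "zeroth_order M"
  shows "\<exists>G. clinear_map G \<and> (\<forall>X. trace (G X) = 0) \<and>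
    (\<forall>X. ((\<lambda>h. (M h X - X) /\<^sub>R h) \<longlongrightarrow> G X) (at_right 0))"
proof -
  have ev: "\<forall>\<^sub>F t :: real in at_right 0. 0 < t" by (simp add: eventually_at_filter)
  define T where "T t = endo (M t)" for t
  have T: "app (T t) = M t" if "0 \<le> t" for t
    unfolding T_def by (rule app_endo[OF channelD(2)[OF ch[OF that]]])
  have "T (s + t) = T s * T t" if "0 \<le> s" "0 \<le> t" for s t
  proof (rule endo_eqI)
    fix X
    have "M (t + s) = M s \<circ> M t" using self that by (simp add: self_timing_def)
    then show "app (T (s + t)) X = app (T s * T t) X"
      using that by (simp add: T add.commute)
  qed
  moreover have "T 0 = 1"
    using zero by (intro endo_eqI) (simp add: T zeroth_order_def)
  moreover have "(T \<longlongrightarrow> 1) (at_right 0)"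
  proof -
    have "((\<lambda>t. onorm (\<lambda>X. M t X - X)) \<longlongrightarrow> 0) (at_right 0)"
      using zero by (simp add: zeroth_order_def)
    moreover have "\<forall>\<^sub>F t in at_right 0. onorm (\<lambda>X. M t X - X) = norm (T t - 1)"
      using ev by eventually_elim (simp add: norm_endo_eq_onorm app.diff_left[abs_def] T)
    ultimately have "((\<lambda>t. norm (T t - 1)) \<longlongrightarrow> 0) (at_right 0)"
      by (rule Lim_transform_eventually)
    then show ?thesis by (simp add: tendsto_norm_zero_iff LIM_zero_iff)
  qed
  ultimately obtain K where K: "((\<lambda>h. (T h - 1) /\<^sub>R h) \<longlongrightarrow> K) (at_right 0)"
    using semigroup_has_generator[of T] by blast
  have lim: "((\<lambda>h. (M h X - X) /\<^sub>R h) \<longlongrightarrow> app K X) (at_right 0)" for X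
    using tendsto_app[OF K, of X]
    by (rule Lim_transform_eventually)
      (use ev in eventually_elim, simp add: app.scaleR_left app.diff_left T)
  have "app K (c *\<^sub>c X) = c *\<^sub>c app K X" for c X
  proof (rule tendsto_unique[OF _ lim])
    show "((\<lambda>h. (M h (c *\<^sub>c X) - c *\<^sub>c X) /\<^sub>R h) \<longlongrightarrow> c *\<^sub>c app K X) (at_right 0)"
      using tendsto_cscale[OF lim[of X], of c]
      by (rule Lim_transform_eventually)
        (use ev in eventually_elim, simp add: clinear_mapD[OF channelD(1)[OF ch]] cscale_scaleR cscale_minus)
  qed simp
  then have "clinear_map (app K)"
    by (simp add: clinear_map_def app.add_right)
  moreover have "trace (app K X) = 0" for X
  proof (rule tendsto_unique[OF _ tendsto_trace[OF lim]])
    show "((\<lambda>h. trace ((M h X - X) /\<^sub>R h)) \<longlongrightarrow> 0) (at_right 0)"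
      using tendsto_const
      by (rule Lim_transform_eventually)
        (use ev in eventually_elim, simp add: channelD(4)[OF ch] trace_scaleR trace_sub)
  qed simp
  ultimately show ?thesis using lim by blast
qed

lemma qform_munit: "qform u (munit i j) v = cnj (u $ i) * v $ j"
proof -
  have "qform u (munit i j) v = (\<Sum>a\<in>UNIV. \<Sum>b\<in>UNIV. if a = i then if b = j then cnj (u $ a) * v $ b else 0 else 0)"
    unfolding qform_def by (intro sum.cong) (auto simp: munit_nth)
  also have "\<dots> = (\<Sum>a\<in>UNIV. if a = i then \<Sum>b\<in>UNIV. if b = j then cnj (u $ a) * v $ b else 0 else 0)"
    by (intro sum.cong) auto
  finally show ?thesis by simp
qed

lemma cnj_mult_self_nonneg: "cnj z * z \<in> \<real>\<^sub>\<ge>\<^sub>0"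
  by (simp add: complex_nonneg_Reals_iff)

lemma qform_choi:
  "qform u (choi \<Lambda>) v = (\<Sum>i\<in>UNIV. \<Sum>j\<in>UNIV. qform (\<chi> a. u $ (a, i)) (\<Lambda> (munit i j)) (\<chi> a. v $ (a, j)))"
proof -
  have "qform u (choi \<Lambda>) v = (\<Sum>a\<in>UNIV. \<Sum>i\<in>UNIV. \<Sum>b\<in>UNIV. \<Sum>j\<in>UNIV.
      cnj (u $ (a, i)) * \<Lambda> (munit i j) $ a $ b * v $ (b, j))"
    by (simp add: qform_def sum_UNIV_prod)
  also have "\<dots> = (\<Sum>i\<in>UNIV. \<Sum>a\<in>UNIV. \<Sum>j\<in>UNIV. \<Sum>b\<in>UNIV.
      cnj (u $ (a, i)) * \<Lambda> (munit i j) $ a $ b * v $ (b, j))"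
    by (subst sum.swap) (intro sum.cong refl sum.swap)
  also have "\<dots> = (\<Sum>i\<in>UNIV. \<Sum>j\<in>UNIV. qform (\<chi> a. u $ (a, i)) (\<Lambda> (munit i j)) (\<chi> a. v $ (a, j)))"
    unfolding qform_def vec_lambda_beta by (rule sum.cong[OF refl], rule sum.swap)
  finally show ?thesis .
qed

text \<open>Complete positivity is applied to the blocks \<open>munit i j \<otimes> |s><s|\<close>,
  a multiple of the projector onto a maximally entangled vector of ancilla and clockwork.
  Compression to the register state \<open>r\<close> keeps the result positive.\<close>

lemma psd_choi_block:
  assumes "completely_positive \<Phi>"
  shows "psd (choi (\<lambda>A. block r (\<Phi> (A \<otimes> munit s s))))"
  unfolding psd_qform
proof
  fix v
  have "(\<Sum>i\<in>UNIV. \<Sum>j\<in>UNIV. qform (u i) (munit i j \<otimes> munit s s) (u j)) \<in> \<real>\<^sub>\<ge>\<^sub>0" for u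
  proof -
    have "(\<Sum>i\<in>UNIV. \<Sum>j\<in>UNIV. qform (u i) (munit i j \<otimes> munit s s) (u j)) =
      cnj (\<Sum>i\<in>UNIV. u i $ (i, s)) * (\<Sum>i\<in>UNIV. u i $ (i, s))"
      by (simp add: qform_tensor qform_munit sum_product)
    also have "\<dots> \<in> \<real>\<^sub>\<ge>\<^sub>0" by (rule cnj_mult_self_nonneg)
    finally show ?thesis .
  qed
  from completely_positive_finite[OF assms this]
  show "qform v (choi (\<lambda>A. block r (\<Phi> (A \<otimes> munit s s)))) v \<in> \<real>\<^sub>\<ge>\<^sub>0"
    unfolding qform_choi qform_block by simp
qed

locale channel_derivative =
  fixes M :: "('c::finite, 'r::finite) dynamics" and G
  assumes cp: "\<And>t. 0 \<le> t \<Longrightarrow> completely_positive (M t)"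
    and lim: "\<And>X. ((\<lambda>h. (M h X - X) /\<^sub>R h) \<longlongrightarrow> G X) (at_right 0)"
begin

lemma ev: "\<forall>\<^sub>F t :: real in at_right 0. 0 < t"
  by (simp add: eventually_at_filter)

lemma lim_block: "((\<lambda>h. (block r (M h X) - block r X) /\<^sub>R h) \<longlongrightarrow> block r (G X)) (at_right 0)"
  using tendsto_block[OF lim[of X], of r] unfolding block_scaleR block_diff .

lemma lim_choi_block:
  "((\<lambda>h. (choi (\<lambda>A. block r (M h (A \<otimes> munit s s))) - choi (\<lambda>A. block r (A \<otimes> munit s s))) /\<^sub>R h)
    \<longlongrightarrow> choi (\<lambda>A. block r (G (A \<otimes> munit s s)))) (at_right 0)"
proof (rule tendsto_operatorI)
  fix p q :: "'c \<times> 'c"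
  show "((\<lambda>h. ((choi (\<lambda>A. block r (M h (A \<otimes> munit s s))) - choi (\<lambda>A. block r (A \<otimes> munit s s))) /\<^sub>R h) $ p $ q)
    \<longlongrightarrow> choi (\<lambda>A. block r (G (A \<otimes> munit s s))) $ p $ q) (at_right 0)"
    using tendsto_operator_nth[OF lim_block[of r "munit (snd p) (snd q) \<otimes> munit s s"], of "fst p" "fst q"] by simp
qed

text \<open>For \<open>r \<noteq> s\<close> the block is empty at time 0, so nothing is subtracted
  in the difference quotient and full positivity survives the limit.\<close>

lemma psd_choi_jump:
  assumes "r \<noteq> s"
  shows "psd (choi (\<lambda>A. block r (G (A \<otimes> munit s s))))"
proof (rule psd_lim[OF lim_choi_block])
  have "choi (\<lambda>A :: 'c operator. block r (A \<otimes> munit s s)) = 0"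
    using assms by (simp add: operator_eq_iff munit_nth)
  then have "psd ((choi (\<lambda>A. block r (M h (A \<otimes> munit s s))) - choi (\<lambda>A. block r (A \<otimes> munit s s))) /\<^sub>R h)"
    if "0 < h" for h
    using psd_scaleR[OF psd_choi_block[OF cp], of h "inverse h" r s] that by simp
  then show "\<forall>\<^sub>F h in at_right 0. psd ((choi (\<lambda>A. block r (M h (A \<otimes> munit s s))) - choi (\<lambda>A. block r (A \<otimes> munit s s))) /\<^sub>R h)"
    using ev by (auto elim: eventually_mono)
qed simp

lemma psd_jump:
  assumes "r \<noteq> s" "psd A"
  shows "psd (block r (G (A \<otimes> munit s s)))"
proof (rule psd_lim[OF lim_block])
  have "psd ((block r (M h (A \<otimes> munit s s)) - block r (A \<otimes> munit s s)) /\<^sub>R h)" if "0 < h" for h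
    using psd_scaleR[OF psd_block[OF completely_positive_psd[OF cp psd_tensor[OF assms(2)]]], of h "inverse h"] that assms(1)
    by (simp add: block_tensor)
  then show "\<forall>\<^sub>F h in at_right 0. psd ((block r (M h (A \<otimes> munit s s)) - block r (A \<otimes> munit s s)) /\<^sub>R h)"
    using ev by (auto elim: eventually_mono)
qed simp

text \<open>Here the identity map is subtracted. Its Choi matrix is the rank-one operator of the
  maximally entangled vector, so positivity survives only on vectors orthogonal to it.\<close>

lemma choi_stay:
  shows "hermitian (choi (\<lambda>A. block s (G (A \<otimes> munit s s))))"
    and "(\<Sum>i\<in>UNIV. v $ (i, i)) = 0 \<Longrightarrow> qform v (choi (\<lambda>A. block s (G (A \<otimes> munit s s)))) v \<in> \<real>\<^sub>\<ge>\<^sub>0"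
proof -
  let ?C = "\<lambda>h. choi (\<lambda>A. block s (M h (A \<otimes> munit s s)))" and ?I = "choi (\<lambda>A :: 'c operator. block s (A \<otimes> munit s s))"
  let ?D = "choi (\<lambda>A. block s (G (A \<otimes> munit s s)))"
  have I: "?I\<^sup>\<dagger> = ?I" by (auto simp: operator_eq_iff munit_nth)
  have C: "(?C h)\<^sup>\<dagger> = ?C h" if "0 \<le> h" for h
    using psd_hermitian[OF psd_choi_block[OF cp[OF that]]] by (simp add: hermitian_def)
  have "cnj (?D $ q $ p) = ?D $ p $ q" for p q
  proof (rule tendsto_unique[OF _ _ tendsto_operator_nth[OF lim_choi_block]])
    show "((\<lambda>h. ((?C h - ?I) /\<^sub>R h) $ p $ q) \<longlongrightarrow> cnj (?D $ q $ p)) (at_right 0)"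
    proof (rule Lim_transform_eventually)
      show "((\<lambda>h. cnj (((?C h - ?I) /\<^sub>R h) $ q $ p)) \<longlongrightarrow> cnj (?D $ q $ p)) (at_right 0)"
        by (intro tendsto_cnj tendsto_operator_nth lim_choi_block)
      have "((?C h - ?I) /\<^sub>R h)\<^sup>\<dagger> = (?C h - ?I) /\<^sub>R h" if "0 < h" for h
        using that unfolding dagger_scaleR dagger_minus I by (simp add: C)
      then have "cnj (((?C h - ?I) /\<^sub>R h) $ q $ p) = ((?C h - ?I) /\<^sub>R h) $ p $ q" if "0 < h" for h
        using that dagger_nth[of "(?C h - ?I) /\<^sub>R h" p q] by (simp only:)
      then show "\<forall>\<^sub>F h in at_right 0. cnj (((?C h - ?I) /\<^sub>R h) $ q $ p) = ((?C h - ?I) /\<^sub>R h) $ p $ q"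
        using ev by (auto elim: eventually_mono)
    qed
  qed simp
  then show "hermitian ?D" by (simp add: hermitian_def operator_eq_iff)
  assume v: "(\<Sum>i\<in>UNIV. v $ (i, i)) = 0"
  show "qform v ?D v \<in> \<real>\<^sub>\<ge>\<^sub>0"
  proof (rule nonneg_Reals_lim[OF tendsto_qform[OF lim_choi_block]])
    have "qform v ?I v = cnj (\<Sum>i\<in>UNIV. v $ (i, i)) * (\<Sum>i\<in>UNIV. v $ (i, i))"
      by (simp add: qform_choi block_tensor qform_munit sum_product)
    then have "qform v ?I v = 0" using v by simp
    then have "qform v ((?C h - ?I) /\<^sub>R h) v \<in> \<real>\<^sub>\<ge>\<^sub>0" if "0 < h" for h
      using psd_choi_block[OF cp, of h s s] that unfolding psd_qform qform_scaleR qform_diff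
      by (auto simp: complex_nonneg_Reals_iff)
    then show "\<forall>\<^sub>F h in at_right 0. qform v ((?C h - ?I) /\<^sub>R h) v \<in> \<real>\<^sub>\<ge>\<^sub>0"
      using ev by (auto elim: eventually_mono)
  qed simp
qed

end

section \<open>From the derivative to the operators \<open>H\<close>, \<open>L\<close> and
  \<open>J\<close>\<close>

text \<open>The no-tick part has a free drift operator \<open>F\<close>. Conservation of the trace
  determines its Hermitian part through \<open>L\<close> and \<open>J\<close>; its anti-Hermitian
  part is the Hamiltonian.\<close>

lemma lindblad_decomposition:
  fixes S S' :: "'n::finite operator \<Rightarrow> 'n operator"
  assumes S: "clinear_map S" "hermitian (choi S)"
      "\<And>v. (\<Sum>i\<in>UNIV. v $ (i, i)) = 0 \<Longrightarrow> qform v (choi S) v \<in> \<real>\<^sub>\<ge>\<^sub>0"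
    and S': "clinear_map S'" "psd (choi S')"
    and tr: "\<And>A. trace (S A) + trace (S' A) = 0"
  shows "\<exists>H NL L J. hermitian H \<and> (\<forall>A. stay_part 1 H NL L J A = S A) \<and> (\<forall>A. jump_part NL J A = S' A)"
proof -
  obtain K :: "'n \<times> 'n \<Rightarrow> 'n operator" and F
    where K: "\<And>A. S A = (\<Sum>k\<in>UNIV. K k ** A ** (K k)\<^sup>\<dagger>) + (F ** A + A ** F\<^sup>\<dagger>)"
    using gkls_decomposition[OF S] by blast
  obtain K' :: "'n \<times> 'n \<Rightarrow> 'n operator"
    where K': "\<And>A. S' A = (\<Sum>k\<in>UNIV. K' k ** A ** (K' k)\<^sup>\<dagger>)"
    using kraus_decomposition[OF S'] by blast
  \<comment> \<open>Both Kraus families are indexed by \<open>'n \<times> 'n\<close>, which gives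
    \<open>L\<close> and \<open>J\<close> the same length.\<close>
  define N where "N = CARD('n \<times> 'n)"
  obtain e :: "nat \<Rightarrow> 'n \<times> 'n" where e: "bij_betw e {1..N} UNIV"
    using ex_bij_betw_nat_finite_1[of "UNIV :: ('n \<times> 'n) set"] by (auto simp: N_def)
  define L where "L j = K (e j)" for j
  define J where "J j = K' (e j)" for j
  define Q where "Q = (\<Sum>j=1..N. (L j)\<^sup>\<dagger> ** L j) + (\<Sum>j=1..N. (J j)\<^sup>\<dagger> ** J j)"
  \<comment> \<open>Makes \<open>- \<i> H\<close> the anti-Hermitian part of
    \<open>F\<close>.\<close>
  define H where "H = (\<i> / 2) *\<^sub>c (F - F\<^sup>\<dagger>)"
  have S_L: "S A = (\<Sum>j=1..N. L j ** A ** (L j)\<^sup>\<dagger>) + (F ** A + A ** F\<^sup>\<dagger>)" for A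
    unfolding K L_def using sum.reindex_bij_betw[OF e, of "\<lambda>k. K k ** A ** (K k)\<^sup>\<dagger>"] by simp
  have S'_J: "S' A = (\<Sum>j=1..N. J j ** A ** (J j)\<^sup>\<dagger>)" for A
    unfolding K' J_def using sum.reindex_bij_betw[OF e, of "\<lambda>k. K' k ** A ** (K' k)\<^sup>\<dagger>"] by simp
  have cyc: "trace (X ** A ** X\<^sup>\<dagger>) = trace (X\<^sup>\<dagger> ** X ** A)" for X A :: "'n operator"
    by (simp add: trace_mul_sym[of "X ** A"] matrix_mul_assoc)
  have QF: "Q + F + F\<^sup>\<dagger> = 0"
  proof -
    have "trace ((Q + F + F\<^sup>\<dagger>) ** A) = trace (S A) + trace (S' A)" for A
      by (simp add: S_L S'_J Q_def trace_add trace_sum cyc matrix_add_rdistrib matrix_mult_sum trace_mul_sym[of A])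
    \<comment> \<open>Tracing against matrix units reads off the individual entries.\<close>
    then have z: "trace ((Q + F + F\<^sup>\<dagger>) ** munit j i) = 0" for i j by (simp add: tr)
    have "trace (X ** munit j i) = X $ i $ j" for X :: "'n operator" and i j
      by (simp add: trace_def mult_munit)
    then show ?thesis using z by (simp add: operator_eq_iff)
  qed
  have herm: "hermitian H"
    by (simp add: H_def hermitian_def dagger_cscale dagger_minus operator_eq_iff algebra_simps)
  have "stay_part 1 H N L J A = S A" for A
  proof -
    have "stay_part 1 H N L J A = (\<Sum>j=1..N. L j ** A ** (L j)\<^sup>\<dagger>)
        + ((- \<i>) *\<^sub>c commutator H A - (1/2) *\<^sub>R anticommutator Q A)"
      by (simp add: stay_part_def dissipator_def anticommutator_def Q_def sum_subtractf sum.distrib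
          matrix_add_ldistrib matrix_add_rdistrib matrix_mult_sum scaleR_sum_right scaleR_add_right)
    also have "(- \<i>) *\<^sub>c commutator H A - (1/2) *\<^sub>R anticommutator Q A = F ** A + A ** F\<^sup>\<dagger>"
    proof -
      have Q: "Q = - (F + F\<^sup>\<dagger>)" using QF by (metis add.assoc add_eq_0_iff2)
      show ?thesis
        unfolding Q H_def commutator_def anticommutator_def
        by (simp add: matrix_mult_diff matrix_add_ldistrib matrix_add_rdistrib matrix_mult_uminus
            scaleR_eq_cscale operator_eq_iff) (simp add: field_simps)
    qed
    finally show ?thesis unfolding S_L .
  qed
  moreover have "jump_part N J A = S' A" for A by (simp add: jump_part_def S'_J)
  ultimately show ?thesis using herm by blast
qed

lemma channel_derivative_channels:
  assumes "\<And>t. 0 \<le> t \<Longrightarrow> channel (M t)" "\<And>X. ((\<lambda>h. (M h X - X) /\<^sub>R h) \<longlongrightarrow> G X) (at_right 0)"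
  shows "channel_derivative M G"
  using assms by unfold_locales (auto simp: channel_def)

context tick_register
begin

lemma periodic_label_of_nat: "periodic_label NT (int m) = m mod (NT + 1)"
proof -
  have "int m mod (int NT + 1) = int (m mod (NT + 1))" by (simp add: zmod_int add.commute)
  then show ?thesis by (simp add: periodic_label_def)
qed

text \<open>Stated without a classical register, because the lemma must also serve the periodic
  clock underlying a cut-off clock. The conditions then fix only the register-diagonal part of
  \<open>G\<close>, whence the \<open>dephase\<close>.\<close>

lemma periodic_clock_generator:
  fixes M :: "('c::finite, 'r) dynamics"
  assumes per: "periodic_clock_channels tick NT M"
  shows "\<exists>G (H :: 'c operator) NL L J. (\<forall>X. ((\<lambda>h. (M h X - X) /\<^sub>R h) \<longlongrightarrow> G X) (at_right 0)) \<and> hermitian H \<and>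
    (\<forall>s A. dephase (G (A \<otimes> munit s s)) = clock_generator Periodic tick NT H NL L J (A \<otimes> munit s s))"
proof -
  have ch: "\<And>t. 0 \<le> t \<Longrightarrow> channel (M t)" and ti: "time_invariance tick NT M" and "self_timing M"
    and zo: "zeroth_order M" and lo: "leading_order tick NT M"
    using per by (auto simp: periodic_clock_channels_def)
  then obtain G where Gc: "clinear_map G" and Gtr: "\<And>X. trace (G X) = 0"
    and Glim: "\<And>X. ((\<lambda>h. (M h X - X) /\<^sub>R h) \<longlongrightarrow> G X) (at_right 0)"
    using channel_semigroup_generator by blast
  interpret channel_derivative M G using ch Glim by (rule channel_derivative_channels)
  define B where "B r s A = block r (G (A \<otimes> munit s s))" for r s and A :: "'c operator"
  have Bc: "clinear_map (B r s)" for r s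
    by (simp add: clinear_map_def B_def tensor_add tensor_cscale clinear_mapD[OF Gc] block_add block_cscale)
  have inv: "B (tick (periodic_label NT (int k + l))) (tick k) A = B (tick (periodic_label NT (int 0 + l))) (tick 0) A"
    if k: "k \<le> NT" for k l A
  proof (induction A rule: density_op_induct)
    case (density \<rho>)
    let ?r = "tick (periodic_label NT (int k + l))" and ?q = "tick (periodic_label NT (int 0 + l))"
    let ?X = "\<rho> \<otimes> munit (tick k) (tick k)" and ?Y = "\<rho> \<otimes> munit (tick 0) (tick 0)"
    have eq: "block ?r (M t ?X) = block ?q (M t ?Y)" if "0 \<le> t" for t
      using ti density that k unfolding time_invariance_def from_tick_def ketbra_munit ptrace_R_mult_proj by blast
    \<comment> \<open>Time invariance at time 0 matches the initial blocks, so the whole difference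
      quotients coincide.\<close>
    then have eq0: "block ?r ?X = block ?q ?Y" using zo eq[of 0] by (simp add: zeroth_order_def)
    show ?case
      unfolding B_def
    proof (rule tendsto_unique[OF _ lim_block])
      show "((\<lambda>h. (block ?r (M h ?X) - block ?r ?X) /\<^sub>R h) \<longlongrightarrow> block ?q (G ?Y)) (at_right 0)"
        using lim_block[of ?q ?Y]
      proof (rule Lim_transform_eventually)
        show "\<forall>\<^sub>F h in at_right 0. (block ?q (M h ?Y) - block ?q ?Y) /\<^sub>R h = (block ?r (M h ?X) - block ?r ?X) /\<^sub>R h"
          using ev
        proof eventually_elim
          case (elim h)
          show ?case unfolding eq0 eq[OF less_imp_le[OF elim]] ..
        qed
      qed
    qed simp
  qed (simp_all add: clinear_mapD[OF Bc])
  have stay: "B s s A = B (tick 0) (tick 0) A" for s A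
  proof (rule tick_cases[of s])
    fix k assume k: "k \<le> NT" "s = tick k"
    then show ?thesis using inv[OF k(1), of 0 A] periodic_label_of_nat[of k] periodic_label_of_nat[of 0] by simp
  qed
  have jump: "B (nxt s) s A = B (nxt (tick 0)) (tick 0) A" for s A
  proof (rule tick_cases[of s])
    fix k assume k: "k \<le> NT" "s = tick k"
    have "tick (periodic_label NT (int j + 1)) = nxt (tick j)" if "j \<le> NT" for j
      using periodic_label_of_nat[of "j + 1"] nxt_tick[OF that] by (simp add: add.commute)
    from this[OF k(1)] this[of 0] show ?thesis using inv[OF k(1), of 1 A] k(2) by simp
  qed
  have vanish: "B r s A = 0" if r: "r \<noteq> s" "r \<noteq> nxt s" for r s A
  proof (induction A rule: density_op_induct)
    case (density \<rho>)
    then have psd_\<rho>: "psd \<rho>" by (simp add: density_op_def)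
    obtain k where k: "k \<le> NT" "s = tick k" by (rule tick_cases)
    obtain l where l: "l \<le> NT" "r = tick l" by (rule tick_cases)
    define f where "f = (k + 1) mod (NT + 1)"
    let ?p = "tick_prob tick M \<rho> k"
    let ?I = "{0..NT} - {k, f}"
    have l_in: "l \<in> ?I" using l r k by (auto simp: nxt_tick f_def)
    have nt: "nxt s = tick f" using k by (simp add: nxt_tick f_def)
    have f: "f \<le> NT" "f \<noteq> k"
      using mod_less_divisor[of "NT + 1" "k + 1"] nxt_neq[of s] nt k by (auto simp: f_def)
    have p_lim: "((\<lambda>h. ?p m h / h) \<longlongrightarrow> Re (trace (B (tick m) s \<rho>))) (at_right 0)"
      if m: "m \<le> NT" "m \<noteq> k" for m
    proof -
      have "tick m \<noteq> tick k" using m k by (simp add: tick_eq_iff)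
      then have "((\<lambda>h. Re (trace (block (tick m) (M h (\<rho> \<otimes> munit s s)) /\<^sub>R h))) \<longlongrightarrow> Re (trace (B (tick m) s \<rho>))) (at_right 0)"
        using tendsto_Re[OF tendsto_trace[OF lim_block[of "tick m" "\<rho> \<otimes> munit s s"]]] k
        by (simp add: B_def block_tensor)
      then show ?thesis
        by (simp add: tick_prob_def from_tick_def ketbra_munit trace_mult_proj trace_scaleR k
            divide_inverse_commute del: of_real_inverse)
    qed
    have lo': "((\<lambda>h. (\<Sum>m\<in>?I. ?p m h) / ?p f h) \<longlongrightarrow> 0) (at_right 0) \<and>
        (\<forall>\<^sub>F h in at_right 0. ?p f h = 0 \<longrightarrow> (\<Sum>m\<in>?I. ?p m h) = 0)"
      using lo k density unfolding leading_order_def Let_def f_def by blast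
    \<comment> \<open>The rate of the next tick is finite, so the leading-order quotient forces the
      other probabilities to be \<open>o(h)\<close>. Where \<open>?p f h\<close> is 0 it cannot be
      cancelled, and the second conjunct of \<open>lo'\<close> gives the equality instead.\<close>
    from tendsto_mult[OF conjunct1[OF this] p_lim[OF f]]
    have "((\<lambda>h. (\<Sum>m\<in>?I. ?p m h) / ?p f h * (?p f h / h)) \<longlongrightarrow> 0) (at_right 0)" by simp
    then have "((\<lambda>h. (\<Sum>m\<in>?I. ?p m h / h)) \<longlongrightarrow> 0) (at_right 0)"
      by (rule Lim_transform_eventually)
        (use conjunct2[OF lo'] in eventually_elim, auto simp: sum_divide_distrib[symmetric])
    moreover have "((\<lambda>h. (\<Sum>m\<in>?I. ?p m h / h)) \<longlongrightarrow> (\<Sum>m\<in>?I. Re (trace (B (tick m) s \<rho>)))) (at_right 0)"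
      by (intro tendsto_sum p_lim) auto
    ultimately have sum0: "(\<Sum>m\<in>?I. Re (trace (B (tick m) s \<rho>))) = 0"
      using tendsto_unique[of "at_right (0::real)"] by fastforce
    have pos: "0 \<le> Re (trace (B (tick m) s \<rho>))" if "m \<in> ?I" for m
      unfolding B_def using that k by (intro psd_trace_nonneg psd_jump psd_\<rho>) (auto simp: tick_eq_iff)
    have "\<forall>m\<in>?I. Re (trace (B (tick m) s \<rho>)) = 0"
      using sum0 pos by (subst (asm) sum_nonneg_eq_0_iff) auto
    then have "Re (trace (B r s \<rho>)) = 0" using l_in l by blast
    then show ?case
      using psd_trace_zero psd_jump[OF r(1) psd_\<rho>] unfolding B_def by blast
  qed (simp_all add: clinear_mapD[OF Bc])
  have "\<exists>H NL L J. hermitian H \<and> (\<forall>A. stay_part 1 H NL L J A = B (tick 0) (tick 0) A)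
      \<and> (\<forall>A. jump_part NL J A = B (nxt (tick 0)) (tick 0) A)"
  proof (rule lindblad_decomposition[OF Bc _ _ Bc])
    show "hermitian (choi (B (tick 0) (tick 0)))" unfolding B_def by (rule choi_stay)
    show "qform v (choi (B (tick 0) (tick 0))) v \<in> \<real>\<^sub>\<ge>\<^sub>0" if "(\<Sum>i\<in>UNIV. v $ (i, i)) = 0" for v
      unfolding B_def using that by (rule choi_stay)
    show "psd (choi (B (nxt (tick 0)) (tick 0)))" unfolding B_def by (rule psd_choi_jump[OF nxt_neq])
    fix A
    have "0 = trace (G (A \<otimes> munit (tick 0) (tick 0)))" by (simp add: Gtr)
    also have "\<dots> = (\<Sum>r\<in>UNIV. trace (B r (tick 0) A))" unfolding B_def by (rule trace_block)
    also have "\<dots> = (\<Sum>r\<in>{tick 0, nxt (tick 0)}. trace (B r (tick 0) A))"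
      by (intro sum.mono_neutral_right) (auto simp: vanish)
    also have "\<dots> = trace (B (tick 0) (tick 0) A) + trace (B (nxt (tick 0)) (tick 0) A)"
      using nxt_neq[of "tick 0"] by simp
    finally show "trace (B (tick 0) (tick 0) A) + trace (B (nxt (tick 0)) (tick 0) A) = 0" ..
  qed
  then obtain H NL L J where H: "hermitian H"
    and sj: "\<And>A. stay_part 1 H NL L J A = B (tick 0) (tick 0) A" "\<And>A. jump_part NL J A = B (nxt (tick 0)) (tick 0) A"
    by blast
  have "dephase (G (A \<otimes> munit s s)) = clock_generator Periodic tick NT H NL L J (A \<otimes> munit s s)" for s A
  proof (rule dephase_eqI)
    show "dephase (clock_generator Periodic tick NT H NL L J (A \<otimes> munit s s)) =
        clock_generator Periodic tick NT H NL L J (A \<otimes> munit s s)"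
      unfolding clock_generator_tensor by (simp add: clinear_mapD[OF dephase_clinear])
    fix r
    show "block r (dephase (G (A \<otimes> munit s s))) = block r (clock_generator Periodic tick NT H NL L J (A \<otimes> munit s s))"
      using vanish[of r s A] stay[of s A] jump[of s A] nxt_neq[of s]
      by (auto simp: clock_generator_tensor sj block_add block_tensor B_def[symmetric])
  qed simp
  then show ?thesis using Glim H by blast
qed

lemma classical_dephase:
  fixes M :: "('c::finite, 'r) dynamics"
  assumes cl: "classical_register tick NT M" and ch: "channel (M t)" and t: "0 \<le> t"
  shows "dephase (M t (A \<otimes> munit s s)) = M t (A \<otimes> munit s s)"
proof (induction A rule: density_op_induct)
  case (density \<rho>)
  obtain k where k: "k \<le> NT" "s = tick k" by (rule tick_cases)
  then obtain \<sigma> where "M t (\<rho> \<otimes> munit s s) = (\<Sum>n\<in>{0..NT}. \<sigma> n \<otimes> munit (tick n) (tick n))"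
    using cl t density unfolding classical_register_def from_tick_def ketbra_munit by blast
  then show ?case by (simp add: clinear_map_sum[OF dephase_clinear])
qed (simp_all add: tensor_add tensor_cscale clinear_mapD[OF channelD(1)[OF ch]] clinear_mapD[OF dephase_clinear])

text \<open>Uniqueness is applied to \<open>M t \<circ> \<Delta>\<close> and
  \<open>E t \<circ> \<Delta>\<close>. By the classical register their outputs are already diagonal,
  so the \<Delta> in the middle of a product is invisible and the semigroup law holds.\<close>

lemma agree_on_ticksI:
  fixes M E :: "('c::finite, 'r) dynamics"
  assumes ch: "\<And>t. 0 \<le> t \<Longrightarrow> channel (M t)" "\<And>t. 0 \<le> t \<Longrightarrow> channel (E t)"
    and self: "self_timing M" "self_timing E"
    and cl: "classical_register tick NT M" "classical_register tick NT E"
    and E0: "E 0 = id" and E_lim: "\<And>X. ((\<lambda>t. E t X) \<longlongrightarrow> X) (at_right 0)"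
    and diff: "\<And>A s. ((\<lambda>h. (M h (A \<otimes> munit s s) - E h (A \<otimes> munit s s)) /\<^sub>R h) \<longlongrightarrow> 0) (at_right 0)"
  shows "agree_on_ticks tick NT M E"
proof -
  have ev: "\<forall>\<^sub>F t :: real in at_right 0. 0 < t" by (simp add: eventually_at_filter)
  let ?\<Delta> = "endo dephase :: ('c \<times> 'r) operator endo"
  have app_\<Delta>: "app ?\<Delta> = dephase" by (rule app_endo[OF clinear_map_linear[OF dephase_clinear]])
  have app_ch: "app (endo \<Phi>) = \<Phi>" if "channel \<Phi>" for \<Phi> :: "('c \<times> 'r) operator \<Rightarrow> _"
    by (rule app_endo[OF channelD(2)[OF that]])
  have expand: "\<Phi> (dephase X) = (\<Sum>s\<in>UNIV. \<Phi> (block s X \<otimes> munit s s))"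
    if "channel \<Phi>" for \<Phi> :: "('c \<times> 'r) operator \<Rightarrow> ('c \<times> 'r) operator" and X
    unfolding dephase_def by (rule clinear_map_sum[OF channelD(1)[OF that]])
  have semi: "endo (P (s + t)) * ?\<Delta> = (endo (P s) * ?\<Delta>) * (endo (P t) * ?\<Delta>)"
    if P: "\<And>t. 0 \<le> t \<Longrightarrow> channel (P t)" "self_timing P" "classical_register tick NT P" and st: "0 < s" "0 < t"
    for P :: "('c, 'r) dynamics" and s t
  proof (rule endo_eqI)
    fix X
    have "dephase (P t (dephase X)) = P t (dephase X)"
      using classical_dephase[OF P(3) P(1)[of t]] st
      by (simp add: expand P(1) clinear_map_sum[OF dephase_clinear])
    moreover have "P (t + s) = P s \<circ> P t" using P(2) st by (simp add: self_timing_def)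
    moreover have "app (endo (P (s + t)) * ?\<Delta>) X = P (t + s) (dephase X)"
      using P(1)[of "s + t"] st by (simp add: app_\<Delta> app_ch add.commute)
    ultimately show "app (endo (P (s + t)) * ?\<Delta>) X = app ((endo (P s) * ?\<Delta>) * (endo (P t) * ?\<Delta>)) X"
      using P(1) st by (simp add: app_\<Delta> app_ch)
  qed
  have "((\<lambda>h. (endo (M h) * ?\<Delta> - endo (E h) * ?\<Delta>) /\<^sub>R h) \<longlongrightarrow> 0) (at_right 0)"
  proof (rule tendsto_endo)
    fix X
    have "((\<lambda>h. \<Sum>s\<in>UNIV. (M h (block s X \<otimes> munit s s) - E h (block s X \<otimes> munit s s)) /\<^sub>R h) \<longlongrightarrow> (\<Sum>s\<in>(UNIV :: 'r set). 0)) (at_right 0)"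
      by (intro tendsto_sum diff)
    then have "((\<lambda>h. \<Sum>s\<in>UNIV. (M h (block s X \<otimes> munit s s) - E h (block s X \<otimes> munit s s)) /\<^sub>R h) \<longlongrightarrow> app 0 X) (at_right 0)"
      by (simp add: app.zero_left)
    then show "((\<lambda>h. app ((endo (M h) * ?\<Delta> - endo (E h) * ?\<Delta>) /\<^sub>R h) X) \<longlongrightarrow> app 0 X) (at_right 0)"
    proof (rule Lim_transform_eventually)
      show "\<forall>\<^sub>F h in at_right 0. (\<Sum>s\<in>UNIV. (M h (block s X \<otimes> munit s s) - E h (block s X \<otimes> munit s s)) /\<^sub>R h)
          = app ((endo (M h) * ?\<Delta> - endo (E h) * ?\<Delta>) /\<^sub>R h) X"
        using ev
      proof eventually_elim
        case (elim h)
        then have c: "channel (M h)" "channel (E h)" using ch by simp_all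
        show ?case
          unfolding app.scaleR_left app.diff_left app_times app_\<Delta> app_ch[OF c(1)] app_ch[OF c(2)]
            expand[OF c(1)] expand[OF c(2)] sum_subtractf[symmetric] scaleR_sum_right ..
      qed
    qed
  qed
  moreover have "((\<lambda>h. endo (E h) * ?\<Delta>) \<longlongrightarrow> ?\<Delta>) (at_right 0)"
  proof (rule tendsto_endo)
    fix X
    show "((\<lambda>h. app (endo (E h) * ?\<Delta>) X) \<longlongrightarrow> app ?\<Delta> X) (at_right 0)"
      using E_lim[of "app ?\<Delta> X"]
      by (rule Lim_transform_eventually) (use ev in eventually_elim, simp add: app_ch ch)
  qed
  then have "\<forall>\<^sub>F h in at_right 0. norm (endo (E h) * ?\<Delta>) < norm ?\<Delta> + 1"
    by (intro order_tendstoD(2)[OF tendsto_norm]) auto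
  then have "\<forall>\<^sub>F h in at_right 0. norm (endo (E h) * ?\<Delta>) \<le> norm ?\<Delta> + 1"
    by (rule eventually_mono) simp
  ultimately have eq: "endo (M t) * ?\<Delta> = endo (E t) * ?\<Delta>" if "0 < t" for t
    using that semigroup_eqI[of "\<lambda>t. endo (M t) * ?\<Delta>" "\<lambda>t. endo (E t) * ?\<Delta>",
        OF semi[OF ch(1) self(1) cl(1)] semi[OF ch(2) self(2) cl(2)]]
    by blast
  have pos: "M t (A \<otimes> munit s s) = E t (A \<otimes> munit s s)" if "0 < t" for t A s
    using arg_cong[OF eq[OF that], of "\<lambda>f. app f (A \<otimes> munit s s)"] that
    by (simp add: app_\<Delta> app_ch ch)
  \<comment> \<open>Time 0 is separate, as \<open>M\<close> is not assumed continuous there: by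
    self-timing \<open>M 0\<close> fixes every \<open>E t ?X\<close> with \<open>t > 0\<close>, and
    these tend to \<open>?X\<close>.\<close>
  have zero: "M 0 (A \<otimes> munit s s) = A \<otimes> munit s s" for A s
  proof (rule tendsto_unique[OF _ _ E_lim])
    let ?X = "A \<otimes> munit s s"
    have "bounded_linear (M 0)" using channelD(2)[OF ch(1)] by (simp add: linear_conv_bounded_linear)
    from bounded_linear.tendsto[OF this E_lim[of ?X]]
    show "((\<lambda>t. E t ?X) \<longlongrightarrow> M 0 ?X) (at_right 0)"
    proof (rule Lim_transform_eventually)
      have "M (t + 0) = M 0 \<circ> M t" if "0 < t" for t
        using self(1) that unfolding self_timing_def by (meson less_imp_le order_refl)
      then have "M t = M 0 \<circ> M t" if "0 < t" for t using that by simp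
      then have "M 0 (E t ?X) = E t ?X" if "0 < t" for t
        using that pos[OF that, of A s] by (metis comp_apply)
      then show "\<forall>\<^sub>F t in at_right 0. M 0 (E t ?X) = E t ?X"
        using ev by (auto elim: eventually_mono)
    qed
  qed simp
  show ?thesis
    unfolding agree_on_ticks_def from_tick_def ketbra_munit
    using pos zero E0 by (metis id_apply less_eq_real_def)
qed

end

lemma psd_sum: "(\<And>k. k \<in> I \<Longrightarrow> psd (f k)) \<Longrightarrow> psd (\<Sum>k\<in>I. f k)"
  by (induction I rule: infinite_finite_induct) (auto intro: psd_add)

lemma (in clock_dynamics) E_tendsto: "((\<lambda>t. E t X) \<longlongrightarrow> X) (at_right 0)"
  using has_vector_derivative_continuous[OF superop_exp_deriv[OF gen_linear, of X 0 "{0<..}"]]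
  by (simp add: continuous_within superop_exp_zero[OF gen_linear])

context tick_register
begin

text \<open>Dephasing is continuous and fixes every difference quotient. This removes the
  \<open>dephase\<close> left by \<open>periodic_clock_generator\<close>.\<close>

lemma classical_derivative:
  fixes M :: "('c::finite, 'r) dynamics"
  assumes cl: "classical_register tick NT M" and ch: "\<And>t. 0 \<le> t \<Longrightarrow> channel (M t)"
    and lim: "((\<lambda>h. (M h (A \<otimes> munit s s) - A \<otimes> munit s s) /\<^sub>R h) \<longlongrightarrow> D) (at_right 0)"
  shows "dephase D = D"
proof (rule tendsto_unique[OF _ _ lim])
  have "bounded_linear (dephase :: ('c \<times> 'r) operator \<Rightarrow> _)"
    using clinear_map_linear[OF dephase_clinear] by (simp add: linear_conv_bounded_linear)
  from bounded_linear.tendsto[OF this lim]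
  show "((\<lambda>h. (M h (A \<otimes> munit s s) - A \<otimes> munit s s) /\<^sub>R h) \<longlongrightarrow> dephase D) (at_right 0)"
  proof (rule Lim_transform_eventually)
    have "\<forall>\<^sub>F h :: real in at_right 0. 0 < h" by (simp add: eventually_at_filter)
    then show "\<forall>\<^sub>F h in at_right 0. dephase ((M h (A \<otimes> munit s s) - A \<otimes> munit s s) /\<^sub>R h)
        = (M h (A \<otimes> munit s s) - A \<otimes> munit s s) /\<^sub>R h"
      by eventually_elim
        (simp add: clinear_mapD[OF dephase_clinear] linear_diff[OF clinear_map_linear[OF dephase_clinear]]
          classical_dephase[OF cl ch])
  qed
qed simp

text \<open>
  The probability of having left \<open>|NT>\<close> is subadditive in time and \<open>o(t)\<close>, hence zero.
\<close>

lemma cutoff_end_invariant: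
  fixes M :: "('c::finite, 'r) dynamics" and A :: "'c operator"
  assumes ch: "\<And>t. 0 \<le> t \<Longrightarrow> channel (M t)" and self: "self_timing M"
    and cl: "classical_register tick NT M"
    and leak: "\<And>\<rho>. density_op \<rho> \<Longrightarrow>
      ((\<lambda>h. (ptrace_C (M h (\<rho> \<otimes> munit (tick NT) (tick NT))) - munit (tick NT) (tick NT)) /\<^sub>R h) \<longlongrightarrow> 0) (at_right 0)"
    and t: "0 < t" and r: "r \<noteq> tick NT"
  shows "block r (M t (A \<otimes> munit (tick NT) (tick NT))) = 0"
proof -
  have ev: "\<forall>\<^sub>F t :: real in at_right 0. 0 < t" by (simp add: eventually_at_filter)
  define N where "N = tick NT"
  define R where "R = UNIV - {N}"
  define Lk where "Lk h A = (\<Sum>r\<in>R. block r (M h (A \<otimes> munit N N)))" for h A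
  have Lk_clinear: "clinear_map (Lk h)" if "0 \<le> h" for h
    by (simp add: clinear_map_def Lk_def tensor_add tensor_cscale clinear_mapD[OF channelD(1)[OF ch[OF that]]]
        block_add block_cscale sum.distrib cscale_sum)
  have trace_split: "trace X = trace (block N X) + (\<Sum>r\<in>R. trace (block r X))" for X :: "('c \<times> 'r) operator"
    unfolding trace_block R_def by (rule sum.remove) auto
  \<comment> \<open>By trace preservation the leaked trace of a state is minus the deviation of the
    \<open>|NT>\<close> entry of the reduced register state, which \<open>leak\<close>
    controls.\<close>
  have Lk_lim: "((\<lambda>h. trace (Lk h A) /\<^sub>R h) \<longlongrightarrow> 0) (at_right 0)" for A
  proof (induction A rule: density_op_induct)
    case (density \<rho>)
    have "((\<lambda>h. - (((ptrace_C (M h (\<rho> \<otimes> munit N N)) - munit N N) /\<^sub>R h) $ N $ N)) \<longlongrightarrow> - (0 $ N $ N)) (at_right 0)"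
      using leak[OF density] unfolding N_def by (intro tendsto_minus tendsto_operator_nth)
    then have "((\<lambda>h. - (((ptrace_C (M h (\<rho> \<otimes> munit N N)) - munit N N) /\<^sub>R h) $ N $ N)) \<longlongrightarrow> 0) (at_right 0)"
      by simp
    then show ?case
    proof (rule Lim_transform_eventually)
      have "- ((ptrace_C (M h (\<rho> \<otimes> munit N N)) - munit N N) $ N $ N) = trace (Lk h \<rho>)" if "0 < h" for h
        using density trace_split[of "M h (\<rho> \<otimes> munit N N)"] that
        by (simp add: channelD(4)[OF ch] trace_tensor density_op_def ptrace_C_nth Lk_def trace_sum munit_nth)
          (metis add_diff_cancel_left')
      then show "\<forall>\<^sub>F h in at_right 0. - (((ptrace_C (M h (\<rho> \<otimes> munit N N)) - munit N N) /\<^sub>R h) $ N $ N) = trace (Lk h \<rho>) /\<^sub>R h"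
        using ev by (auto elim!: eventually_mono simp flip: scaleR_minus_right)
    qed
  next
    case (add A B)
    have "((\<lambda>h. trace (Lk h A) /\<^sub>R h + trace (Lk h B) /\<^sub>R h) \<longlongrightarrow> 0 + 0) (at_right 0)"
      by (intro tendsto_add add)
    then have "((\<lambda>h. trace (Lk h A) /\<^sub>R h + trace (Lk h B) /\<^sub>R h) \<longlongrightarrow> 0) (at_right 0)" by simp
    then show ?case
      by (rule Lim_transform_eventually)
        (use ev in eventually_elim, simp add: clinear_mapD[OF Lk_clinear] trace_add scaleR_add_right)
  next
    case (scale c A)
    have "((\<lambda>h. c * (trace (Lk h A) /\<^sub>R h)) \<longlongrightarrow> c * 0) (at_right 0)"
      by (intro tendsto_mult tendsto_const scale)
    then have "((\<lambda>h. c * (trace (Lk h A) /\<^sub>R h)) \<longlongrightarrow> 0) (at_right 0)" by simp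
    then show ?case
      by (rule Lim_transform_eventually)
        (use ev in eventually_elim, simp add: clinear_mapD[OF Lk_clinear] trace_cscale)
  qed
  \<comment> \<open>A leak bound uniform in the state: \<open>step\<close> applies it to the
    clockwork state reached at time \<open>s\<close>, not to the initial one.\<close>
  define q where "q h = (\<Sum>i\<in>UNIV. \<Sum>j\<in>UNIV. norm (trace (Lk h (munit i j))))" for h
  have q0: "0 \<le> q h" for h unfolding q_def by (intro sum_nonneg) auto
  have "((\<lambda>h. \<Sum>i\<in>UNIV. \<Sum>j\<in>UNIV. norm (trace (Lk h (munit i j)) /\<^sub>R h)) \<longlongrightarrow> (\<Sum>i\<in>(UNIV::'c set). \<Sum>j\<in>(UNIV::'c set). norm (0::complex))) (at_right 0)"
    by (intro tendsto_sum tendsto_norm Lk_lim)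
  then have "((\<lambda>h. \<Sum>i\<in>UNIV. \<Sum>j\<in>UNIV. norm (trace (Lk h (munit i j)) /\<^sub>R h)) \<longlongrightarrow> 0) (at_right 0)" by simp
  then have q_lim: "((\<lambda>h. q h / h) \<longlongrightarrow> 0) (at_right 0)"
    by (rule Lim_transform_eventually)
      (use ev in eventually_elim, simp add: q_def sum_distrib_left divide_inverse_commute)
  have psd_M: "psd (M h X)" if "0 \<le> h" "psd X" for h X
    using completely_positive_psd[OF channelD(3)[OF ch[OF that(1)]] that(2)] .
  have block_le: "(\<Sum>r\<in>R. Re (trace (block r X))) \<le> Re (trace X)" "Re (trace (block N X)) \<le> Re (trace X)"
    if "psd X" for X :: "('c \<times> 'r) operator"
    using psd_trace_nonneg[OF psd_block[OF that]] sum_nonneg[of R "\<lambda>r. Re (trace (block r X))"]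
    unfolding trace_split[of X] by (auto simp: Re_sum)
  have Lk_le: "Re (trace (Lk h A)) \<le> q h * Re (trace A)" if "0 \<le> h" "psd A" for h A
    using clinear_trace_bound[OF Lk_clinear[OF that(1)] that(2)] complex_Re_le_cmod[of "trace (Lk h A)"]
    unfolding q_def by linarith
  \<comment> \<open>Whatever is outside \<open>|NT>\<close> after \<open>s + h\<close> either left
    it during the last \<open>h\<close>, or was outside after \<open>s\<close>; the latter part
    cannot grow, since channels preserve the trace.\<close>
  have step: "Re (trace (Lk (s + h) A)) \<le> q h * Re (trace A) + Re (trace (Lk s A))"
    if s: "0 \<le> s" and h: "0 \<le> h" and A: "psd A" for s h A
  proof -
    define X where "X = M s (A \<otimes> munit N N)"
    define Y where "Y = (\<Sum>r\<in>R. block r X \<otimes> munit r r)"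
    have psd_X: "psd X" unfolding X_def by (intro psd_M psd_tensor s A)
    have "dephase X = X" unfolding X_def by (rule classical_dephase[OF cl ch[OF s] s])
    then have X: "X = block N X \<otimes> munit N N + Y"
      unfolding Y_def R_def dephase_def by (subst (asm) sum.remove[of _ N]) auto
    have psd_Y: "psd Y" unfolding Y_def by (intro psd_sum psd_tensor psd_block psd_X)
    have "M (s + h) (A \<otimes> munit N N) = M h X"
      using self s h by (simp add: self_timing_def X_def)
    also have "\<dots> = M h (block N X \<otimes> munit N N) + M h Y"
      by (subst X) (rule clinear_mapD[OF channelD(1)[OF ch[OF h]]])
    finally have "Re (trace (Lk (s + h) A)) = Re (trace (Lk h (block N X))) + (\<Sum>r\<in>R. Re (trace (block r (M h Y))))"
      by (simp add: Lk_def trace_sum block_add trace_add sum.distrib Re_sum)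
    also have "Re (trace (Lk h (block N X))) \<le> q h * Re (trace (block N X))"
      by (intro Lk_le h psd_block psd_X)
    also have "\<dots> \<le> q h * Re (trace X)" by (intro mult_left_mono q0 block_le psd_X)
    also have "Re (trace X) = Re (trace A)" by (simp add: X_def channelD(4)[OF ch[OF s]] trace_tensor)
    also have "(\<Sum>r\<in>R. Re (trace (block r (M h Y)))) \<le> Re (trace (M h Y))"
      by (intro block_le psd_M h psd_Y)
    also have "Re (trace (M h Y)) = Re (trace (Lk s A))"
      by (simp add: channelD(4)[OF ch[OF h]] Y_def Lk_def X_def trace_sum trace_tensor)
    finally show ?thesis by simp
  qed
  have Lk_0: "Re (trace (Lk t A)) = 0" if A: "psd A" for A
  proof -
    \<comment> \<open>With \<open>h = t / Suc n\<close> the right-hand side is \<open>t\<close>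
      times the trace of \<open>A\<close> times \<open>q h / h\<close>, which tends to 0.\<close>
    have mult: "Re (trace (Lk (real (Suc n) * h) A)) \<le> real (Suc n) * (q h * Re (trace A))" if h: "0 \<le> h" for n h
    proof (induction n)
      case 0
      then show ?case using Lk_le[OF h A] by simp
    next
      case (Suc n)
      have "real (Suc (Suc n)) * h = real (Suc n) * h + h" by (simp add: algebra_simps)
      then show ?case using Suc step[of "real (Suc n) * h" h A] h A by (simp add: algebra_simps)
    qed
    define h where "h n = t / real (Suc n)" for n
    have h_pos: "0 < h n" for n using t by (simp add: h_def)
    have "(h \<longlongrightarrow> 0) sequentially"
      unfolding h_def by (intro LIMSEQ_Suc[of "\<lambda>n. t / real n" 0] lim_const_over_n)
    then have "filterlim h (at_right 0) sequentially"
      using h_pos by (auto simp: filterlim_at intro!: always_eventually dest: less_imp_neq[THEN not_sym])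
    from filterlim_compose[OF q_lim this]
    have "(\<lambda>n. t * Re (trace A) * (q (h n) / h n)) \<longlonglongrightarrow> t * Re (trace A) * 0"
      by (intro tendsto_intros)
    moreover have "Re (trace (Lk t A)) \<le> t * Re (trace A) * (q (h n) / h n)" for n
    proof -
      have n: "real (Suc n) * h n = t" by (simp add: h_def)
      have "real (Suc n) * (q (h n) * Re (trace A)) = t * Re (trace A) * (q (h n) / h n)"
        unfolding n[symmetric] using h_pos[of n] by (simp add: field_simps)
      then show ?thesis using mult[OF less_imp_le[OF h_pos[of n]], of n] unfolding n by simp
    qed
    ultimately have "Re (trace (Lk t A)) \<le> t * Re (trace A) * 0"
      by (intro tendsto_lowerbound[of _ _ sequentially]) auto
    moreover have "0 \<le> Re (trace (Lk t A))"
      unfolding Lk_def using t by (intro psd_trace_nonneg psd_sum psd_block psd_M psd_tensor A) auto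
    ultimately show ?thesis by simp
  qed
  show ?thesis
    unfolding N_def[symmetric]
  proof (induction A rule: density_op_induct)
    case (density \<rho>)
    then have psd: "psd (block r (M t (\<rho> \<otimes> munit N N)))" for r
      using t by (intro psd_block psd_M psd_tensor) (auto simp: density_op_def)
    have "(\<Sum>r\<in>R. Re (trace (block r (M t (\<rho> \<otimes> munit N N))))) = 0"
      using Lk_0[of \<rho>] density by (simp add: density_op_def Lk_def trace_sum Re_sum)
    then have "\<forall>r\<in>R. Re (trace (block r (M t (\<rho> \<otimes> munit N N)))) = 0"
      using psd_trace_nonneg[OF psd] by (subst (asm) sum_nonneg_eq_0_iff) auto
    then show ?case using psd_trace_zero[OF psd] r by (simp add: R_def N_def)
  qed (use t in \<open>simp_all add: tensor_add tensor_cscale clinear_mapD[OF channelD(1)[OF ch]] block_add block_cscale\<close>)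
qed

section \<open>Explicit form of classical clocks\<close>

lemma tendsto_quotient_clinear:
  fixes M M' :: "('c::finite, 'r) dynamics"
  assumes ch: "\<And>t. 0 \<le> t \<Longrightarrow> channel (M t)" "\<And>t. 0 \<le> t \<Longrightarrow> channel (M' t)"
    and dens: "\<And>\<rho>. density_op \<rho> \<Longrightarrow> ((\<lambda>h. (M h (\<rho> \<otimes> munit s s) - M' h (\<rho> \<otimes> munit s s)) /\<^sub>R h) \<longlongrightarrow> 0) (at_right 0)"
  shows "((\<lambda>h. (M h (A \<otimes> munit s s) - M' h (A \<otimes> munit s s)) /\<^sub>R h) \<longlongrightarrow> 0) (at_right 0)"
proof (induction A rule: density_op_induct)
  case (add A B)
  have ev: "\<forall>\<^sub>F t :: real in at_right 0. 0 < t" by (simp add: eventually_at_filter)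
  from tendsto_add[OF add] have "((\<lambda>h. (M h (A \<otimes> munit s s) - M' h (A \<otimes> munit s s)) /\<^sub>R h
      + (M h (B \<otimes> munit s s) - M' h (B \<otimes> munit s s)) /\<^sub>R h) \<longlongrightarrow> 0) (at_right 0)" by simp
  then show ?case
    by (rule Lim_transform_eventually)
      (use ev in eventually_elim, simp add: tensor_add clinear_mapD[OF channelD(1)[OF ch(1)]] clinear_mapD[OF channelD(1)[OF ch(2)]] algebra_simps)
next
  case (scale c A)
  have ev: "\<forall>\<^sub>F t :: real in at_right 0. 0 < t" by (simp add: eventually_at_filter)
  from tendsto_cscale[OF scale, of c] have "((\<lambda>h. c *\<^sub>c ((M h (A \<otimes> munit s s) - M' h (A \<otimes> munit s s)) /\<^sub>R h)) \<longlongrightarrow> 0) (at_right 0)" by simp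
  then show ?case
    by (rule Lim_transform_eventually)
      (use ev in eventually_elim, simp add: tensor_cscale clinear_mapD[OF channelD(1)[OF ch(1)]] clinear_mapD[OF channelD(1)[OF ch(2)]] cscale_scaleR cscale_minus)
qed (rule dens)

lemma periodic_clock_explicit:
  fixes M :: "('c::finite, 'r) dynamics"
  assumes per: "periodic_clock_channels tick NT M" and cl: "classical_register tick NT M"
  shows "\<exists>(H :: 'c operator) NL L J. hermitian H \<and>
    agree_on_ticks tick NT M (superop_exp (clock_generator Periodic tick NT H NL L J))"
proof -
  obtain G and H :: "'c operator" and NL L J
    where Glim: "\<And>X. ((\<lambda>h. (M h X - X) /\<^sub>R h) \<longlongrightarrow> G X) (at_right 0)" and H: "hermitian H"
      and G: "\<And>s A. dephase (G (A \<otimes> munit s s)) = clock_generator Periodic tick NT H NL L J (A \<otimes> munit s s)"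
    using periodic_clock_generator[OF per] by blast
  have ch: "\<And>t. 0 \<le> t \<Longrightarrow> channel (M t)" and self: "self_timing M"
    using per by (auto simp: periodic_clock_channels_def)
  interpret clock_dynamics tick NT Periodic H NL L J by unfold_locales (rule H)
  have "agree_on_ticks tick NT M E"
  proof (rule agree_on_ticksI[OF ch E_channel self M_self_timing[OF refl] cl M_classical[OF refl] _ E_tendsto])
    show "E 0 = id" by (simp add: fun_eq_iff superop_exp_zero[OF gen_linear])
    fix A s
    have "G (A \<otimes> munit s s) = gen (A \<otimes> munit s s)"
      using G classical_derivative[OF cl ch Glim] by metis
    then show "((\<lambda>h. (M h (A \<otimes> munit s s) - E h (A \<otimes> munit s s)) /\<^sub>R h) \<longlongrightarrow> 0) (at_right 0)"
      using Glim[of "A \<otimes> munit s s"] superop_exp_deriv_0[OF gen_linear, of "A \<otimes> munit s s"]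
      by (intro tendsto_quotient_diff[where X = "A \<otimes> munit s s"]) simp_all
  qed
  then show ?thesis using H by blast
qed

text \<open>The last register state decides the case: either the clockwork states reached from it
  differ, which is clockwork equivalence, or they agree and so do the dynamics on all register
  states.\<close>

lemma cutoff_clock_explicit:
  fixes M :: "('c::finite, 'r) dynamics"
  assumes clock: "ticking_clock Cutoff tick NT \<rho>0 M" and cl: "classical_register tick NT M"
  shows "\<exists>(H :: 'c operator) NL L J. hermitian H \<and>
    (agree_on_ticks tick NT M (superop_exp (clock_generator Cutoff tick NT H NL L J)) \<or>
     clockwork_equivalent tick NT \<rho>0 M \<rho>0 (superop_exp (clock_generator Cutoff tick NT H NL L J)))"
proof -
  let ?e = "munit (tick NT) (tick NT)"
  have ev: "\<forall>\<^sub>F t :: real in at_right 0. 0 < t" by (simp add: eventually_at_filter)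
  have \<rho>0: "density_op \<rho>0" and ch: "\<And>t. 0 \<le> t \<Longrightarrow> channel (M t)" and self: "self_timing M"
    using clock by auto
  obtain M' where up: "underlying_periodic tick NT M M'" using clock by auto
  then have per: "periodic_clock_channels tick NT M'" by (simp add: underlying_periodic_def)
  then have ch': "\<And>t. 0 \<le> t \<Longrightarrow> channel (M' t)" by (simp add: periodic_clock_channels_def)
  obtain G and H :: "'c operator" and NL L J
    where Glim: "\<And>X. ((\<lambda>h. (M' h X - X) /\<^sub>R h) \<longlongrightarrow> G X) (at_right 0)" and H: "hermitian H"
      and G: "\<And>s A. dephase (G (A \<otimes> munit s s)) = clock_generator Periodic tick NT H NL L J (A \<otimes> munit s s)"
    using periodic_clock_generator[OF per] by blast
  interpret P: clock_dynamics tick NT Periodic H NL L J by unfold_locales (rule H)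
  interpret C: clock_dynamics tick NT Cutoff H NL L J by unfold_locales (rule H)
  have M_lim: "((\<lambda>h. (M h (A \<otimes> munit (tick k) (tick k)) - A \<otimes> munit (tick k) (tick k)) /\<^sub>R h)
      \<longlongrightarrow> P.gen (A \<otimes> munit (tick k) (tick k))) (at_right 0)" if k: "k < NT" for k A
  proof -
    let ?X = "A \<otimes> munit (tick k) (tick k)"
    have "((\<lambda>h. (M h ?X - M' h ?X) /\<^sub>R h) \<longlongrightarrow> 0) (at_right 0)"
    proof (rule tendsto_quotient_clinear[OF ch ch'])
      show "((\<lambda>h. (M h (\<rho> \<otimes> munit (tick k) (tick k)) - M' h (\<rho> \<otimes> munit (tick k) (tick k))) /\<^sub>R h) \<longlongrightarrow> 0) (at_right 0)"
        if "density_op \<rho>" for \<rho>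
        using up k that unfolding underlying_periodic_def smallo_norm_iff from_tick_def ketbra_munit by blast
    qed
    from tendsto_add[OF this Glim[of ?X]]
    have lim: "((\<lambda>h. (M h ?X - ?X) /\<^sub>R h) \<longlongrightarrow> G ?X) (at_right 0)" by (simp add: algebra_simps)
    moreover have "G ?X = P.gen ?X" using G classical_derivative[OF cl ch lim] by metis
    ultimately show ?thesis by simp
  qed
  have leak: "((\<lambda>h. (ptrace_C (M h (\<rho> \<otimes> ?e)) - ?e) /\<^sub>R h) \<longlongrightarrow> 0) (at_right 0)" if "density_op \<rho>" for \<rho>
    using up that unfolding underlying_periodic_def smallo_norm_iff from_tick_def ketbra_munit by blast
  have E_up: "underlying_periodic tick NT C.E P.E"
    by (rule cutoff_underlying_periodic[OF H refl])
  have "((\<lambda>h. (M h (A \<otimes> munit (tick k) (tick k)) - P.E h (A \<otimes> munit (tick k) (tick k))) /\<^sub>R h) \<longlongrightarrow> 0) (at_right 0)"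
    if "k < NT" for k A
    by (rule tendsto_quotient_diff[OF M_lim[OF that] superop_exp_deriv_0[OF P.gen_linear]])
  moreover have "periodic_clock_channels tick NT P.E" using E_up by (simp add: underlying_periodic_def)
  \<comment> \<open>The common underlying clock is the explicit \<open>P.E\<close> rather than the
    given \<open>M'\<close>: below \<open>|NT>\<close> the classical register of \<open>M\<close>
    forces its derivative to be the explicit one.\<close>
  ultimately have M_up: "underlying_periodic tick NT M P.E"
    unfolding underlying_periodic_def smallo_norm_iff from_tick_def ketbra_munit using leak by blast
  show ?thesis
  proof (cases "\<exists>t\<ge>0. \<exists>\<rho>. density_op \<rho> \<and>
      ptrace_R (from_tick tick M t NT \<rho>) \<noteq> ptrace_R (from_tick tick C.E t NT \<rho>)")
    case True
    moreover have "ticking_clock Cutoff tick NT \<rho>0 C.E"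
      by (rule explicit_dynamics_clock(1)[OF H \<rho>0 refl])
    ultimately have "clockwork_equivalent tick NT \<rho>0 M \<rho>0 C.E"
      using clock E_up M_up unfolding clockwork_equivalent_def by blast
    then show ?thesis using H by blast
  next
    case False
    \<comment> \<open>Neither dynamics ever leaves \<open>|NT>\<close>, so the reduced clockwork
      state determines the whole state.\<close>
    have M_end: "M t (\<rho> \<otimes> ?e) = C.E t (\<rho> \<otimes> ?e)" if t: "0 < t" and \<rho>: "density_op \<rho>" for t \<rho>
    proof (rule dephase_eqI)
      show deph: "dephase (M t (\<rho> \<otimes> ?e)) = M t (\<rho> \<otimes> ?e)" "dephase (C.E t (\<rho> \<otimes> ?e)) = C.E t (\<rho> \<otimes> ?e)"
        using classical_dephase[OF cl ch] C.dephase_E[OF dephase_tensor] t by simp_all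
      have end_form: "X = block (tick NT) X \<otimes> ?e"
        if "dephase X = X" "\<And>r. r \<noteq> tick NT \<Longrightarrow> block r X = 0" for X :: "('c \<times> 'r) operator"
        by (rule dephase_eqI) (use that in \<open>auto simp: block_tensor\<close>)
      have "ptrace_R (M t (\<rho> \<otimes> ?e)) = ptrace_R (C.E t (\<rho> \<otimes> ?e))"
        using False t \<rho> unfolding from_tick_def ketbra_munit by (meson less_imp_le)
      moreover have "ptrace_R (M t (\<rho> \<otimes> ?e)) = block (tick NT) (M t (\<rho> \<otimes> ?e))"
        using arg_cong[OF end_form[OF deph(1) cutoff_end_invariant[OF ch self cl leak t]], of ptrace_R]
        unfolding ptrace_R_tensor .
      moreover have "ptrace_R (C.E t (\<rho> \<otimes> ?e)) = block (tick NT) (C.E t (\<rho> \<otimes> ?e))"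
        using arg_cong[OF end_form[OF deph(2) cutoff_exp_end[OF H]], of ptrace_R]
        unfolding ptrace_R_tensor .
      ultimately show "block r (M t (\<rho> \<otimes> ?e)) = block r (C.E t (\<rho> \<otimes> ?e))" for r
        using cutoff_end_invariant[OF ch self cl leak t, of r] cutoff_exp_end[OF H, of r]
        by (cases "r = tick NT") simp_all
    qed
    have "agree_on_ticks tick NT M C.E"
    proof (rule agree_on_ticksI[OF ch C.E_channel self C.M_self_timing[OF refl] cl C.M_classical[OF refl] _ C.E_tendsto])
      show "C.E 0 = id" by (simp add: fun_eq_iff superop_exp_zero[OF C.gen_linear])
      fix A s
      obtain k where k: "k \<le> NT" "s = tick k" by (rule tick_cases)
      show "((\<lambda>h. (M h (A \<otimes> munit s s) - C.E h (A \<otimes> munit s s)) /\<^sub>R h) \<longlongrightarrow> 0) (at_right 0)"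
      proof (cases "k = NT")
        case True
        show ?thesis
          unfolding k(2) True
        proof (rule tendsto_quotient_clinear[OF ch C.E_channel])
          fix \<rho> :: "'c operator" assume "density_op \<rho>"
          then show "((\<lambda>h. (M h (\<rho> \<otimes> ?e) - C.E h (\<rho> \<otimes> ?e)) /\<^sub>R h) \<longlongrightarrow> 0) (at_right 0)"
            by (intro tendsto_eventually) (use ev in eventually_elim, simp add: M_end)
        qed
      next
        case False
        then have "k < NT" using k by simp
        then show ?thesis
          unfolding k(2) using superop_exp_deriv_0[OF C.gen_linear, of "A \<otimes> munit (tick k) (tick k)"]
          by (intro tendsto_quotient_diff[OF M_lim]) (simp_all add: cutoff_generator_lt)
      qed
    qed
    then show ?thesis using H by blast
  qed
qed

end

theorem proposition2:
  fixes reg :: register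
    and tick :: "nat \<Rightarrow> 'r::finite"
    and NT :: nat
    and \<rho>0 :: "('c::finite \<times> 'r) operator"
    and M :: "('c, 'r) dynamics"
  assumes "NT > 0"
    and "tick_labelling tick NT"
    and "density_op \<rho>0"
  shows
    "(ticking_clock reg tick NT \<rho>0 M \<and> classical_register tick NT M \<longrightarrow>
       (\<exists>(H :: 'c operator) NL L J. hermitian H \<and>
          (let E = superop_exp (clock_generator reg tick NT H NL L J)
           in agree_on_ticks tick NT M E \<or>
              (reg = Cutoff \<and> clockwork_equivalent tick NT \<rho>0 M \<rho>0 E)))) \<and>
     ((\<exists>(H :: 'c operator) NL L J. hermitian H \<and>
          (\<forall>t\<ge>0. M t = superop_exp (clock_generator reg tick NT H NL L J) t)) \<longrightarrow>
       ticking_clock reg tick NT \<rho>0 M \<and> classical_register tick NT M)"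
proof -
  interpret tick_register tick NT using assms by unfold_locales
  show ?thesis
  proof (intro conjI impI)
    assume M: "ticking_clock reg tick NT \<rho>0 M \<and> classical_register tick NT M"
    show "\<exists>(H :: 'c operator) NL L J. hermitian H \<and>
        (let E = superop_exp (clock_generator reg tick NT H NL L J)
         in agree_on_ticks tick NT M E \<or> (reg = Cutoff \<and> clockwork_equivalent tick NT \<rho>0 M \<rho>0 E))"
    proof (cases reg)
      case Periodic
      then show ?thesis using periodic_clock_explicit M unfolding Let_def by fastforce
    next
      case Cutoff
      then show ?thesis using cutoff_clock_explicit M unfolding Let_def by fastforce
    qed
  qed (use explicit_dynamics_clock[OF _ assms(3)] in blast)+
qed

end
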